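(* Let $\alpha\in(0,1)$. (a) Lower bound. Suppose that $u\in B^{\alpha}_{1,\infty}(\mathbb{T})$ is mixing on the scale $H^{1/2}(\mathbb{T};\mathbb{C})$ with rate $r$. Then there is a constant $C>0$ such that $r(t)\le C\,t^{\frac{1}{2\alpha}}$ for all $t\ge1$. (b) Upper bound. Almost every $u\in B^{\alpha}_{1,\infty}(\mathbb{T})$ (in the sense of prevalence) satisfies the following property: for any $\tilde\alpha>\alpha$, $u$ is mixing on the scale $H^{1/2}(\mathbb{T};\mathbb{C})$ with a rate $r$ satisfying $r(t)\ge c\,t^{\frac{1}{2\tilde\alpha}}$ for all $t\ge1$, for some constant $c>0$.
   Context: $\mathbb{T}=\mathbb{R}/2\pi\mathbb{Z}$ with canonical distance $d_{\mathbb{T}}$. $H^s(\mathbb{T};\mathbb{C})$ are the usual Sobolev spaces. For $\alpha\in(0,1)$, $B^\alpha_{1,\infty}(\mathbb{T})$ is the Banach space of $u\in L^1(\mathbb{T};\mathbb{R})$ with finite norm $\|u\|_{L^1}+\sup_{x\ne y}\frac{\|u(\cdot+x)-u(\cdot+y)\|_{L^1}}{d_{\mathbb{T}}(x,y)^{\alpha}}$. Mixing: a rate is a continuous increasing function $r:\mathbb{R}_{\ge0}\to\mathbb{R}_{\ge0}$. A function $u\in L^1(\mathbb{T})$ is mixing on the scale $H^s(\mathbb{T};\mathbb{C})$, $s\ge0$, with rate $r$ if there is a constant $C>0$ such that $$\|e^{-itku}\|_{H^s\to H^{-s}}\le \frac{C}{r(t|k|)}\qquad\forall\,k\in\mathbb{Z}\setminus\{0\},\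 t\ge1,$$ where $e^{-itku}$ denotes the multiplication operator $g\mapsto e^{-itku(\cdot)}g(\cdot)$. Prevalence: let $E$ be a Banach space. A Borel set $A\subset E$ is shy if there is a Borel measure $\mu$ on $E$ such that (i) there is a compact $K\subset E$ with $0<\mu(K)<\infty$ and (ii) $\mu(v+A)=0$ for every $v\in E$. An arbitrary subset is shy if it is contained in a shy Borel set; a set is prevalent if its complement is shy. "Almost every $u\in E$ satisfies a property" means that the set of such $u$ is prevalent. *)

theory Defs
  imports "HOL-Analysis.Analysis"
begin

section \<open>Integrable functions on the torus\<close>

text \<open>Functions on \<open>\<real>/2\<pi>\<int>\<close> are \<open>2\<pi>\<close>-periodic functions on \<open>\<real>\<close>; the measure is Lebesgue measure on
  \<open>[0, 2\<pi>]\<close>, of total mass \<open>2\<pi>\<close>.\<close>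

definition torus_integrable :: "(real \<Rightarrow> 'a::{banach, second_countable_topology}) \<Rightarrow> bool" where
  "torus_integrable f \<longleftrightarrow>
     f \<in> borel_measurable borel \<and> (\<forall>x. f (x + 2 * pi) = f x) \<and> set_integrable lborel {0..2 * pi} f"

definition torus_ae_eq ::
  "(real \<Rightarrow> 'a::{banach, second_countable_topology}) \<Rightarrow> (real \<Rightarrow> 'a) \<Rightarrow> bool" where
  "torus_ae_eq f g \<longleftrightarrow> torus_integrable f \<and> torus_integrable g \<and> (AE x in lborel. f x = g x)"

lemma torus_integrable_measurable [measurable_dest]:
  "torus_integrable f \<Longrightarrow> f \<in> borel_measurable borel"
  by (simp add: torus_integrable_def)

lemma torus_integrable_zero: "torus_integrable (\<lambda>_. 0)"
  by (simp add: torus_integrable_def set_integrable_def)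

lemma torus_integrable_add:
  "torus_integrable f \<Longrightarrow> torus_integrable g \<Longrightarrow> torus_integrable (\<lambda>x. f x + g x)"
  by (auto simp: torus_integrable_def intro: set_integral_add)

lemma torus_integrable_scaleR:
  "torus_integrable f \<Longrightarrow> torus_integrable (\<lambda>x. c *\<^sub>R f x)"
  by (auto simp: torus_integrable_def)

lemma torus_integrable_uminus:
  "torus_integrable f \<Longrightarrow> torus_integrable (\<lambda>x. - f x)"
  using torus_integrable_scaleR[of f "-1"] by simp

lemma torus_integrable_diff:
  "torus_integrable f \<Longrightarrow> torus_integrable g \<Longrightarrow> torus_integrable (\<lambda>x. f x - g x)"
  using torus_integrable_add[OF _ torus_integrable_uminus, of f g] by simp

lemma periodic_nat:
  assumes "\<forall>x. f (x + 2 * pi) = f x"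
  shows "f (x + 2 * pi * real n) = f x"
proof (induction n)
  case (Suc n)
  have "f (x + 2 * pi * real (Suc n)) = f ((x + 2 * pi * real n) + 2 * pi)"
    by (simp add: algebra_simps)
  then show ?case using assms Suc by simp
qed simp

lemma periodic_int:
  assumes "\<forall>x. f (x + 2 * pi) = f x"
  shows "f (x + 2 * pi * of_int k) = f x"
proof (cases "k \<ge> 0")
  case True
  then show ?thesis using periodic_nat[OF assms, of x "nat k"] by simp
next
  case False
  then show ?thesis
    using periodic_nat[OF assms, of "x + 2 * pi * of_int k" "nat (- k)"] by (simp add: algebra_simps)
qed

lemma torus_integrable_local:
  assumes f: "torus_integrable f"
  shows "set_integrable lborel {a..b} f"
proof -
  have per: "\<forall>x. f (x + 2 * pi) = f x" and int: "set_integrable lborel {0..2 * pi} f"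
    using f by (auto simp: torus_integrable_def)
  have cell: "set_integrable lborel {2 * pi * of_int k..2 * pi * of_int (k + 1)} f" for k :: int
  proof -
    have "integrable lborel (\<lambda>x. indicator {0..2 * pi} (- 2 * pi * of_int k + 1 * x) *\<^sub>R
        f (- 2 * pi * of_int k + 1 * x))"
      by (rule lborel_integrable_real_affine[OF int[unfolded set_integrable_def]]) simp
    also have "(\<lambda>x. indicator {0..2 * pi} (- 2 * pi * of_int k + 1 * x) *\<^sub>R
        f (- 2 * pi * of_int k + 1 * x))
      = (\<lambda>x. indicator {2 * pi * of_int k..2 * pi * of_int (k + 1)} x *\<^sub>R f x)"
    proof
      fix x
      have "f (- 2 * pi * of_int k + 1 * x) = f x"
        using periodic_int[OF per, of x "- k"] by (simp add: algebra_simps)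
      moreover have "(- 2 * pi * of_int k + 1 * x \<in> {0..2 * pi}) =
          (x \<in> {2 * pi * of_int k..2 * pi * of_int (k + 1)})"
        by (auto simp: algebra_simps)
      ultimately show "indicator {0..2 * pi} (- 2 * pi * of_int k + 1 * x) *\<^sub>R
          f (- 2 * pi * of_int k + 1 * x)
        = indicator {2 * pi * of_int k..2 * pi * of_int (k + 1)} x *\<^sub>R f x"
        unfolding indicator_def by simp
    qed
    finally show ?thesis by (simp add: set_integrable_def)
  qed
  have big: "set_integrable lborel {- 2 * pi * real n..2 * pi * real n} f" for n
  proof (induction n)
    case 0
    show ?case by (rule set_integrable_subset[OF int]) auto
  next
    case (Suc n)
    have l: "set_integrable lborel {- 2 * pi * real (Suc n)..- 2 * pi * real n} f"
      using cell[of "- int (Suc n)"] by (simp add: algebra_simps)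
    have r: "set_integrable lborel {2 * pi * real n..2 * pi * real (Suc n)} f"
      using cell[of "int n"] by (simp add: add.commute)
    have "set_integrable lborel ({- 2 * pi * real (Suc n)..- 2 * pi * real n}
        \<union> {- 2 * pi * real n..2 * pi * real n} \<union> {2 * pi * real n..2 * pi * real (Suc n)}) f"
      by (intro set_integrable_Un l r Suc) auto
    then show ?case
      by (rule set_integrable_subset) auto
  qed
  obtain n where n: "max \<bar>a\<bar> \<bar>b\<bar> \<le> real n" using real_arch_simple by blast
  have "real n \<le> 2 * pi * real n"
    using mult_right_mono[of 1 "2 * pi" "real n"] pi_ge_two by simp
  with n have "{a..b} \<subseteq> {- 2 * pi * real n..2 * pi * real n}" by auto
  then show ?thesis by (intro set_integrable_subset[OF big]) auto
qed

lemma torus_integrable_translate: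
  assumes f: "torus_integrable f"
  shows "torus_integrable (\<lambda>x. f (x + h))"
proof -
  have "integrable lborel (\<lambda>x. indicator {h..h + 2 * pi} (h + 1 * x) *\<^sub>R f (h + 1 * x))"
    by (rule lborel_integrable_real_affine
        [OF torus_integrable_local[OF f, unfolded set_integrable_def]]) simp
  also have "(\<lambda>x. indicator {h..h + 2 * pi} (h + 1 * x) *\<^sub>R f (h + 1 * x))
      = (\<lambda>x. indicator {0..2 * pi} x *\<^sub>R f (x + h))"
    by (auto simp: indicator_def add.commute fun_eq_iff)
  finally have "set_integrable lborel {0..2 * pi} (\<lambda>x. f (x + h))"
    by (simp add: set_integrable_def)
  moreover have "f (x + 2 * pi + h) = f (x + h)" for x
    using f by (metis add.assoc add.commute torus_integrable_def)
  moreover have "(\<lambda>x. f (x + h)) \<in> borel_measurable borel"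
    using measurable_compose[OF _ torus_integrable_measurable[OF f], of "\<lambda>x. x + h"] by simp
  ultimately show ?thesis
    unfolding torus_integrable_def by simp
qed

lemma torus_ae_eq_translate:
  assumes "torus_ae_eq f g"
  shows "torus_ae_eq (\<lambda>x. f (x + h)) (\<lambda>x. g (x + h))"
proof -
  have [measurable]: "f \<in> borel_measurable borel" "g \<in> borel_measurable borel"
    using assms by (auto simp: torus_ae_eq_def torus_integrable_def)
  have "AE x in lborel. f (h + 1 * x) = g (h + 1 * x)"
    using assms by (intro AE_borel_affine[where P = "\<lambda>x. f x = g x"]) (auto simp: torus_ae_eq_def)
  then show ?thesis
    using assms by (simp add: torus_ae_eq_def torus_integrable_translate add.commute)
qed

lemma torus_integrable_AE_zero:
  assumes f: "torus_integrable f" and zero: "(LBINT x:{0..2 * pi}. norm (f x)) = 0"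
  shows "AE x in lborel. f x = 0"
proof -
  have per: "\<forall>x. f (x + 2 * pi) = f x" and int: "set_integrable lborel {0..2 * pi} f"
    using f by (auto simp: torus_integrable_def)
  have [measurable]: "f \<in> borel_measurable borel" using f by measurable
  have "integrable lborel (\<lambda>x. indicator {0..2 * pi} x *\<^sub>R norm (f x))"
    using set_integrable_norm[OF int] by (simp add: set_integrable_def)
  then have "AE x in lborel. indicator {0..2 * pi} x *\<^sub>R norm (f x) = 0"
    using zero unfolding set_lebesgue_integral_def
    by (subst (asm) integral_nonneg_eq_0_iff_AE) auto
  then have base: "AE x in lborel. x \<in> {0..2 * pi} \<longrightarrow> f x = 0"
    by eventually_elim (auto simp: indicator_def split: if_splits)
  have "AE x in lborel. (2 * pi * of_int k + 1 * x) \<in> {0..2 * pi} \<longrightarrow> f (2 * pi * of_int k + 1 * x) = 0"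
    for k :: int
    by (rule AE_borel_affine[OF _ _ base]) auto
  then have "AE x in lborel. \<forall>k::int. (2 * pi * of_int k + 1 * x) \<in> {0..2 * pi}
      \<longrightarrow> f (2 * pi * of_int k + 1 * x) = 0"
    by (simp only: AE_all_countable) simp
  then show ?thesis
  proof eventually_elim
    case (elim x)
    define k where "k = - \<lfloor>x / (2 * pi)\<rfloor>"
    have "of_int \<lfloor>x / (2 * pi)\<rfloor> * (2 * pi) \<le> x" "x \<le> (of_int \<lfloor>x / (2 * pi)\<rfloor> + 1) * (2 * pi)"
      by (simp_all add: floor_divide_lower floor_divide_upper less_imp_le)
    then have "2 * pi * of_int k + 1 * x \<in> {0..2 * pi}"
      by (simp add: k_def algebra_simps)
    then have "f (2 * pi * of_int k + 1 * x) = 0" using elim by blast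
    then show ?case using periodic_int[OF per, of x k] by (simp add: add.commute)
  qed
qed

lemma torus_ae_eq_LBINT_cong:
  assumes "torus_ae_eq f g" and "\<And>x. f x = g x \<Longrightarrow> F x = G x"
    and [measurable]: "F \<in> borel_measurable borel" "G \<in> borel_measurable borel"
  shows "(LBINT x:{0..2 * pi}. F x) = (LBINT x:{0..2 * pi}. (G x :: _::{banach, second_countable_topology}))"
  unfolding set_lebesgue_integral_def
proof (rule integral_cong_AE)
  have "AE x in lborel. f x = g x" using assms(1) by (simp add: torus_ae_eq_def)
  then show "AE x in lborel. indicator {0..2 * pi} x *\<^sub>R F x = indicator {0..2 * pi} x *\<^sub>R G x"
    by eventually_elim (simp add: assms(2))
qed measurable

quotient_type (overloaded) 'a torus_L1 =
  "real \<Rightarrow> 'a::{banach, second_countable_topology}" / partial: torus_ae_eq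
proof (rule part_equivpI)
  show "\<exists>f. torus_ae_eq f (f :: real \<Rightarrow> 'a)"
    by (rule exI[of _ "\<lambda>_. 0"]) (simp add: torus_ae_eq_def torus_integrable_zero)
  show "symp (torus_ae_eq :: (real \<Rightarrow> 'a) \<Rightarrow> _)"
    by (auto simp: torus_ae_eq_def symp_def)
  show "transp (torus_ae_eq :: (real \<Rightarrow> 'a) \<Rightarrow> _)"
    by (auto simp: torus_ae_eq_def transp_def)
qed

instantiation torus_L1 :: ("{banach, second_countable_topology}") real_normed_vector
begin

lift_definition zero_torus_L1 :: "'a torus_L1" is "\<lambda>_. 0"
  by (simp add: torus_ae_eq_def torus_integrable_zero)

lift_definition plus_torus_L1 :: "'a torus_L1 \<Rightarrow> 'a torus_L1 \<Rightarrow> 'a torus_L1"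
  is "\<lambda>f g x. f x + g x"
  by (auto simp: torus_ae_eq_def torus_integrable_add)

lift_definition uminus_torus_L1 :: "'a torus_L1 \<Rightarrow> 'a torus_L1" is "\<lambda>f x. - f x"
  by (auto simp: torus_ae_eq_def torus_integrable_uminus)

lift_definition minus_torus_L1 :: "'a torus_L1 \<Rightarrow> 'a torus_L1 \<Rightarrow> 'a torus_L1"
  is "\<lambda>f g x. f x - g x"
  by (auto simp: torus_ae_eq_def torus_integrable_diff)

lift_definition scaleR_torus_L1 :: "real \<Rightarrow> 'a torus_L1 \<Rightarrow> 'a torus_L1" is "\<lambda>c f x. c *\<^sub>R f x"
  by (auto simp: torus_ae_eq_def torus_integrable_scaleR)

lift_definition norm_torus_L1 :: "'a torus_L1 \<Rightarrow> real" is "\<lambda>f. LBINT x:{0..2 * pi}. norm (f x)"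
  by (rule torus_ae_eq_LBINT_cong, assumption) (auto simp: torus_ae_eq_def torus_integrable_def)

definition sgn_torus_L1 :: "'a torus_L1 \<Rightarrow> 'a torus_L1" where
  "sgn_torus_L1 u = inverse (norm u) *\<^sub>R u"

definition dist_torus_L1 :: "'a torus_L1 \<Rightarrow> 'a torus_L1 \<Rightarrow> real" where
  "dist_torus_L1 u v = norm (u - v)"

definition uniformity_torus_L1 :: "('a torus_L1 \<times> 'a torus_L1) filter" where
  "uniformity_torus_L1 = (INF e\<in>{0<..}. principal {(u, v). dist u v < e})"

definition open_torus_L1 :: "'a torus_L1 set \<Rightarrow> bool" where
  "open_torus_L1 U \<longleftrightarrow> (\<forall>u\<in>U. \<forall>\<^sub>F (u', v) in uniformity. u' = u \<longrightarrow> v \<in> U)"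

instance
proof
  fix u v w :: "'a torus_L1" and a b :: real
  show "u + v + w = u + (v + w)"
    by transfer (simp add: torus_ae_eq_def torus_integrable_add add.assoc)
  show "u + v = v + u"
    by transfer (simp add: torus_ae_eq_def torus_integrable_add add.commute)
  show "0 + u = u"
    by transfer (simp add: torus_ae_eq_def)
  show "- u + u = 0"
    by transfer (simp add: torus_ae_eq_def torus_integrable_zero)
  show "u - v = u + - v"
    by transfer (simp add: torus_ae_eq_def torus_integrable_diff)
  show "a *\<^sub>R (u + v) = a *\<^sub>R u + a *\<^sub>R v"
    by transfer (auto simp: torus_ae_eq_def scaleR_add_right
        intro!: torus_integrable_add torus_integrable_scaleR)
  show "(a + b) *\<^sub>R u = a *\<^sub>R u + b *\<^sub>R u"
    by transfer (auto simp: torus_ae_eq_def scaleR_add_left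
        intro!: torus_integrable_add torus_integrable_scaleR)
  show "a *\<^sub>R b *\<^sub>R u = (a * b) *\<^sub>R u"
    by transfer (auto simp: torus_ae_eq_def intro!: torus_integrable_scaleR)
  show "1 *\<^sub>R u = u"
    by transfer (simp add: torus_ae_eq_def)
  show "sgn u = inverse (norm u) *\<^sub>R u" by (fact sgn_torus_L1_def)
  show "dist u v = norm (u - v)" by (fact dist_torus_L1_def)
  show "(uniformity :: ('a torus_L1 \<times> 'a torus_L1) filter) =
      (INF e\<in>{0<..}. principal {(u, v). dist u v < e})"
    by (fact uniformity_torus_L1_def)
  show "open U \<longleftrightarrow> (\<forall>u\<in>U. \<forall>\<^sub>F (u', v) in uniformity. u' = u \<longrightarrow> v \<in> U)" for U :: "'a torus_L1 set"
    by (fact open_torus_L1_def)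
  show "norm u = 0 \<longleftrightarrow> u = 0"
  proof transfer
    fix f :: "real \<Rightarrow> 'a" assume f: "torus_ae_eq f f"
    then have ti: "torus_integrable f" by (simp add: torus_ae_eq_def)
    show "((LBINT x:{0..2 * pi}. norm (f x)) = 0) = torus_ae_eq f (\<lambda>_. 0)"
    proof
      assume "(LBINT x:{0..2 * pi}. norm (f x)) = 0"
      then show "torus_ae_eq f (\<lambda>_. 0)"
        using torus_integrable_AE_zero[OF ti] ti by (simp add: torus_ae_eq_def torus_integrable_zero)
    next
      assume "torus_ae_eq f (\<lambda>_. 0)"
      then have "(LBINT x:{0..2 * pi}. norm (f x)) = (LBINT x:{0..2 * pi}. norm (0 :: 'a))"
        by (rule torus_ae_eq_LBINT_cong) (use ti in \<open>auto simp: torus_integrable_def\<close>)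
      then show "(LBINT x:{0..2 * pi}. norm (f x)) = 0" by simp
    qed
  qed
  show "norm (u + v) \<le> norm u + norm v"
  proof transfer
    fix f g :: "real \<Rightarrow> 'a" assume "torus_ae_eq f f" "torus_ae_eq g g"
    then have fg: "set_integrable lborel {0..2 * pi} f" "set_integrable lborel {0..2 * pi} g"
      by (auto simp: torus_ae_eq_def torus_integrable_def)
    have "(LBINT x:{0..2 * pi}. norm (f x + g x)) \<le> (LBINT x:{0..2 * pi}. norm (f x) + norm (g x))"
      by (intro set_integral_mono set_integrable_norm set_integral_add(1) fg) (simp add: norm_triangle_ineq)
    also have "\<dots> = (LBINT x:{0..2 * pi}. norm (f x)) + (LBINT x:{0..2 * pi}. norm (g x))"
      by (intro set_integral_add(2) set_integrable_norm fg)
    finally show "(LBINT x:{0..2 * pi}. norm (f x + g x))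
      \<le> (LBINT x:{0..2 * pi}. norm (f x)) + (LBINT x:{0..2 * pi}. norm (g x))" .
  qed
  show "norm (a *\<^sub>R u) = \<bar>a\<bar> * norm u"
    by transfer simp
qed

end

lift_definition translate ::
  "real \<Rightarrow> 'a::{banach, second_countable_topology} torus_L1 \<Rightarrow> 'a torus_L1"
  is "\<lambda>h f x. f (x + h)"
  by (rule torus_ae_eq_translate)

lemma translate_zero [simp]: "translate h 0 = 0"
  by transfer (simp add: torus_ae_eq_def torus_integrable_zero)

lemma translate_diff: "translate h (u - v) = translate h u - translate h v"
  by transfer (auto simp: torus_ae_eq_def intro!: torus_integrable_diff torus_integrable_translate)

lemma translate_scaleR: "translate h (c *\<^sub>R u) = c *\<^sub>R translate h u"
  by transfer (auto simp: torus_ae_eq_def intro!: torus_integrable_scaleR torus_integrable_translate)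


section \<open>The Besov space with indices \<open>\<alpha>, 1, \<infinity>\<close>\<close>

definition torus_dist :: "real \<Rightarrow> real \<Rightarrow> real" where
  "torus_dist x y = (INF k::int. \<bar>x - y - 2 * pi * of_int k\<bar>)"

definition besov_enorm :: "real \<Rightarrow> real torus_L1 \<Rightarrow> ennreal" where
  "besov_enorm \<alpha> u = ennreal (norm u) +
     (SUP (x, y) \<in> {(x, y). torus_dist x y \<noteq> 0}.
        ennreal (norm (translate x u - translate y u) / torus_dist x y powr \<alpha>))"

definition besov :: "real \<Rightarrow> real torus_L1 set" where
  "besov \<alpha> = {u. besov_enorm \<alpha> u < \<infinity>}"

definition besov_norm :: "real \<Rightarrow> real torus_L1 \<Rightarrow> real" where
  "besov_norm \<alpha> u = enn2real (besov_enorm \<alpha> u)"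

lemma besov_enorm_zero [simp]: "besov_enorm \<alpha> 0 = 0"
proof -
  have "(SUP (x, y) \<in> {(x, y). torus_dist x y \<noteq> 0}.
        ennreal (norm (translate x 0 - translate y (0 :: real torus_L1)) / torus_dist x y powr \<alpha>)) \<le> 0"
    by (rule SUP_least) auto
  then show ?thesis by (simp add: besov_enorm_def)
qed

lemma besov_enorm_diff: "besov_enorm \<alpha> (u - v) \<le> besov_enorm \<alpha> u + besov_enorm \<alpha> v"
proof -
  let ?P = "{(x, y). torus_dist x y \<noteq> 0}"
  let ?q = "\<lambda>w (x, y). ennreal (norm (translate x w - translate y w) / torus_dist x y powr \<alpha>)"
  have "(SUP p\<in>?P. ?q (u - v) p) \<le> (SUP p\<in>?P. ?q u p) + (SUP p\<in>?P. ?q v p)"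
  proof (rule SUP_least, clarify)
    fix x y assume xy: "torus_dist x y \<noteq> 0"
    have "norm (translate x (u - v) - translate y (u - v))
        = norm ((translate x u - translate y u) - (translate x v - translate y v))"
      by (simp add: translate_diff algebra_simps)
    also have "\<dots> \<le> norm (translate x u - translate y u) + norm (translate x v - translate y v)"
      by (rule norm_triangle_ineq4)
    finally have "?q (u - v) (x, y) \<le> ?q u (x, y) + ?q v (x, y)"
      unfolding prod.case
      by (simp add: add_divide_distrib[symmetric] divide_right_mono ennreal_leI flip: ennreal_plus)
    also have "\<dots> \<le> (SUP p\<in>?P. ?q u p) + (SUP p\<in>?P. ?q v p)"
      by (rule add_mono; rule SUP_upper) (use xy in auto)
    finally show "ennreal (norm (translate x (u - v) - translate y (u - v)) / torus_dist x y powr \<alpha>)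
        \<le> (SUP p\<in>?P. ?q u p) + (SUP p\<in>?P. ?q v p)"
      by simp
  qed
  moreover have "ennreal (norm (u - v)) \<le> ennreal (norm u) + ennreal (norm v)"
    by (simp add: norm_triangle_ineq4 flip: ennreal_plus)
  ultimately have "ennreal (norm (u - v)) + (SUP p\<in>?P. ?q (u - v) p)
     \<le> (ennreal (norm u) + ennreal (norm v)) + ((SUP p\<in>?P. ?q u p) + (SUP p\<in>?P. ?q v p))"
    by (intro add_mono)
  then show ?thesis
    unfolding besov_enorm_def by (simp only: ac_simps)
qed

lemma besov_diff: "u \<in> besov \<alpha> \<Longrightarrow> v \<in> besov \<alpha> \<Longrightarrow> u - v \<in> besov \<alpha>"
  unfolding besov_def using besov_enorm_diff[of \<alpha> u v] by (auto simp: order_le_less_trans)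

lemma besov_enorm_scaleR_le: "besov_enorm \<alpha> (c *\<^sub>R u) \<le> ennreal \<bar>c\<bar> * besov_enorm \<alpha> u"
proof -
  let ?P = "{(x, y). torus_dist x y \<noteq> 0}"
  let ?q = "\<lambda>w (x, y). ennreal (norm (translate x w - translate y w) / torus_dist x y powr \<alpha>)"
  have "(SUP p\<in>?P. ?q (c *\<^sub>R u) p) \<le> ennreal \<bar>c\<bar> * (SUP p\<in>?P. ?q u p)"
  proof (rule SUP_least, clarify)
    fix x y assume xy: "torus_dist x y \<noteq> 0"
    have "ennreal (norm (translate x (c *\<^sub>R u) - translate y (c *\<^sub>R u)) / torus_dist x y powr \<alpha>)
        = ennreal \<bar>c\<bar> * ?q u (x, y)"
      by (simp add: translate_scaleR scaleR_diff_right[symmetric] flip: ennreal_mult)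
    also have "\<dots> \<le> ennreal \<bar>c\<bar> * (SUP p\<in>?P. ?q u p)"
      by (rule mult_left_mono[OF SUP_upper]) (use xy in auto)
    finally show "ennreal (norm (translate x (c *\<^sub>R u) - translate y (c *\<^sub>R u)) / torus_dist x y powr \<alpha>)
        \<le> ennreal \<bar>c\<bar> * (SUP p\<in>?P. ?q u p)" .
  qed
  moreover have "ennreal (norm (c *\<^sub>R u)) = ennreal \<bar>c\<bar> * ennreal (norm u)"
    by (simp add: ennreal_mult)
  ultimately show ?thesis
    unfolding besov_enorm_def by (simp add: distrib_left add_left_mono)
qed

lemma subspace_besov: "subspace (besov \<alpha>)"
proof (rule subspaceI)
  show zero: "0 \<in> besov \<alpha>" by (simp add: besov_def)
  show "u + v \<in> besov \<alpha>" if "u \<in> besov \<alpha>" "v \<in> besov \<alpha>" for u v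
    using besov_diff[OF that(1) besov_diff[OF zero that(2)]] by simp
  show "c *\<^sub>R u \<in> besov \<alpha>" if "u \<in> besov \<alpha>" for c u
    using that besov_enorm_scaleR_le[of \<alpha> c u]
    by (auto simp: besov_def ennreal_mult_less_top intro: order_le_less_trans)
qed

lemma Metric_space_besov: "Metric_space (besov \<alpha>) (\<lambda>u v. besov_norm \<alpha> (u - v))"
proof
  fix u v w
  show "0 \<le> besov_norm \<alpha> (u - v)" by (simp add: besov_norm_def)
  have "besov_enorm \<alpha> (x - y) \<le> besov_enorm \<alpha> (y - x)" for x y
    using besov_enorm_diff[of \<alpha> 0 "y - x"] by simp
  then show "besov_norm \<alpha> (u - v) = besov_norm \<alpha> (v - u)"
    unfolding besov_norm_def by (metis antisym)
  show "besov_norm \<alpha> (u - v) = 0 \<longleftrightarrow> u = v" if uv: "u \<in> besov \<alpha>" "v \<in> besov \<alpha>"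
  proof
    assume "besov_norm \<alpha> (u - v) = 0"
    then have "besov_enorm \<alpha> (u - v) = 0"
      using besov_diff[OF uv] by (auto simp: besov_norm_def besov_def enn2real_eq_0_iff)
    then show "u = v" by (simp add: besov_enorm_def add_eq_0_iff_both_eq_0)
  qed (simp add: besov_norm_def)
  assume uvw: "u \<in> besov \<alpha>" "v \<in> besov \<alpha>" "w \<in> besov \<alpha>"
  have fin: "besov_enorm \<alpha> (x - y) < \<infinity>" if "x \<in> besov \<alpha>" "y \<in> besov \<alpha>" for x y
    using besov_diff[OF that] by (simp add: besov_def)
  have "besov_enorm \<alpha> (u - w) \<le> besov_enorm \<alpha> (u - v) + besov_enorm \<alpha> (w - v)"
    using besov_enorm_diff[of \<alpha> "u - v" "w - v"] by simp
  moreover have "besov_enorm \<alpha> (w - v) \<le> besov_enorm \<alpha> (v - w)"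
    using besov_enorm_diff[of \<alpha> 0 "v - w"] by simp
  ultimately have le: "besov_enorm \<alpha> (u - w) \<le> besov_enorm \<alpha> (u - v) + besov_enorm \<alpha> (v - w)"
    by (meson add_left_mono order_trans)
  have "besov_norm \<alpha> (u - w) \<le> enn2real (besov_enorm \<alpha> (u - v) + besov_enorm \<alpha> (v - w))"
    unfolding besov_norm_def
    by (rule enn2real_mono[OF le]) (use fin uvw in auto)
  then show "besov_norm \<alpha> (u - w) \<le> besov_norm \<alpha> (u - v) + besov_norm \<alpha> (v - w)"
    using fin uvw by (simp add: besov_norm_def enn2real_plus)
qed


section \<open>Sobolev norms and mixing\<close>

lift_definition fourier_coeff :: "complex torus_L1 \<Rightarrow> int \<Rightarrow> complex"
  is "\<lambda>g n. (LBINT x:{0..2 * pi}. g x * cis (- (of_int n * x))) / complex_of_real (2 * pi)"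
  apply (rule ext)
  apply (rule arg_cong[where f = "\<lambda>z. z / complex_of_real (2 * pi)"])
  apply (rule torus_ae_eq_LBINT_cong, assumption)
    apply simp
   apply (auto simp: torus_ae_eq_def cis_conv_exp dest!: torus_integrable_measurable
      intro!: borel_measurable_times borel_measurable_continuous_onI[of "\<lambda>x. exp (_ x)"]
      continuous_intros)
  done

text \<open>The norm of \<open>H\<^sup>s\<close>, infinite outside of \<open>H\<^sup>s\<close>.  For \<open>s \<ge> 0\<close> the space \<open>H\<^sup>s\<close> is exactly the set of
  \<open>g\<close> in \<open>L\<^sup>1\<close> where it is finite.  For \<open>s < 0\<close> the space \<open>H\<^sup>s\<close> also contains distributions that are
  not functions, on which the norm is not needed here.\<close>

definition sobolev_enorm :: "real \<Rightarrow> complex torus_L1 \<Rightarrow> ennreal" where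
  "sobolev_enorm s g =
     (let w = (\<lambda>n::int. (1 + (of_int n)\<^sup>2) powr s * (norm (fourier_coeff g n))\<^sup>2)
      in if w summable_on UNIV then ennreal (sqrt (infsum w UNIV)) else \<infinity>)"

lift_definition phase_mult :: "real \<Rightarrow> real torus_L1 \<Rightarrow> complex torus_L1 \<Rightarrow> complex torus_L1"
  is "\<lambda>\<tau> u g x. exp (- \<i> * complex_of_real (\<tau> * u x)) * g x"
proof -
  fix \<tau> :: real and u u' :: "real \<Rightarrow> real" and g g' :: "real \<Rightarrow> complex"
  assume u: "torus_ae_eq u u'" and g: "torus_ae_eq g g'"
  have ti: "torus_integrable (\<lambda>x. exp (- \<i> * complex_of_real (\<tau> * v x)) * h x)"
    if v: "torus_integrable v" and h: "torus_integrable h" for v :: "real \<Rightarrow> real" and h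
  proof -
    have [measurable]: "v \<in> borel_measurable borel" "h \<in> borel_measurable borel"
      using v h by (auto simp: torus_integrable_def)
    have m: "(\<lambda>x. exp (- \<i> * complex_of_real (\<tau> * v x)) * h x) \<in> borel_measurable borel"
      by measurable
    have "set_integrable lborel {0..2 * pi} (\<lambda>x. exp (- \<i> * complex_of_real (\<tau> * v x)) * h x)"
      unfolding set_integrable_def
    proof (rule Bochner_Integration.integrable_bound)
      show "integrable lborel (\<lambda>x. indicator {0..2 * pi} x *\<^sub>R h x)"
        using h by (simp add: torus_integrable_def set_integrable_def)
      show "AE x in lborel. norm (indicator {0..2 * pi} x *\<^sub>R
          (exp (- \<i> * complex_of_real (\<tau> * v x)) * h x)) \<le> norm (indicator {0..2 * pi} x *\<^sub>R h x)"
        by (simp add: norm_mult)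
    qed (use m in measurable)
    with m v h show ?thesis by (simp add: torus_integrable_def)
  qed
  have "AE x in lborel. u x = u' x" "AE x in lborel. g x = g' x"
    using u g by (auto simp: torus_ae_eq_def)
  then have "AE x in lborel. exp (- \<i> * complex_of_real (\<tau> * u x)) * g x
      = exp (- \<i> * complex_of_real (\<tau> * u' x)) * g' x"
    by eventually_elim simp
  with u g show "torus_ae_eq (\<lambda>x. exp (- \<i> * complex_of_real (\<tau> * u x)) * g x)
      (\<lambda>x. exp (- \<i> * complex_of_real (\<tau> * u' x)) * g' x)"
    by (simp only: torus_ae_eq_def ti)
qed

text \<open>The norm of multiplication by \<open>exp(-i\<tau>u)\<close> as an operator from \<open>H\<^sup>s\<close> to \<open>H\<^sup>-\<^sup>s\<close>, for \<open>s \<ge> 0\<close>.\<close>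

definition phase_mult_opnorm :: "real \<Rightarrow> real \<Rightarrow> real torus_L1 \<Rightarrow> ennreal" where
  "phase_mult_opnorm s \<tau> u =
     (SUP g \<in> {g. sobolev_enorm s g \<le> 1}. sobolev_enorm (- s) (phase_mult \<tau> u g))"

text \<open>Only the values of a rate on \<open>[0, \<infinity>)\<close> matter; increasing is read as nondecreasing.\<close>

definition is_rate :: "(real \<Rightarrow> real) \<Rightarrow> bool" where
  "is_rate r \<longleftrightarrow> continuous_on {0..} r \<and> mono_on {0..} r \<and> (\<forall>t\<ge>0. r t \<ge> 0)"

text \<open>The quotient is taken in \<open>ennreal\<close>, so that the bound is vacuous where \<open>r\<close> vanishes.\<close>

definition mixing_on_scale :: "real \<Rightarrow> real torus_L1 \<Rightarrow> (real \<Rightarrow> real) \<Rightarrow> bool" where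
  "mixing_on_scale s u r \<longleftrightarrow> is_rate r \<and>
     (\<exists>C>0. \<forall>k::int. \<forall>t\<ge>1. k \<noteq> 0 \<longrightarrow>
        phase_mult_opnorm s (t * of_int k) u \<le> ennreal C / ennreal (r (t * \<bar>of_int k\<bar>)))"


section \<open>Prevalence\<close>

text \<open>The exponent \<open>\<alpha>\<close> is a term, so the Banach space cannot be a type: it is given by a
  linear subspace \<open>E\<close> of a vector space and a norm \<open>N\<close> on \<open>E\<close>.\<close>

definition norm_topology :: "'a::real_vector set \<Rightarrow> ('a \<Rightarrow> real) \<Rightarrow> 'a topology" where
  "norm_topology E N = Metric_space.mtopology E (\<lambda>u v. N (u - v))"

definition norm_borel :: "'a::real_vector set \<Rightarrow> ('a \<Rightarrow> real) \<Rightarrow> 'a measure" where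
  "norm_borel E N = sigma E {U. openin (norm_topology E N) U}"

definition shy_borel :: "'a::real_vector set \<Rightarrow> ('a \<Rightarrow> real) \<Rightarrow> 'a set \<Rightarrow> bool" where
  "shy_borel E N A \<longleftrightarrow> A \<in> sets (norm_borel E N) \<and>
     (\<exists>\<mu>. sets \<mu> = sets (norm_borel E N) \<and>
        (\<exists>K. compactin (norm_topology E N) K \<and> 0 < emeasure \<mu> K \<and> emeasure \<mu> K < \<infinity>) \<and>
        (\<forall>v\<in>E. emeasure \<mu> ((+) v ` A) = 0))"

definition shy :: "'a::real_vector set \<Rightarrow> ('a \<Rightarrow> real) \<Rightarrow> 'a set \<Rightarrow> bool" where
  "shy E N S \<longleftrightarrow> (\<exists>A. shy_borel E N A \<and> S \<subseteq> A)"

definition prevalent :: "'a::real_vector set \<Rightarrow> ('a \<Rightarrow> real) \<Rightarrow> 'a set \<Rightarrow> bool" where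
  "prevalent E N S \<longleftrightarrow> shy E N (E - S)"

end

theory Submission
  imports Defs "HOL-Probability.Probability" "HOL-Real_Asymp.Real_Asymp"
begin

text \<open>
  Lower bound: test the multiplication operator on the constant function. If \<open>f = exp(-i\<tau>u)\<close>, the
  \<open>L\<^sup>1\<close> modulus of continuity of \<open>u\<close> and \<open>\<bar>f\<bar> = 1\<close> bound the \<open>L\<^sup>2\<close> modulus of continuity of \<open>f\<close>, so by
  Parseval at least half of the mass of \<open>f\<close> sits at frequencies at most of order \<open>\<tau> powr (1 / \<alpha>)\<close>,
  which bounds its \<open>H\<close>-norm with index \<open>-1/2\<close> from below.

  Upper bound: a weighted \<open>\<ell>\<^sup>2\<close> convolution estimate bounds the operator norm by the norm of \<open>f\<close> with
  index \<open>-\<sigma>\<close>, for any \<open>\<sigma> < 1/2\<close>, and the latter is controlled by a uniform bound of order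
  \<open>\<tau> powr (\<epsilon> - 1 / (2 * \<alpha>))\<close> on the Fourier coefficients of \<open>f\<close>. This bound is a countable intersection
  of countable unions of closed conditions on \<open>u\<close>. The transverse measure is the law of a random
  series of dyadic step functions with independent coefficients; these are Lipschitz in \<open>L\<^sup>1\<close>, so the
  series lies in the Besov space and ranges over a compact set. Given \<open>\<tau>\<close>, resampling only the
  coefficients at scale \<open>2 ^ (-m) \<approx> \<tau> powr (\<epsilon> - 1 / \<alpha>)\<close> makes a Fourier coefficient a sum of \<open>2 ^ m\<close>
  independent terms of size at most \<open>2 ^ (-m)\<close> with negligible mean, whatever the other coefficients
  and the translation are. Hoeffding's inequality and the Borel-Cantelli lemma on a polynomially fine
  grid of values of \<open>\<tau>\<close> conclude.
\<close>

section \<open>Integration over a period\<close>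

text \<open>One heuristic gives the exponent 1/(2\<alpha>) in both halves: \<open>\<tau> * u\<close>
  varies by order one over distances of order \<open>\<tau> powr (- 1 / \<alpha>)\<close>, so
  exp(-i\<tau>u) resembles noise on N = \<open>\<tau> powr (1 / \<alpha>)\<close> cells, with
  Fourier coefficients of size N to the power -1/2. The index 1/2 is critical for the convolution
  estimate, because \<open>jb n powr (- (1 - \<sigma>))\<close> is summable only for \<sigma> < 1/2.
  This loss, and that of \<epsilon> in the coefficient bound, is affordable because the rate is
  claimed only for exponents above \<alpha>. Shyness asks one measure to handle every translate v,
  whose fine structure is arbitrary. The obstacle is then the mean: at the chosen level
  \<open>\<tau> * amp \<alpha> m\<close> is only of order
  \<open>\<tau> powr (\<alpha> * \<epsilon>)\<close> up to logarithms, so a single uniform variable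
  per cell would gain too little. Hence the copies inside each cell, whose number grows with the
  level.\<close>

definition torus_measure :: "real measure" where
  "torus_measure = restrict_space lborel {0..2 * pi}"

abbreviation torus_integral ::
  "(real \<Rightarrow> 'a::{banach, second_countable_topology}) \<Rightarrow> 'a" (binder "TINT " 10) where
  "torus_integral \<equiv> integral\<^sup>L torus_measure"

lemma space_torus_measure [simp]: "space torus_measure = {0..2 * pi}"
  by (simp add: torus_measure_def space_restrict_space)

lemma finite_measure_torus: "finite_measure torus_measure"
  by (rule finite_measureI) (simp add: torus_measure_def emeasure_restrict_space)

interpretation torus: finite_measure torus_measure
  by (rule finite_measure_torus)

lemma measure_torus [simp]: "measure torus_measure {0..2 * pi} = 2 * pi"
  by (simp add: torus_measure_def measure_restrict_space)

lemma borel_measurable_torus [measurable (raw)]: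
  "f \<in> borel_measurable borel \<Longrightarrow> f \<in> borel_measurable torus_measure"
  unfolding torus_measure_def by (rule measurable_restrict_space1) simp

lemma LBINT_torus: "(LBINT x:{0..2 * pi}. f x) = (TINT x. f x)"
  for f :: "real \<Rightarrow> 'a::{banach, second_countable_topology}"
  by (simp add: set_lebesgue_integral_def torus_measure_def integral_restrict_space)

lemma set_integrable_torus: "set_integrable lborel {0..2 * pi} f \<longleftrightarrow> integrable torus_measure f"
  for f :: "real \<Rightarrow> 'a::{banach, second_countable_topology}"
  by (simp add: set_integrable_def torus_measure_def integrable_restrict_space)

lemma AE_torus:
  assumes "AE x in lborel. P x"
  shows "AE x in torus_measure. P x"
proof -
  have "AE x in lborel. x \<in> {0..2 * pi} \<longrightarrow> P x"
    using assms by eventually_elim simp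
  then show ?thesis
    unfolding torus_measure_def by (subst AE_restrict_space_iff) auto
qed

lemma torus_integrable_altdef:
  "torus_integrable f \<longleftrightarrow> f \<in> borel_measurable borel \<and> (\<forall>x. f (x + 2 * pi) = f x) \<and>
     integrable torus_measure f"
  by (simp add: torus_integrable_def set_integrable_torus)

lemma torus_integrableD:
  assumes "torus_integrable f"
  shows "f \<in> borel_measurable borel" "f (x + 2 * pi) = f x" "integrable torus_measure f"
  using assms unfolding torus_integrable_altdef by blast+

lemma torus_integrable_bounded:
  fixes f :: "real \<Rightarrow> 'a::{banach, second_countable_topology}"
  assumes "f \<in> borel_measurable borel" "\<And>x. f (x + 2 * pi) = f x" "\<And>x. norm (f x) \<le> B"
  shows "torus_integrable f"
  unfolding torus_integrable_altdef
  using assms(1) by (intro conjI allI assms torus.integrable_const_bound[of f B] AE_I2 borel_measurable_torus)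

lemma torus_integrable_bounded_mult:
  fixes f g :: "real \<Rightarrow> complex"
  assumes f: "f \<in> borel_measurable borel" "\<And>x. f (x + 2 * pi) = f x" "\<And>x. norm (f x) \<le> B"
    and g: "torus_integrable g"
  shows "torus_integrable (\<lambda>x. f x * g x)"
proof -
  have [measurable]: "f \<in> borel_measurable borel" "g \<in> borel_measurable borel"
    using f(1) torus_integrableD(1)[OF g] by auto
  have "integrable torus_measure (\<lambda>x. f x * g x)"
  proof (rule Bochner_Integration.integrable_bound)
    show "integrable torus_measure (\<lambda>x. B * norm (g x))"
      using torus_integrableD(3)[OF g] by simp
    show "AE x in torus_measure. norm (f x * g x) \<le> norm (B * norm (g x))"
      using order_trans[OF f(3) abs_ge_self] by (auto simp: norm_mult abs_mult intro!: mult_right_mono)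
  qed measurable
  then show ?thesis
    unfolding torus_integrable_altdef
    by (intro conjI allI) (simp_all only: f(2) torus_integrableD(2)[OF g], measurable)
qed

text \<open>For a shift by at most one period, the part of the shifted interval beyond
  \<open>2 * pi\<close> is moved back by a period; any other shift is first reduced modulo
  \<open>2 * pi\<close>.\<close>

lemma torus_integral_translate:
  fixes f :: "real \<Rightarrow> 'a::{banach, second_countable_topology}"
  assumes f: "torus_integrable f"
  shows "(TINT x. f (x + h)) = (TINT x. f x)"
proof -
  have per: "\<forall>x. f (x + 2 * pi) = f x" using f by (simp add: torus_integrable_def)
  have base: "(TINT x. f (x + h)) = (TINT x. f x)"
    if h: "0 \<le> h" "h \<le> 2 * pi" for h
  proof -
    define I where "I a b = integral\<^sup>L lborel (\<lambda>x. indicator {a..b} x *\<^sub>R f x)" for a b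
    have int: "integrable lborel (\<lambda>x. indicator {a..b} x *\<^sub>R f x)" for a b
      using torus_integrable_local[OF f] by (simp add: set_integrable_def)
    have split: "I a c = I a b + I b c" if "a \<le> b" "b \<le> c" for a b c
    proof -
      have "I a c = integral\<^sup>L lborel (\<lambda>x. indicator {a..b} x *\<^sub>R f x + indicator {b..c} x *\<^sub>R f x)"
        unfolding I_def
      proof (rule integral_cong_AE)
        have "AE x in lborel. x \<noteq> b"
          by (rule AE_lborel_singleton)
        then show "AE x in lborel. indicator {a..c} x *\<^sub>R f x =
            indicator {a..b} x *\<^sub>R f x + indicator {b..c} x *\<^sub>R f x"
          by eventually_elim (use that in \<open>auto simp: indicator_def\<close>)
      qed (use torus_integrableD(1)[OF f] in measurable)
      then show ?thesis
        by (simp add: int I_def)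
    qed
    have shift: "integral\<^sup>L lborel (\<lambda>x. indicator {a..b} x *\<^sub>R f (x + c)) = I (a + c) (b + c)" for a b c
    proof -
      have "I (a + c) (b + c) = (\<integral>x. indicator {a + c..b + c} (c + 1 * x) *\<^sub>R f (c + 1 * x) \<partial>lborel)"
        unfolding I_def by (subst lborel_integral_real_affine[where c = 1 and t = c]) auto
      also have "\<dots> = integral\<^sup>L lborel (\<lambda>x. indicator {a..b} x *\<^sub>R f (x + c))"
        by (intro Bochner_Integration.integral_cong) (auto simp: indicator_def add.commute)
      finally show ?thesis by simp
    qed
    have "(TINT x. f (x + h)) = I h (2 * pi + h)"
      using shift[of 0 "2 * pi" h] by (simp flip: LBINT_torus add: set_lebesgue_integral_def)
    also have "\<dots> = I h (2 * pi) + I (2 * pi) (2 * pi + h)"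
      using h by (intro split) auto
    also have "I (2 * pi) (2 * pi + h) = I 0 h"
      using shift[of 0 h "2 * pi"] per by (simp add: I_def add.commute)
    also have "I h (2 * pi) + I 0 h = I 0 (2 * pi)"
      using split[of 0 h "2 * pi"] h by simp
    also have "\<dots> = (TINT x. f x)"
      by (simp flip: LBINT_torus add: set_lebesgue_integral_def I_def)
    finally show ?thesis .
  qed
  define k where "k = \<lfloor>h / (2 * pi)\<rfloor>"
  define r where "r = h - 2 * pi * of_int k"
  have "of_int k * (2 * pi) \<le> h" "h \<le> (of_int k + 1) * (2 * pi)"
    unfolding k_def by (simp_all add: floor_divide_lower floor_divide_upper less_imp_le)
  then have r: "0 \<le> r" "r \<le> 2 * pi"
    by (auto simp: r_def algebra_simps)
  have "f (x + h) = f (x + r)" for x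
    using periodic_int[OF per, of "x + r" k] by (simp add: r_def algebra_simps)
  then show ?thesis
    using base[OF r] by simp
qed

abbreviation torus_class :: "(real \<Rightarrow> 'a::{banach, second_countable_topology}) \<Rightarrow> 'a torus_L1" where
  "torus_class \<equiv> abs_torus_L1"

lemma torus_ae_eq_refl: "torus_integrable f \<Longrightarrow> torus_ae_eq f f"
  by (simp add: torus_ae_eq_def)

lemma torus_class_cases:
  obtains f where "torus_integrable f" "u = torus_class f"
proof -
  have "\<exists>f. torus_integrable f \<and> u = torus_class f"
    by (rule torus_L1.abs_induct) (auto simp: torus_ae_eq_def)
  then show ?thesis using that by blast
qed

lemma norm_torus_class:
  "torus_integrable f \<Longrightarrow> norm (torus_class f) = (TINT x. norm (f x))"
  by (simp add: norm_torus_L1.abs_eq torus_ae_eq_refl LBINT_torus)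

lemma diff_torus_class:
  "torus_integrable f \<Longrightarrow> torus_integrable g \<Longrightarrow>
     torus_class f - torus_class g = torus_class (\<lambda>x. f x - g x)"
  by (simp add: minus_torus_L1.abs_eq torus_ae_eq_refl)

lemma translate_torus_class:
  "torus_integrable f \<Longrightarrow> translate h (torus_class f) = torus_class (\<lambda>x. f (x + h))"
  by (simp add: translate.abs_eq torus_ae_eq_refl)

definition fcoef :: "(real \<Rightarrow> complex) \<Rightarrow> int \<Rightarrow> complex" where
  "fcoef f n = (TINT x. f x * cis (- (of_int n * x))) / of_real (2 * pi)"

lemma fourier_coeff_torus_class:
  "torus_integrable f \<Longrightarrow> fourier_coeff (torus_class f) = fcoef f"
  by (simp add: fourier_coeff.abs_eq torus_ae_eq_refl fcoef_def LBINT_torus fun_eq_iff)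

definition phase :: "real \<Rightarrow> (real \<Rightarrow> real) \<Rightarrow> real \<Rightarrow> complex" where
  "phase \<tau> u x = cis (- (\<tau> * u x))"

lemma phase_mult_torus_class:
  "torus_integrable u \<Longrightarrow> torus_integrable g \<Longrightarrow>
     phase_mult \<tau> (torus_class u) (torus_class g) = torus_class (\<lambda>x. phase \<tau> u x * g x)"
  by (simp add: phase_mult.abs_eq torus_ae_eq_refl phase_def cis_conv_exp mult.commute)

lemma cis_period: "cis (- (of_int n * (x + 2 * pi))) = cis (- (of_int n * x))"
proof -
  have "cis (- (of_int n * (x + 2 * pi))) = cis (- (of_int n * x)) * cis (2 * pi * of_int (- n))"
    by (simp add: cis_mult algebra_simps)
  moreover have "cis (2 * pi * of_int (- n)) = 1"
    by (rule cis_multiple_2pi) auto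
  ultimately show ?thesis by simp
qed

lemma measurable_cis [measurable]: "cis \<in> borel_measurable borel"
  by (intro borel_measurable_continuous_onI continuous_intros)

lemma norm_phase [simp]: "norm (phase \<tau> u x) = 1"
  by (simp add: phase_def)

lemma measurable_phase [measurable]:
  assumes [measurable]: "u \<in> borel_measurable borel"
  shows "phase \<tau> u \<in> borel_measurable borel"
  unfolding phase_def [abs_def] by measurable

lemma torus_integrable_phase:
  "torus_integrable u \<Longrightarrow> torus_integrable (phase \<tau> u)"
  by (rule torus_integrable_bounded[of _ 1]) (auto simp: torus_integrable_def phase_def[of \<tau> u])

section \<open>Fourier coefficients\<close>

definition tchar :: "int \<Rightarrow> real \<Rightarrow> complex" where
  "tchar k x = cis (of_int k * x)"

lemma norm_tchar [simp]: "norm (tchar k x) = 1"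
  by (simp add: tchar_def)

lemma tchar_0 [simp]: "tchar 0 x = 1"
  by (simp add: tchar_def)

lemma tchar_mult: "tchar k x * tchar l x = tchar (k + l) x"
  by (simp add: tchar_def cis_mult algebra_simps)

lemma cnj_char: "cnj (tchar k x) = tchar (- k) x"
  by (simp add: tchar_def cis_cnj)

lemma tchar_period: "tchar k (x + 2 * pi) = tchar k x"
  using cis_period[of "- k" x] by (simp add: tchar_def)

lemma tchar_add: "tchar k (x + h) = tchar k h * tchar k x"
  by (simp add: tchar_def cis_mult algebra_simps)

lemma measurable_tchar [measurable]: "tchar k \<in> borel_measurable borel"
  unfolding tchar_def [abs_def] by measurable

lemma measurable_cnj [measurable]: "cnj \<in> borel_measurable borel"
  by (intro borel_measurable_continuous_onI continuous_intros)

lemma torus_integrable_tchar: "torus_integrable (tchar k)"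
  by (rule torus_integrable_bounded[of _ 1]) (auto simp: tchar_period)

lemma torus_integrable_tchar_mult:
  "torus_integrable f \<Longrightarrow> torus_integrable (\<lambda>x. tchar k x * f x)"
  by (rule torus_integrable_bounded_mult[of _ 1]) (auto simp: tchar_period)

lemma fcoef_tchar: "fcoef f n = (TINT x. tchar (- n) x * f x) / (2 * pi)"
  by (simp add: fcoef_def tchar_def mult.commute)

lemma integral_tchar: "(TINT x. tchar k x) = (if k = 0 then 2 * pi else 0)"
proof (cases "k = 0")
  case False
  \<comment> \<open>A shift by \<open>pi / k\<close> multiplies the character by -1, so the integral
    equals its own negative.\<close>
  have "(TINT x. tchar k x) = (TINT x. tchar k (x + pi / of_int k))"
    by (rule torus_integral_translate[OF torus_integrable_tchar, symmetric])
  also have "\<dots> = (TINT x. - tchar k x)"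
    using False by (simp add: tchar_add) (simp add: tchar_def)
  finally show ?thesis using False by simp
qed (simp add: scaleR_conv_of_real)

lemma fcoef_tchar_self: "fcoef (tchar k) n = (if n = k then 1 else 0)"
  by (simp add: fcoef_tchar tchar_mult integral_tchar)

lemma fcoef_bound:
  assumes "torus_integrable f"
  shows "norm (fcoef f n) \<le> (TINT x. norm (f x)) / (2 * pi)"
proof -
  have "norm (TINT x. tchar (- n) x * f x) \<le> (TINT x. norm (tchar (- n) x * f x))"
    by (rule integral_norm_bound)
  then show ?thesis
    by (simp add: fcoef_tchar norm_divide norm_mult divide_right_mono)
qed

lemma fcoef_add:
  assumes "torus_integrable f" "torus_integrable g"
  shows "fcoef (\<lambda>x. f x + g x) n = fcoef f n + fcoef g n"
  using assms by (simp add: fcoef_tchar distrib_left add_divide_distrib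
      torus_integrable_tchar_mult[THEN torus_integrableD(3)])

lemma fcoef_diff:
  assumes "torus_integrable f" "torus_integrable g"
  shows "fcoef (\<lambda>x. f x - g x) n = fcoef f n - fcoef g n"
  using assms by (simp add: fcoef_tchar right_diff_distrib diff_divide_distrib
      torus_integrable_tchar_mult[THEN torus_integrableD(3)])

lemma fcoef_cmult: "fcoef (\<lambda>x. c * f x) n = c * fcoef f n"
  by (simp add: fcoef_tchar mult.left_commute)

lemma fcoef_tchar_mult: "fcoef (\<lambda>x. tchar k x * f x) n = fcoef f (n - k)"
  by (simp add: fcoef_tchar tchar_mult flip: mult.assoc)

lemma fcoef_sum:
  assumes "finite F" "\<And>k. k \<in> F \<Longrightarrow> torus_integrable (f k)"
  shows "fcoef (\<lambda>x. \<Sum>k\<in>F. f k x) n = (\<Sum>k\<in>F. fcoef (f k) n)"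
  using assms by (simp add: fcoef_tchar sum_distrib_left sum_divide_distrib
      torus_integrable_tchar_mult[THEN torus_integrableD(3)])

lemma fcoef_translate:
  assumes "torus_integrable f"
  shows "fcoef (\<lambda>x. f (x + h)) n = tchar n h * fcoef f n"
proof -
  have "tchar (- n) x * f (x + h) = tchar n h * (tchar (- n) (x + h) * f (x + h))" for x
  proof -
    have "tchar (- n) (x + h) = tchar (- n) h * tchar (- n) x" by (rule tchar_add)
    moreover have "tchar n h * tchar (- n) h = 1" by (simp add: tchar_mult)
    ultimately show ?thesis by (simp add: mult.assoc[symmetric])
  qed
  then have "(TINT x. tchar (- n) x * f (x + h))
      = tchar n h * (TINT x. tchar (- n) (x + h) * f (x + h))"
    by (simp only: integral_mult_right_zero)
  also have "(TINT x. tchar (- n) (x + h) * f (x + h)) = (TINT x. tchar (- n) x * f x)"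
    by (rule torus_integral_translate[OF torus_integrable_tchar_mult[OF assms]])
  finally show ?thesis by (simp add: fcoef_tchar)
qed

definition trig_poly :: "int set \<Rightarrow> (int \<Rightarrow> complex) \<Rightarrow> real \<Rightarrow> complex" where
  "trig_poly F c x = (\<Sum>k\<in>F. c k * tchar k x)"

lemma measurable_trig_poly [measurable]: "trig_poly F c \<in> borel_measurable borel"
  unfolding trig_poly_def [abs_def] by measurable

lemma norm_trig_poly_le: "norm (trig_poly F c x) \<le> (\<Sum>k\<in>F. norm (c k))"
  unfolding trig_poly_def by (rule order_trans[OF norm_sum]) (simp add: norm_mult)

lemma trig_poly_period: "trig_poly F c (x + 2 * pi) = trig_poly F c x"
  by (simp add: trig_poly_def tchar_period)

lemma torus_integrable_trig_poly: "torus_integrable (trig_poly F c)"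
  by (rule torus_integrable_bounded) (auto simp: trig_poly_period intro: norm_trig_poly_le)

lemma fcoef_mult_trig_poly:
  assumes "finite F" "torus_integrable f"
  shows "fcoef (\<lambda>x. trig_poly F c x * f x) n = (\<Sum>k\<in>F. c k * fcoef f (n - k))"
proof -
  have "torus_integrable (\<lambda>x. c k * (tchar k x * f x))" for k
    by (rule torus_integrable_bounded_mult[of "\<lambda>_. c k" "norm (c k)"])
       (auto intro: torus_integrable_tchar_mult assms)
  then have "fcoef (\<lambda>x. \<Sum>k\<in>F. c k * (tchar k x * f x)) n = (\<Sum>k\<in>F. fcoef (\<lambda>x. c k * (tchar k x * f x)) n)"
    using assms by (intro fcoef_sum) auto
  then show ?thesis
    by (simp add: fcoef_cmult fcoef_tchar_mult trig_poly_def sum_distrib_right mult.assoc)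
qed

lemma fcoef_trig_poly:
  assumes "finite F"
  shows "fcoef (trig_poly F c) n = (if n \<in> F then c n else 0)"
proof -
  have "fcoef (trig_poly F c) n = (\<Sum>k\<in>F. c k * fcoef (tchar 0) (n - k))"
    using fcoef_mult_trig_poly[OF assms torus_integrable_tchar[of 0], of c n] by simp
  also have "\<dots> = (\<Sum>k\<in>F. if k = n then c k else 0)"
    by (intro sum.cong) (auto simp: fcoef_tchar_self)
  finally show ?thesis using assms by simp
qed

lemma integral_cnj_trig_poly:
  assumes "finite F" "torus_integrable f"
  shows "(TINT x. f x * cnj (trig_poly F c x)) = 2 * pi * (\<Sum>k\<in>F. cnj (c k) * fcoef f k)"
proof -
  have "torus_integrable (\<lambda>x. cnj (c k) * (tchar (- k) x * f x))" for k
    by (rule torus_integrable_bounded_mult[of "\<lambda>_. cnj (c k)" "norm (c k)"])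
       (auto intro: torus_integrable_tchar_mult assms)
  then have "(TINT x. (\<Sum>k\<in>F. cnj (c k) * (tchar (- k) x * f x)))
      = (\<Sum>k\<in>F. TINT x. cnj (c k) * (tchar (- k) x * f x))"
    by (intro Bochner_Integration.integral_sum torus_integrableD(3))
  also have "\<dots> = (\<Sum>k\<in>F. cnj (c k) * (2 * pi * fcoef f k))"
    by (simp add: fcoef_tchar)
  finally show ?thesis
    by (simp add: trig_poly_def cnj_char sum_distrib_left mult_ac)
qed

lemma integral_norm_trig_poly:
  assumes "finite F"
  shows "(TINT x. (norm (trig_poly F c x))\<^sup>2) = 2 * pi * (\<Sum>k\<in>F. (norm (c k))\<^sup>2)"
proof -
  have "complex_of_real (TINT x. (norm (trig_poly F c x))\<^sup>2)
      = (TINT x. trig_poly F c x * cnj (trig_poly F c x))"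
    by (simp add: complex_norm_square[symmetric] flip: integral_complex_of_real)
  also have "\<dots> = 2 * pi * (\<Sum>k\<in>F. cnj (c k) * c k)"
    unfolding integral_cnj_trig_poly[OF assms torus_integrable_trig_poly]
    by (intro arg_cong2[where f = "(*)"] refl sum.cong) (auto simp: fcoef_trig_poly assms)
  also have "\<dots> = complex_of_real (2 * pi * (\<Sum>k\<in>F. (norm (c k))\<^sup>2))"
    by (simp add: mult.commute flip: complex_norm_square)
  finally show ?thesis
    unfolding of_real_eq_iff .
qed

text \<open>The integral of |f - P|^2 is nonnegative, where P is the partial sum over
  \<open>F\<close>; expanding it gives the claim. The bound on f makes each term of the expansion
  integrable.\<close>

lemma bessel:
  assumes f: "torus_integrable f" "\<And>x. norm (f x) \<le> B" and F: "finite F"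
  shows "(\<Sum>n\<in>F. (norm (fcoef f n))\<^sup>2) \<le> (TINT x. (norm (f x))\<^sup>2) / (2 * pi)"
proof -
  define P where "P = trig_poly F (fcoef f)"
  define S where "S = (\<Sum>n\<in>F. (norm (fcoef f n))\<^sup>2)"
  have [measurable]: "f \<in> borel_measurable borel" using f by (blast dest: torus_integrableD)
  have [measurable]: "P \<in> borel_measurable borel" by (simp add: P_def)
  have Pb: "norm (P x) \<le> (\<Sum>k\<in>F. norm (fcoef f k))" for x
    unfolding P_def by (rule norm_trig_poly_le)
  have bd: "integrable torus_measure g" if "g \<in> borel_measurable borel" "\<And>x. norm (g x) \<le> C"
    for g :: "real \<Rightarrow> 'b::{banach, second_countable_topology}" and C
    using that by (intro torus.integrable_const_bound[of _ C] AE_I2 borel_measurable_torus)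
  have i1: "integrable torus_measure (\<lambda>x. (norm (f x))\<^sup>2)"
    by (rule bd[of _ "B\<^sup>2"]) (auto intro!: power_mono f)
  have i2: "integrable torus_measure (\<lambda>x. (norm (P x))\<^sup>2)"
    by (rule bd[of _ "(\<Sum>k\<in>F. norm (fcoef f k))\<^sup>2"]) (auto intro!: power_mono Pb)
  have i3: "integrable torus_measure (\<lambda>x. f x * cnj (P x))"
  proof (rule bd)
    show "norm (f x * cnj (P x)) \<le> B * (\<Sum>k\<in>F. norm (fcoef f k))" for x
      using order_trans[OF norm_ge_zero f(2)[of x]] by (auto simp: norm_mult intro!: mult_mono f Pb)
  qed simp
  have "0 \<le> (TINT x. (norm (f x - P x))\<^sup>2)"
    by simp
  also have "\<dots> = (TINT x. (norm (f x))\<^sup>2 + (norm (P x))\<^sup>2 - 2 * Re (f x * cnj (P x)))"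
    unfolding cmod_power2 by (simp add: power2_eq_square algebra_simps)
  also have "\<dots> = (TINT x. (norm (f x))\<^sup>2) + (TINT x. (norm (P x))\<^sup>2)
      - 2 * Re (TINT x. f x * cnj (P x))"
    using i1 i2 integrable_Re[OF i3]
    by (simp only: integral_Re[OF i3, symmetric] Bochner_Integration.integral_diff
        Bochner_Integration.integral_add integral_mult_right_zero integrable_mult_right
        Bochner_Integration.integrable_add)
  also have "(TINT x. f x * cnj (P x)) = complex_of_real (2 * pi * S)"
    unfolding P_def integral_cnj_trig_poly[OF F f(1)] S_def
    by (simp add: mult.commute flip: complex_norm_square)
  also have "(TINT x. (norm (P x))\<^sup>2) = 2 * pi * S"
    unfolding P_def S_def by (rule integral_norm_trig_poly[OF F])
  finally show ?thesis
    by (simp add: field_simps S_def)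
qed

lemma integral_norm_trig_poly_le:
  assumes F: "finite F" and s: "(\<Sum>k\<in>F. (norm (c k))\<^sup>2) \<le> s\<^sup>2" "0 < s"
  shows "(TINT x. norm (trig_poly F c x)) \<le> 2 * pi * s"
proof -
  let ?P = "trig_poly F c"
  have i: "integrable torus_measure (\<lambda>x. (norm (?P x))\<^sup>2)"
    by (rule torus.integrable_const_bound[of _ "(\<Sum>k\<in>F. norm (c k))\<^sup>2"])
       (auto intro!: power_mono norm_trig_poly_le)
  \<comment> \<open>The inequality 2|P| \<le> s + |P|^2 / s takes the place of Cauchy-Schwarz; since
    s bounds the l^2 norm of the coefficients, both halves are at most
    \<open>2 * pi * s\<close>.\<close>
  have "(TINT x. norm (?P x)) \<le> (TINT x. (s + (norm (?P x))\<^sup>2 / s) / 2)"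
  proof (rule integral_mono)
    show "integrable torus_measure (\<lambda>x. norm (?P x))"
      using torus_integrable_trig_poly by (auto dest: torus_integrableD(3))
    show "norm (?P x) \<le> (s + (norm (?P x))\<^sup>2 / s) / 2" for x
      using s(2) zero_le_power2[of "s - norm (?P x)"] by (simp add: field_simps power2_eq_square)
  qed (use i in auto)
  also have "\<dots> = (2 * pi * s + 2 * pi * (\<Sum>k\<in>F. (norm (c k))\<^sup>2) / s) / 2"
    using i by (simp add: integral_norm_trig_poly[OF F])
  also have "\<dots> \<le> (2 * pi * s + 2 * pi * s\<^sup>2 / s) / 2"
    using s by (intro divide_right_mono add_left_mono mult_left_mono) auto
  also have "\<dots> = 2 * pi * s"
    using s by (simp add: power2_eq_square)
  finally show ?thesis .
qed

section \<open>Uniqueness and $L^1$ approximation by partial sums\<close>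

lemma cis_inj_close: "cis x = cis y \<Longrightarrow> \<bar>x - y\<bar> < 2 * pi \<Longrightarrow> x = y"
  using exp_complex_eqI[of "\<i> * x" "\<i> * y"] by (simp add: cis_conv_exp)

text \<open>A real-linear functional on the plane is, on the unit circle, a trigonometric polynomial
  of degree one. This is the base case that turns real polynomials in \<open>cis x\<close> into
  multipliers.\<close>

lemma bounded_linear_circle:
  fixes f :: "complex \<Rightarrow> real"
  assumes "bounded_linear f"
  shows "complex_of_real (f (cis x)) =
     (f 1 - \<i> * f \<i>) / 2 * tchar 1 x + (f 1 + \<i> * f \<i>) / 2 * tchar (- 1) x"
proof -
  interpret bounded_linear f by fact
  have "cis x = cos x *\<^sub>R 1 + sin x *\<^sub>R \<i>"
    by (simp add: complex_eq_iff)
  then have "f (cis x) = cos x * f 1 + sin x * f \<i>"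
    by (simp only: add scaleR real_scaleR_def)
  then show ?thesis
    by (simp add: tchar_def complex_eq_iff field_simps)
qed

text \<open>The property survives multiplication by characters, which only shift coefficients. The
  uniqueness proof enlarges the class of multipliers against which g integrates to 0: polynomials on
  the circle, continuous functions, indicators of half-lines, indicators of Borel sets.\<close>

definition fourier_null :: "(real \<Rightarrow> complex) \<Rightarrow> bool" where
  "fourier_null g \<longleftrightarrow> torus_integrable g \<and> (\<forall>n. fcoef g n = 0)"

lemma fourier_null_cmult: "fourier_null g \<Longrightarrow> fourier_null (\<lambda>x. c * g x)"
  unfolding fourier_null_def
  by (auto simp: fcoef_cmult intro: torus_integrable_bounded_mult[of "\<lambda>_. c" "norm c"])

lemma fourier_null_add: "fourier_null f \<Longrightarrow> fourier_null g \<Longrightarrow> fourier_null (\<lambda>x. f x + g x)"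
  unfolding fourier_null_def by (auto simp: fcoef_add torus_integrable_add)

lemma fourier_null_tchar: "fourier_null g \<Longrightarrow> fourier_null (\<lambda>x. tchar k x * g x)"
  unfolding fourier_null_def by (auto simp: fcoef_tchar_mult torus_integrable_tchar_mult)

text \<open>The function g is kept arbitrary in the induction because the product case applies the
  hypothesis for one factor to the other factor times g.\<close>

lemma fourier_null_polynomial:
  fixes p :: "complex \<Rightarrow> real"
  assumes "real_polynomial_function p" "fourier_null g"
  shows "fourier_null (\<lambda>x. complex_of_real (p (cis x)) * g x)"
  using assms
proof (induction arbitrary: g rule: real_polynomial_function.induct)
  case (linear f)
  have "fourier_null (\<lambda>x. (f 1 - \<i> * f \<i>) / 2 * (tchar 1 x * g x)
      + (f 1 + \<i> * f \<i>) / 2 * (tchar (- 1) x * g x))"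
    by (intro fourier_null_add fourier_null_cmult fourier_null_tchar linear)
  then show ?case
    by (simp add: bounded_linear_circle[OF linear(1)] distrib_right mult.assoc)
next
  case (const c)
  then show ?case by (intro fourier_null_cmult)
next
  case (add f1 f2)
  then show ?case
    using fourier_null_add[OF add.IH(1)[OF add.prems] add.IH(2)[OF add.prems]]
    by (simp add: distrib_right)
next
  case (mult f1 f2)
  then show ?case
    using mult.IH(1)[OF mult.IH(2)[OF mult.prems]] by (simp add: mult.assoc)
qed

lemma fourier_null_continuous:
  fixes \<phi> :: "complex \<Rightarrow> real"
  assumes \<phi>: "continuous_on UNIV \<phi>" and g: "fourier_null g"
  shows "(TINT x. complex_of_real (\<phi> (cis x)) * g x) = 0"
proof -
  let ?I = "TINT x. complex_of_real (\<phi> (cis x)) * g x"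
  have gi: "torus_integrable g" using g by (simp add: fourier_null_def)
  have [measurable]: "\<phi> \<in> borel_measurable borel"
    by (rule borel_measurable_continuous_onI[OF \<phi>])
  have [measurable]: "g \<in> borel_measurable borel"
    by (rule torus_integrableD(1)[OF gi])
  have "norm ?I \<le> e * (1 + (TINT x. norm (g x)))" if e: "e > 0" for e
  proof -
    obtain p where p: "real_polynomial_function p" "\<And>z. z \<in> sphere 0 1 \<Longrightarrow> \<bar>\<phi> z - p z\<bar> < e"
      using Stone_Weierstrass_real_polynomial_function[of "sphere 0 1" \<phi> e] e
        continuous_on_subset[OF \<phi>] by auto
    have n: "fourier_null (\<lambda>x. complex_of_real (p (cis x)) * g x)"
      by (rule fourier_null_polynomial[OF p(1) g])
    have zero: "(TINT x. complex_of_real (p (cis x)) * g x) = 0"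
    proof -
      have "fcoef (\<lambda>x. complex_of_real (p (cis x)) * g x) 0 = 0"
        using n unfolding fourier_null_def by blast
      then show ?thesis by (simp add: fcoef_tchar)
    qed
    have int1: "integrable torus_measure (\<lambda>x. complex_of_real (p (cis x)) * g x)"
      using n unfolding fourier_null_def by (blast intro: torus_integrableD)
    have "continuous_on UNIV p"
    using p(1) by (intro continuous_on_polymonial_function) (simp add: real_polynomial_function_eq)
    then have [measurable]: "p \<in> borel_measurable borel"
      by (rule borel_measurable_continuous_onI)
    have int2: "integrable torus_measure (\<lambda>x. complex_of_real (\<phi> (cis x) - p (cis x)) * g x)"
    proof (rule Bochner_Integration.integrable_bound)
      show "integrable torus_measure (\<lambda>x. e * norm (g x))"
        using torus_integrableD(3)[OF gi] by simp
      show "AE x in torus_measure. norm (complex_of_real (\<phi> (cis x) - p (cis x)) * g x) \<le> norm (e * norm (g x))"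
      proof (rule AE_I2)
        fix x
        have "\<bar>\<phi> (cis x) - p (cis x)\<bar> \<le> e" using p(2)[of "cis x"] by simp
        then show "norm (complex_of_real (\<phi> (cis x) - p (cis x)) * g x) \<le> norm (e * norm (g x))"
          using e by (auto simp: norm_mult abs_mult simp flip: of_real_diff intro!: mult_right_mono)
      qed
    qed simp
    have "?I = (TINT x. complex_of_real (p (cis x)) * g x + complex_of_real (\<phi> (cis x) - p (cis x)) * g x)"
      by (intro Bochner_Integration.integral_cong) (auto simp: algebra_simps)
    also have "\<dots> = (TINT x. complex_of_real (\<phi> (cis x) - p (cis x)) * g x)"
      using Bochner_Integration.integral_add[OF int1 int2] zero by simp
    finally have "norm ?I \<le> (TINT x. norm (complex_of_real (\<phi> (cis x) - p (cis x)) * g x))"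
      using integral_norm_bound by metis
    also have "\<dots> \<le> (TINT x. e * norm (g x))"
    proof (rule integral_mono)
      show "norm (complex_of_real (\<phi> (cis x) - p (cis x)) * g x) \<le> e * norm (g x)" for x
        using p(2)[of "cis x"] by (auto simp: norm_mult simp flip: of_real_diff intro!: mult_right_mono)
    qed (use int2 torus_integrableD(3)[OF gi] in auto)
    also have "\<dots> \<le> e * (1 + (TINT x. norm (g x)))"
      using e by (simp add: distrib_left)
    finally show ?thesis .
  qed
  note small = this
  show ?thesis
  proof (rule ccontr)
    assume "?I \<noteq> 0"
    \<comment> \<open>The summand 1 in the bound keeps J positive even when g vanishes, so that e
      can be taken as the integral's norm divided by 2J.\<close>
    define J where "J = 1 + (TINT x. norm (g x))"
    have J: "J > 0" by (auto simp: J_def intro!: add_pos_nonneg)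
    have "norm ?I / (2 * J) > 0" using J \<open>?I \<noteq> 0\<close> by simp
    from small[OF this] show False
      using J \<open>?I \<noteq> 0\<close> by (simp add: J_def[symmetric])
  qed
qed

text \<open>The set C is the closed arc of angles up to a, and \<open>\<phi> j\<close> increases to
  the indicator of its complement. For negative a the arc would be empty; there the zeroth
  coefficient already gives the claim.\<close>

lemma fourier_null_halfline:
  assumes g: "fourier_null g"
  shows "(TINT x. indicator {a<..} x *\<^sub>R g x) = 0"
proof (cases "a < 0")
  case True
  have "(TINT x. indicator {a<..} x *\<^sub>R g x) = (TINT x. g x)"
    using True by (intro Bochner_Integration.integral_cong) (auto simp: indicator_def)
  moreover have "fcoef g 0 = 0" using g by (simp add: fourier_null_def)
  ultimately show ?thesis by (simp add: fcoef_tchar)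
next
  case False
  define C where "C = cis ` ({0..2 * pi} \<inter> {..a})"
  define \<phi> where "\<phi> j z = min 1 (real j * infdist z C)" for j z
  have gi: "torus_integrable g" using g by (simp add: fourier_null_def)
  have [measurable]: "g \<in> borel_measurable borel"
    by (rule torus_integrableD(1)[OF gi])
  have cont: "continuous_on UNIV (\<phi> j)" for j
    unfolding \<phi>_def by (intro continuous_intros)
  then have [measurable]: "\<phi> j \<in> borel_measurable borel" for j
    by (rule borel_measurable_continuous_onI)
  have C: "closed C" "C \<noteq> {}"
  proof -
    have "compact C" unfolding C_def
      by (intro compact_continuous_image continuous_intros compact_Int_closed) auto
    then show "closed C" by (rule compact_imp_closed)
    show "C \<noteq> {}" using False by (auto simp: C_def intro!: exI[of _ 0])
  qed
  have "(\<lambda>j. TINT x. complex_of_real (\<phi> j (cis x)) * g x)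
      \<longlonglongrightarrow> (TINT x. indicator {a<..} x *\<^sub>R g x)"
  proof (rule integral_dominated_convergence[where w = "\<lambda>x. norm (g x)"])
    \<comment> \<open>The endpoint must be dropped: \<open>cis (2 * pi)\<close> equals
      \<open>cis 0\<close> and lies in C, although \<open>2 * pi\<close> may exceed a.\<close>
    have "AE x in lborel. x \<noteq> 2 * pi" by (rule AE_lborel_singleton)
    then have "AE x in torus_measure. x \<noteq> 2 * pi" by (rule AE_torus)
    moreover have "AE x in torus_measure. x \<in> {0..2 * pi}" by (rule AE_I2) simp
    ultimately show "AE x in torus_measure. (\<lambda>j. complex_of_real (\<phi> j (cis x)) * g x)
        \<longlonglongrightarrow> indicator {a<..} x *\<^sub>R g x"
    proof eventually_elim
      case (elim x)
      show ?case
      proof (cases "x \<le> a")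
        case True
        then have "cis x \<in> C" using elim by (auto simp: C_def)
        then show ?thesis using True by (simp add: \<phi>_def)
      next
        case False
        have "cis x \<notin> C"
        proof
          assume "cis x \<in> C"
          then obtain y where y: "0 \<le> y" "y \<le> a" "cis x = cis y" by (auto simp: C_def)
          then have "x = y" using elim False by (intro cis_inj_close) auto
          then show False using y False by simp
        qed
        then have pos: "infdist (cis x) C > 0"
          using C by (simp add: infdist_pos_not_in_closed)
        obtain j0 :: nat where j0: "1 / infdist (cis x) C \<le> real j0"
          using real_arch_simple by blast
        have "\<phi> j (cis x) = 1" if "j \<ge> j0" for j
        proof -
          have "1 / infdist (cis x) C \<le> real j" using j0 that by linarith
          then show ?thesis using pos by (simp add: \<phi>_def field_simps)
        qed
        then have "eventually (\<lambda>j. complex_of_real (\<phi> j (cis x)) * g x = indicator {a<..} x *\<^sub>R g x) sequentially"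
          using False by (auto simp: eventually_sequentially)
        then show ?thesis by (rule tendsto_eventually)
      qed
    qed
    show "AE x in torus_measure. norm (complex_of_real (\<phi> j (cis x)) * g x) \<le> norm (g x)" for j
    proof (rule AE_I2)
      fix x
      have "\<bar>\<phi> j (cis x)\<bar> \<le> 1" by (auto simp: \<phi>_def infdist_nonneg)
      then show "norm (complex_of_real (\<phi> j (cis x)) * g x) \<le> norm (g x)"
        by (auto simp: norm_mult intro!: mult_left_le_one_le)
    qed
  qed (use torus_integrableD(3)[OF gi] in auto)
  moreover have "(TINT x. complex_of_real (\<phi> j (cis x)) * g x) = 0" for j
    by (rule fourier_null_continuous[OF cont g])
  ultimately have "(\<lambda>j::nat. 0) \<longlonglongrightarrow> (TINT x. indicator {a<..} x *\<^sub>R g x)"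
    by simp
  then show ?thesis
    by (simp add: LIMSEQ_const_iff)
qed

lemma sets_torus_measure: "A \<in> sets torus_measure \<Longrightarrow> A \<in> sets borel"
  by (auto simp: torus_measure_def sets_restrict_space)

text \<open>Half-lines form an intersection-stable generator of the Borel sets, and the sets over
  which g integrates to 0 are closed under complement and disjoint union. Applied to real and
  imaginary parts, vanishing over all Borel sets forces g = 0 almost everywhere.\<close>

theorem fourier_uniqueness:
  assumes g: "fourier_null g"
  shows "AE x in lborel. g x = 0"
proof -
  have gi: "torus_integrable g" using g by (simp add: fourier_null_def)
  note int = torus_integrableD(3)[OF gi]
  have [measurable]: "g \<in> borel_measurable borel"
    by (rule torus_integrableD(1)[OF gi])
  have int_ind: "integrable torus_measure (\<lambda>x. indicator A x *\<^sub>R g x)" if "A \<in> sets borel" for A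
    by (rule Bochner_Integration.integrable_bound[OF int]) (use that in \<open>auto simp: indicator_def\<close>)
  have tot: "(TINT x. g x) = 0"
  proof -
    have "fcoef g 0 = 0" using g by (simp add: fourier_null_def)
    then show ?thesis by (simp add: fcoef_tchar)
  qed
  have zero: "(TINT x. indicator A x *\<^sub>R g x) = 0" if "A \<in> sets borel" for A
  proof -
    have mem: "A \<in> sigma_sets UNIV (range greaterThan)"
      using that by (subst (asm) borel_Ioi) simp
    have stable: "Int_stable (range (greaterThan :: real \<Rightarrow> _))"
    proof -
      have "{a<..} \<inter> {b<..} = {max a b<..}" for a b :: real by auto
      then show ?thesis by (auto simp: Int_stable_def)
    qed
    have sub: "range (greaterThan :: real \<Rightarrow> _) \<subseteq> Pow UNIV" by simp
    from stable sub mem show ?thesis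
    proof (induction rule: sigma_sets_induct_disjoint)
      case (basic A)
      then show ?case using fourier_null_halfline[OF g] by auto
    next
      case empty
      then show ?case by simp
    next
      case (compl A)
      then have A: "A \<in> sets borel" by (subst borel_Ioi) simp
      have "(TINT x. indicator (UNIV - A) x *\<^sub>R g x)
          = (TINT x. g x - indicator A x *\<^sub>R g x)"
        by (intro Bochner_Integration.integral_cong) (auto simp: indicator_def)
      also have "\<dots> = 0"
        using compl.IH tot int_ind[OF A] int by simp
      finally show ?case .
    next
      case (union A)
      then have A: "A i \<in> sets borel" for i by (subst borel_Ioi) auto
      have "(\<lambda>n. TINT x. indicator (\<Union>i<n. A i) x *\<^sub>R g x)
        \<longlonglongrightarrow> (TINT x. indicator (\<Union>i. A i) x *\<^sub>R g x)"
      proof (rule integral_dominated_convergence[where w = "\<lambda>x. norm (g x)"])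
        show "AE x in torus_measure. (\<lambda>n. indicator (\<Union>i<n. A i) x *\<^sub>R g x)
            \<longlonglongrightarrow> indicator (\<Union>i. A i) x *\<^sub>R g x"
          by (intro AE_I2 tendsto_intros LIMSEQ_indicator_UN)
      qed (use A int in \<open>auto simp: indicator_def\<close>)
      moreover have "(TINT x. indicator (\<Union>i<n. A i) x *\<^sub>R g x) = 0" for n
      proof -
        have "(TINT x. indicator (\<Union>i<n. A i) x *\<^sub>R g x)
           = (TINT x. (\<Sum>i<n. indicator (A i) x *\<^sub>R g x))"
        proof (intro Bochner_Integration.integral_cong refl)
          fix x
          have "indicator (\<Union>i<n. A i) x = (\<Sum>i<n. indicator (A i) x :: real)"
            by (rule indicator_UN_disjoint) (use union in \<open>auto intro: disjoint_family_on_mono\<close>)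
          then show "indicator (\<Union>i<n. A i) x *\<^sub>R g x = (\<Sum>i<n. indicator (A i) x *\<^sub>R g x)"
            by (simp add: scaleR_sum_left)
        qed
        also have "\<dots> = (\<Sum>i<n. TINT x. indicator (A i) x *\<^sub>R g x)"
          by (intro Bochner_Integration.integral_sum int_ind A)
        finally show ?thesis using union by simp
      qed
      ultimately have "(\<lambda>n::nat. 0) \<longlonglongrightarrow> (TINT x. indicator (\<Union>i. A i) x *\<^sub>R g x)"
        by simp
      then show ?case
        by (simp add: LIMSEQ_const_iff)
    qed
  qed
  have "AE x in torus_measure. Re (g x) = 0"
  proof (rule density_unique_real)
    fix A assume "A \<in> sets torus_measure"
    then have "A \<in> sets borel" by (rule sets_torus_measure)
    from zero[OF this] integral_Re[OF int_ind[OF this]]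
    show "(LINT x:A|torus_measure. Re (g x)) = (LINT x:A|torus_measure. 0)"
      by (simp add: set_lebesgue_integral_def)
  qed (use int in auto)
  moreover have "AE x in torus_measure. Im (g x) = 0"
  proof (rule density_unique_real)
    fix A assume "A \<in> sets torus_measure"
    then have "A \<in> sets borel" by (rule sets_torus_measure)
    from zero[OF this] integral_Im[OF int_ind[OF this]]
    show "(LINT x:A|torus_measure. Im (g x)) = (LINT x:A|torus_measure. 0)"
      by (simp add: set_lebesgue_integral_def)
  qed (use int in auto)
  ultimately have "AE x in torus_measure. norm (g x) = 0"
    by eventually_elim (simp add: complex_eq_iff)
  then have "(LBINT x:{0..2 * pi}. norm (g x)) = 0"
    unfolding LBINT_torus by (rule integral_eq_zero_AE)
  then show ?thesis
    by (rule torus_integrable_AE_zero[OF gi])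
qed

section \<open>Riesz-Fischer, Parseval and the convolution formula\<close>

lemma summable_on_nested_tails:
  fixes w :: "int \<Rightarrow> real"
  assumes w: "w summable_on UNIV" "\<And>n. 0 \<le> w n" and \<epsilon>: "\<And>j. 0 < \<epsilon> j"
  obtains F :: "nat \<Rightarrow> int set"
  where "\<And>j. finite (F j)" "\<And>j. F j \<subseteq> F (Suc j)" "\<And>n. eventually (\<lambda>j. n \<in> F j) sequentially"
    "\<And>j G. finite G \<Longrightarrow> G \<inter> F j = {} \<Longrightarrow> sum w G \<le> \<epsilon> j"
proof -
  define S where "S = infsum w UNIV"
  have "(sum w \<longlongrightarrow> S) (finite_subsets_at_top UNIV)"
    using w(1) by (simp add: S_def infsum_tendsto)
  then have "\<exists>X. finite X \<and> (\<forall>Y. finite Y \<and> X \<subseteq> Y \<longrightarrow> dist (sum w Y) S < \<epsilon> j)" for j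
    using \<epsilon>[of j] by (auto simp: tendsto_iff eventually_finite_subsets_at_top)
  then obtain X where X: "\<And>j. finite (X j)" "\<And>j Y. finite Y \<Longrightarrow> X j \<subseteq> Y \<Longrightarrow> dist (sum w Y) S < \<epsilon> j"
    by metis
  have le: "sum w Y \<le> S" if "finite Y" for Y
    unfolding S_def by (rule finite_sum_le_infsum) (use w that in auto)
  \<comment> \<open>The union over earlier indices makes the sets nested; the interval makes them
    exhaust the integers even where w vanishes.\<close>
  define F where "F j = (\<Union>i\<le>j. X i) \<union> {- int j..int j}" for j
  show ?thesis
  proof (rule that[of F])
    show fin: "finite (F j)" for j by (simp add: F_def X)
    show "F j \<subseteq> F (Suc j)" for j by (fastforce simp: F_def intro: le_SucI)
    show "eventually (\<lambda>j. n \<in> F j) sequentially" for n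
      by (rule eventually_sequentiallyI[of "nat \<bar>n\<bar>"]) (auto simp: F_def)
    fix j G assume G: "finite G" "G \<inter> F j = {}"
    have "dist (sum w (F j)) S < \<epsilon> j" by (rule X(2)[OF fin]) (auto simp: F_def)
    then have "S - sum w (F j) < \<epsilon> j" by (simp add: dist_real_def)
    moreover have "sum w G + sum w (F j) \<le> S"
      using le[of "G \<union> F j"] G fin by (simp add: sum.union_disjoint)
    ultimately show "sum w G \<le> \<epsilon> j" by linarith
  qed
qed

text \<open>By monotone convergence the sum of the norms has finite integral, hence is finite almost
  everywhere.\<close>

lemma AE_summable_norm:
  fixes d :: "nat \<Rightarrow> 'a \<Rightarrow> 'b::{banach, second_countable_topology}"
  assumes d: "\<And>j. integrable M (d j)" and b: "\<And>j. (\<integral>x. norm (d j x) \<partial>M) \<le> b j" and s: "summable b"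
  shows "AE x in M. summable (\<lambda>j. norm (d j x))" "summable (\<lambda>j. \<integral>x. norm (d j x) \<partial>M)"
proof -
  show s2: "summable (\<lambda>j. \<integral>x. norm (d j x) \<partial>M)"
    by (rule summable_comparison_test'[OF s, of 0]) (use b in auto)
  have [measurable]: "d j \<in> borel_measurable M" for j using d by auto
  have "(\<integral>\<^sup>+x. (\<Sum>j. ennreal (norm (d j x))) \<partial>M) = (\<Sum>j. \<integral>\<^sup>+x. ennreal (norm (d j x)) \<partial>M)"
    by (rule nn_integral_suminf) measurable
  also have "\<dots> = (\<Sum>j. ennreal (\<integral>x. norm (d j x) \<partial>M))"
    by (intro suminf_cong nn_integral_eq_integral) (auto simp: d)
  also have "\<dots> = ennreal (\<Sum>j. \<integral>x. norm (d j x) \<partial>M)"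
    by (rule suminf_ennreal2) (auto simp: s2)
  finally have "(\<integral>\<^sup>+x. (\<Sum>j. ennreal (norm (d j x))) \<partial>M) \<noteq> \<infinity>"
    by simp
  then have "AE x in M. (\<Sum>j. ennreal (norm (d j x))) \<noteq> \<infinity>"
    by (intro nn_integral_PInf_AE) auto
  then show "AE x in M. summable (\<lambda>j. norm (d j x))"
    by eventually_elim (auto intro: summable_suminf_not_top)
qed

text \<open>Riesz-Fischer: a subsequence of the partial sums converges in $L^1$, and by uniqueness its
  limit is the function itself.\<close>

theorem L1_approx_partial_sums:
  assumes g: "torus_integrable g" and s: "(\<lambda>n. (norm (fcoef g n))\<^sup>2) summable_on UNIV"
  obtains F :: "nat \<Rightarrow> int set"
  where "\<And>j. finite (F j)"
    "(\<lambda>j. TINT x. norm (g x - trig_poly (F j) (fcoef g) x)) \<longlonglongrightarrow> 0"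
proof -
  let ?c = "fcoef g"
  \<comment> \<open>Tails of squared coefficients are at most the square of 2^(-j), so that
    \<open>integral_norm_trig_poly_le\<close> makes the L^1 norms of the increments geometrically
    small.\<close>
  obtain F where F: "\<And>j. finite (F j)" "\<And>j. F j \<subseteq> F (Suc j)"
    "\<And>n. eventually (\<lambda>j. n \<in> F j) sequentially"
    "\<And>j G. finite G \<Longrightarrow> G \<inter> F j = {} \<Longrightarrow> (\<Sum>n\<in>G. (norm (?c n))\<^sup>2) \<le> ((1/2) ^ j)\<^sup>2"
    by (rule summable_on_nested_tails[OF s, of "\<lambda>j. ((1/2) ^ j)\<^sup>2"]) auto
  define P where "P j = trig_poly (F j) ?c" for j
  define d where "d j x = P (Suc j) x - P j x" for j x
  have d_alt: "d j = trig_poly (F (Suc j) - F j) ?c" for j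
    unfolding d_def P_def trig_poly_def using F(1,2) by (simp add: sum_diff fun_eq_iff)
  have dint: "integrable torus_measure (d j)" for j
    unfolding d_alt using torus_integrable_trig_poly by (rule torus_integrableD(3))
  have db: "(TINT x. norm (d j x)) \<le> 2 * pi * (1/2) ^ j" for j
    unfolding d_alt by (rule integral_norm_trig_poly_le) (use F(1) in \<open>auto intro!: F(4)\<close>)
  have sb: "summable (\<lambda>j. 2 * pi * (1/2::real) ^ j)"
    by (intro summable_mult summable_geometric) simp
  note ae = AE_summable_norm(1)[OF dint db sb] and sd = AE_summable_norm(2)[OF dint db sb]
  define G where "G x = P 0 x + (\<Sum>j. d j x)" for x
  have [measurable]: "P j \<in> borel_measurable borel" "d j \<in> borel_measurable borel" for j
    by (simp_all add: P_def d_alt)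
  have Pint: "integrable torus_measure (P j)" for j
    unfolding P_def using torus_integrable_trig_poly by (rule torus_integrableD(3))
  have Gint: "torus_integrable G"
    unfolding torus_integrable_altdef
  proof (intro conjI allI)
    show "G \<in> borel_measurable borel" unfolding G_def [abs_def] by measurable
    show "G (x + 2 * pi) = G x" for x
      by (simp add: G_def d_def P_def trig_poly_period)
    show "integrable torus_measure G"
      unfolding G_def [abs_def] using Pint integrable_suminf[OF dint ae sd] by simp
  qed
  have psum: "P 0 x + (\<Sum>i<j. d i x) = P j x" for j x
    by (simp add: d_def sum_lessThan_telescope[where f = "\<lambda>i. P i x"])
  have Dint: "integrable torus_measure (\<lambda>x. \<Sum>j. norm (d j x))"
    using dint ae sd by (intro integrable_suminf) auto
  have lim: "(\<lambda>j. TINT x. norm (G x - P j x)) \<longlonglongrightarrow> (TINT x. 0)"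
  proof (rule integral_dominated_convergence[where w = "\<lambda>x. \<Sum>j. norm (d j x)"])
    show "AE x in torus_measure. (\<lambda>j. norm (G x - P j x)) \<longlonglongrightarrow> 0"
      using ae
    proof eventually_elim
      case (elim x)
      have "(\<lambda>j. P 0 x + (\<Sum>i<j. d i x)) \<longlonglongrightarrow> P 0 x + (\<Sum>j. d j x)"
        by (intro tendsto_intros summable_LIMSEQ summable_norm_cancel[OF elim])
      then have "(\<lambda>j. P j x) \<longlonglongrightarrow> G x" by (simp add: psum G_def)
      then have "(\<lambda>j. G x - P j x) \<longlonglongrightarrow> G x - G x" by (intro tendsto_intros)
      then show ?case by (simp add: tendsto_norm_zero)
    qed
    show "AE x in torus_measure. norm (norm (G x - P j x)) \<le> (\<Sum>j. norm (d j x))" for j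
      using ae
    proof eventually_elim
      case (elim x)
      have "G x - P j x = (\<Sum>i. d i x) - (\<Sum>i<j. d i x)"
        unfolding G_def psum[of x j, symmetric] by simp
      also have "\<dots> = (\<Sum>i. d (i + j) x)"
        by (rule suminf_minus_initial_segment[OF summable_norm_cancel[OF elim], symmetric])
      finally have "norm (G x - P j x) \<le> (\<Sum>i. norm (d (i + j) x))"
        using summable_norm[of "\<lambda>i. d (i + j) x"] elim by (simp add: summable_iff_shift[where f="\<lambda>i. norm (d i x)"])
      also have "\<dots> = (\<Sum>i. norm (d i x)) - (\<Sum>i<j. norm (d i x))"
        by (rule suminf_minus_initial_segment[OF elim])
      also have "\<dots> \<le> (\<Sum>i. norm (d i x))"
        by (simp add: sum_nonneg)
      finally show ?case by simp
    qed
  qed (use Dint torus_integrableD(1)[OF Gint] in auto)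
  \<comment> \<open>Coefficients are continuous in L^1, and the n-th coefficient of
    \<open>P j\<close> is \<open>?c n\<close> as soon as n belongs to \<open>F j\<close>.\<close>
  have coef: "fcoef G n = ?c n" for n
  proof -
    have ti: "torus_integrable (\<lambda>x. G x - P j x)" for j
      unfolding P_def by (intro torus_integrable_diff Gint torus_integrable_trig_poly)
    have "(\<lambda>j. norm (fcoef (\<lambda>x. G x - P j x) n)) \<longlonglongrightarrow> 0"
    proof (rule tendsto_sandwich[OF _ _ tendsto_const])
      show "eventually (\<lambda>j. norm (fcoef (\<lambda>x. G x - P j x) n)
          \<le> (TINT x. norm (G x - P j x)) / (2 * pi)) sequentially"
        by (intro always_eventually allI fcoef_bound ti)
      show "(\<lambda>j. (TINT x. norm (G x - P j x)) / (2 * pi)) \<longlonglongrightarrow> 0"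
        using tendsto_divide[OF lim tendsto_const[of "2 * pi"]] by simp
    qed auto
    moreover have "eventually (\<lambda>j. norm (fcoef (\<lambda>x. G x - P j x) n) = norm (fcoef G n - ?c n)) sequentially"
      using F(3)[of n]
    proof eventually_elim
      case (elim j)
      then show ?case
        unfolding P_def fcoef_diff[OF Gint torus_integrable_trig_poly] fcoef_trig_poly[OF F(1)] by simp
    qed
    ultimately have "(\<lambda>j::nat. norm (fcoef G n - ?c n)) \<longlonglongrightarrow> 0"
      by (rule Lim_transform_eventually)
    then show ?thesis by (simp add: LIMSEQ_const_iff)
  qed
  have "fourier_null (\<lambda>x. g x - G x)"
    using coef by (simp add: fourier_null_def torus_integrable_diff g Gint fcoef_diff)
  then have "AE x in torus_measure. g x - G x = 0"
    by (intro AE_torus fourier_uniqueness)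
  then have aeq: "AE x in torus_measure. norm (g x - P j x) = norm (G x - P j x)" for j
    by eventually_elim simp
  have eq: "(TINT x. norm (g x - P j x)) = (TINT x. norm (G x - P j x))" for j
    using torus_integrableD(1)[OF g] torus_integrableD(1)[OF Gint]
    by (intro integral_cong_AE aeq) auto
  show ?thesis
    by (rule that[of F]) (use F(1) lim in \<open>auto simp flip: P_def simp: eq\<close>)
qed

lemma bessel_summable:
  assumes "torus_integrable f" "\<And>x. norm (f x) \<le> B"
  shows "(\<lambda>n. (norm (fcoef f n))\<^sup>2) summable_on UNIV"
  using bessel[OF assms]
  by (intro nonneg_bdd_above_summable_on bdd_aboveI[of _ "(TINT x. (norm (f x))\<^sup>2) / (2 * pi)"]) auto

lemma integral_mult_L1_tendsto:
  fixes f :: "real \<Rightarrow> complex"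
  assumes f: "f \<in> borel_measurable borel" "\<And>x. norm (f x) \<le> B"
    and P: "\<And>j. integrable torus_measure (P j)" "integrable torus_measure g"
    and lim: "(\<lambda>j. TINT x. norm (g x - P j x)) \<longlonglongrightarrow> 0"
  shows "(\<lambda>j. TINT x. f x * P j x) \<longlonglongrightarrow> (TINT x. f x * g x)"
proof -
  have int: "integrable torus_measure (\<lambda>x. f x * h x)" if "integrable torus_measure h" for h
  proof (rule Bochner_Integration.integrable_bound)
    show "integrable torus_measure (\<lambda>x. B * norm (h x))" using that by simp
    show "AE x in torus_measure. norm (f x * h x) \<le> norm (B * norm (h x))"
      using order_trans[OF f(2) abs_ge_self] by (auto simp: norm_mult abs_mult intro!: mult_right_mono)
  qed (use f that in auto)
  have "norm ((TINT x. f x * P j x) - (TINT x. f x * g x))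
      \<le> B * (TINT x. norm (g x - P j x))" for j
  proof -
    have "(TINT x. f x * P j x) - (TINT x. f x * g x)
        = (TINT x. f x * P j x - f x * g x)"
      using int P by simp
    also have "norm \<dots> \<le> (TINT x. norm (f x * P j x - f x * g x))"
      by (rule integral_norm_bound)
    also have "\<dots> \<le> (TINT x. B * norm (g x - P j x))"
    proof (rule integral_mono)
      show "norm (f x * P j x - f x * g x) \<le> B * norm (g x - P j x)" for x
        using f(2)[of x] by (auto simp: norm_mult norm_minus_commute intro: mult_right_mono simp flip: right_diff_distrib)
    qed (use int P in auto)
    finally show ?thesis by simp
  qed
  note le = this
  have "(\<lambda>j. B * (TINT x. norm (g x - P j x))) \<longlonglongrightarrow> 0"
    by (rule tendsto_mult_right_zero[OF lim])
  then have "(\<lambda>j. (TINT x. f x * P j x) - (TINT x. f x * g x)) \<longlonglongrightarrow> 0"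
    by (rule Lim_null_comparison[OF always_eventually[OF allI[OF le]]])
  then show ?thesis by (simp add: LIM_zero_iff)
qed

text \<open>Pairing f with its own partial sums gives \<open>2 * pi\<close> times finite sums of
  squared coefficients, and these pairings tend to the integral of |f|^2 by L^1 convergence, f being
  bounded. Bessel's inequality supplies the other direction.\<close>

theorem parseval:
  assumes f: "torus_integrable f" "\<And>x. norm (f x) \<le> B"
  shows "((\<lambda>n. (norm (fcoef f n))\<^sup>2) has_sum (TINT x. (norm (f x))\<^sup>2) / (2 * pi)) UNIV"
proof -
  let ?w = "\<lambda>n. (norm (fcoef f n))\<^sup>2"
  define I where "I = (TINT x. (norm (f x))\<^sup>2)"
  note s = bessel_summable[OF f]
  obtain F where F: "\<And>j. finite (F j)"
    "(\<lambda>j. TINT x. norm (f x - trig_poly (F j) (fcoef f) x)) \<longlonglongrightarrow> 0"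
    using L1_approx_partial_sums[OF f(1) s] by blast
  have "(\<lambda>j. TINT x. cnj (f x) * trig_poly (F j) (fcoef f) x)
      \<longlonglongrightarrow> (TINT x. cnj (f x) * f x)"
    using torus_integrableD[OF f(1)] torus_integrable_trig_poly
    by (intro integral_mult_L1_tendsto[of _ B] F) (auto simp: f(2) intro: torus_integrableD(3))
  also have "(TINT x. cnj (f x) * f x) = complex_of_real I"
    by (simp add: I_def mult.commute complex_norm_square[symmetric] flip: integral_complex_of_real)
  also have "(\<lambda>j. TINT x. cnj (f x) * trig_poly (F j) (fcoef f) x)
      = (\<lambda>j. complex_of_real (2 * pi * sum ?w (F j)))"
  proof
    fix j
    have "(TINT x. cnj (f x) * trig_poly (F j) (fcoef f) x)
        = cnj (TINT x. f x * cnj (trig_poly (F j) (fcoef f) x))"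
      by (simp flip: Bochner_Integration.integral_cnj)
    also have "\<dots> = complex_of_real (2 * pi * sum ?w (F j))"
      unfolding integral_cnj_trig_poly[OF F(1) f(1)] by (simp flip: complex_norm_square)
    finally show "(TINT x. cnj (f x) * trig_poly (F j) (fcoef f) x)
        = complex_of_real (2 * pi * sum ?w (F j))" .
  qed
  finally have "(\<lambda>j. 2 * pi * sum ?w (F j)) \<longlonglongrightarrow> I"
    unfolding tendsto_of_real_iff .
  moreover have "2 * pi * sum ?w (F j) \<le> 2 * pi * infsum ?w UNIV" for j
    using finite_sum_le_infsum[OF s F(1)] by (intro mult_left_mono) auto
  ultimately have "I \<le> 2 * pi * infsum ?w UNIV"
    using LIMSEQ_le_const2 by blast
  moreover have "infsum ?w UNIV \<le> I / (2 * pi)"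
    unfolding I_def by (rule infsum_le_finite_sums[OF s bessel[OF f]])
  ultimately have "infsum ?w UNIV = I / (2 * pi)"
    by (simp add: field_simps)
  then show ?thesis
    using has_sum_infsum[OF s] by (simp add: I_def)
qed

text \<open>One sequence of finite sets serves all n at once, so that an inequality for finitely
  many coefficients of the product can pass to the limit.\<close>

theorem fcoef_mult_tendsto:
  assumes f: "f \<in> borel_measurable borel" "\<And>x. norm (f x) \<le> B" and ft: "torus_integrable f"
    and g: "torus_integrable g" and s: "(\<lambda>n. (norm (fcoef g n))\<^sup>2) summable_on UNIV"
  obtains F :: "nat \<Rightarrow> int set" where "\<And>j. finite (F j)"
    "\<And>n. (\<lambda>j. \<Sum>k\<in>F j. fcoef g k * fcoef f (n - k)) \<longlonglongrightarrow> fcoef (\<lambda>x. f x * g x) n"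
proof -
  obtain F where F: "\<And>j. finite (F j)"
    "(\<lambda>j. TINT x. norm (g x - trig_poly (F j) (fcoef g) x)) \<longlonglongrightarrow> 0"
    using L1_approx_partial_sums[OF g s] by blast
  have "(\<lambda>j. \<Sum>k\<in>F j. fcoef g k * fcoef f (n - k)) \<longlonglongrightarrow> fcoef (\<lambda>x. f x * g x) n" for n
  proof -
    have "(\<lambda>j. TINT x. (tchar (- n) x * f x) * trig_poly (F j) (fcoef g) x)
      \<longlonglongrightarrow> (TINT x. (tchar (- n) x * f x) * g x)"
      using f torus_integrableD(3)[OF g] torus_integrable_trig_poly
      by (intro integral_mult_L1_tendsto[of _ B] F) (auto simp: norm_mult intro: torus_integrableD(3))
    then have "(\<lambda>j. fcoef (\<lambda>x. f x * trig_poly (F j) (fcoef g) x) n) \<longlonglongrightarrow> fcoef (\<lambda>x. f x * g x) n"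
      unfolding fcoef_tchar by (intro tendsto_intros) (auto simp: mult.assoc)
    moreover have "fcoef (\<lambda>x. f x * trig_poly (F j) (fcoef g) x) n = (\<Sum>k\<in>F j. fcoef g k * fcoef f (n - k))" for j
      using fcoef_mult_trig_poly[OF F(1) ft, of j "fcoef g" n] by (simp add: mult.commute)
    ultimately show ?thesis by simp
  qed
  with F(1) show ?thesis by (rule that)
qed

section \<open>Lower bound\<close>

text \<open>The n-th coefficient of the increment by h carries the factor |exp(inh) - 1|^2 = 2 - 2
  cos(nh). A single h may be resonant with n, but the integral over h in [0, \<delta>] is at least
  2\<delta> - 2/|n|, hence at least \<delta> when |n|\<delta> is at least 2.\<close>

lemma high_frequency_le:
  assumes f: "torus_integrable f" "\<And>x. norm (f x) = 1" and \<delta>: "0 < \<delta>"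
    and b: "\<And>h. 0 < h \<Longrightarrow> h \<le> \<delta> \<Longrightarrow> (TINT x. norm (f (x + h) - f x)) \<le> b"
    and F: "finite F" "\<And>n. n \<in> F \<Longrightarrow> 2 \<le> \<bar>of_int n\<bar> * \<delta>"
  shows "(\<Sum>n\<in>F. (norm (fcoef f n))\<^sup>2) \<le> b / pi"
proof -
  let ?c = "\<lambda>n. (norm (fcoef f n))\<^sup>2"
  let ?J = "\<lambda>n. (2 * \<delta> - 2 * sin (of_int n * \<delta>) / of_int n) - (2 * 0 - 2 * sin (of_int n * 0) / of_int n)"
  have b0: "0 \<le> b"
    using order_trans[OF _ b[of \<delta>]] \<delta> by simp
  have pt: "(\<Sum>n\<in>F. (2 - 2 * cos (of_int n * h)) * ?c n) \<le> b / pi" if h: "0 \<le> h" "h \<le> \<delta>" for h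
  proof (cases "h = 0")
    case True
    then show ?thesis using b0 by simp
  next
    case False
    have ti: "torus_integrable (\<lambda>x. f (x + h) - f x)"
      by (intro torus_integrable_diff torus_integrable_translate f)
    have le2: "norm (f (x + h) - f x) \<le> 2" for x
      using norm_triangle_ineq4[of "f (x + h)" "f x"] by (simp add: f(2))
    have "(norm (fcoef (\<lambda>x. f (x + h) - f x) n))\<^sup>2 = (2 - 2 * cos (of_int n * h)) * ?c n" for n
    proof -
      have "fcoef (\<lambda>x. f (x + h) - f x) n = (tchar n h - 1) * fcoef f n"
        using f(1) by (simp add: fcoef_diff torus_integrable_translate fcoef_translate algebra_simps)
      moreover have "(norm (tchar n h - 1))\<^sup>2 = 2 - 2 * cos (of_int n * h)"
        unfolding cmod_power2 using sin_cos_squared_add[of "of_int n * h"]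
        by (simp add: tchar_def power2_eq_square algebra_simps)
      ultimately show ?thesis by (simp add: norm_mult power_mult_distrib)
    qed
    then have "(\<Sum>n\<in>F. (2 - 2 * cos (of_int n * h)) * ?c n)
        \<le> (TINT x. (norm (f (x + h) - f x))\<^sup>2) / (2 * pi)"
      using bessel[OF ti le2 F(1)] by simp
    \<comment> \<open>Since |f| = 1, increments are at most 2, and one factor of the square is
      traded for this constant: L^1 control yields L^2 control.\<close>
    also have "\<dots> \<le> (TINT x. 2 * norm (f (x + h) - f x)) / (2 * pi)"
    proof (intro divide_right_mono integral_mono)
      show "integrable torus_measure (\<lambda>x. (norm (f (x + h) - f x))\<^sup>2)"
        using torus_integrableD(1)[OF ti] power_mono[OF le2 norm_ge_zero, of _ 2]
        by (intro torus.integrable_const_bound[of _ "2\<^sup>2"] AE_I2 borel_measurable_torus) auto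
      show "(norm (f (x + h) - f x))\<^sup>2 \<le> 2 * norm (f (x + h) - f x)" for x
        using le2[of x] by (simp add: power2_eq_square mult_right_mono)
    qed (use torus_integrableD(3)[OF ti] in auto)
    also have "\<dots> \<le> 2 * b / (2 * pi)"
      using b[of h] h False by (intro divide_right_mono) auto
    finally show ?thesis by simp
  qed
  have F0: "n \<noteq> 0" if "n \<in> F" for n using F(2)[OF that] by auto
  have "((\<lambda>h. \<Sum>n\<in>F. (2 - 2 * cos (of_int n * h)) * ?c n) has_integral
      (\<Sum>n\<in>F. ?J n * ?c n)) {0..\<delta>}"
  proof (intro has_integral_sum F(1) has_integral_mult_left fundamental_theorem_of_calculus)
    fix n h assume n: "n \<in> F"
    show "((\<lambda>h. 2 * h - 2 * sin (of_int n * h) / of_int n) has_vector_derivative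
        2 - 2 * cos (of_int n * h)) (at h within {0..\<delta>})"
      unfolding has_real_derivative_iff_has_vector_derivative[symmetric]
      using F0[OF n] by (auto intro!: derivative_eq_intros)
  qed (use \<delta> in auto)
  moreover have "((\<lambda>h. b / pi) has_integral (\<delta> * (b / pi))) {0..\<delta>}"
    using has_integral_const_real[of "b / pi" 0 \<delta>] \<delta> by simp
  ultimately have "(\<Sum>n\<in>F. ?J n * ?c n)
      \<le> \<delta> * (b / pi)"
    by (rule has_integral_le) (use pt in auto)
  moreover have "(\<Sum>n\<in>F. \<delta> * ?c n) \<le>
      (\<Sum>n\<in>F. ?J n * ?c n)"
  proof (intro sum_mono mult_right_mono)
    fix n assume n: "n \<in> F"
    have "sin (of_int n * \<delta>) / of_int n \<le> 1 / \<bar>of_int n\<bar>"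
    proof -
      have "sin (of_int n * \<delta>) / of_int n \<le> \<bar>sin (of_int n * \<delta>) / of_int n\<bar>" by (rule abs_ge_self)
      also have "\<dots> \<le> 1 / \<bar>of_int n\<bar>" by (simp add: abs_divide divide_right_mono)
      finally show ?thesis .
    qed
    also have "\<dots> \<le> \<delta> / 2"
      using F(2)[OF n] F0[OF n] by (simp add: field_simps)
    finally have "2 * (sin (of_int n * \<delta>) / of_int n) \<le> \<delta>"
      by (simp add: mult.commute)
    then show "\<delta> \<le> ?J n"
      by simp
  qed simp
  ultimately have "\<delta> * (\<Sum>n\<in>F. ?c n) \<le> \<delta> * (b / pi)"
    by (simp add: sum_distrib_left)
  then show ?thesis by (rule mult_left_le_imp_le[OF _ \<delta>])
qed

lemma sobolev_enorm_class:
  "torus_integrable g \<Longrightarrow> sobolev_enorm s (torus_class g) =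
     (if (\<lambda>n. (1 + (of_int n)\<^sup>2) powr s * (norm (fcoef g n))\<^sup>2) summable_on UNIV
      then ennreal (sqrt (\<Sum>\<^sub>\<infinity>n. (1 + (of_int n)\<^sup>2) powr s * (norm (fcoef g n))\<^sup>2)) else \<infinity>)"
  by (simp add: sobolev_enorm_def Let_def fourier_coeff_torus_class)

text \<open>The total mass is 1 by Parseval and the frequencies with |n|\<delta> at least 2 carry at
  most 1/pi. So at least half of the mass sits where the weight is at least \<delta>/3, whence
  \<delta>/6.\<close>

lemma sobolev_neg_half_ge:
  assumes f: "torus_integrable f" "\<And>x. norm (f x) = 1" and \<delta>: "0 < \<delta>" "\<delta> \<le> 1"
    and b: "\<And>h. 0 < h \<Longrightarrow> h \<le> \<delta> \<Longrightarrow> (TINT x. norm (f (x + h) - f x)) \<le> 1"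
  shows "ennreal (sqrt (\<delta> / 6)) \<le> sobolev_enorm (- 1 / 2) (torus_class f)"
proof -
  let ?c = "\<lambda>n. (norm (fcoef f n))\<^sup>2"
  let ?w = "\<lambda>n::int. (1 + (of_int n)\<^sup>2) powr (- 1 / 2) * ?c n"
  define L where "L = {n::int. \<bar>of_int n\<bar> * \<delta> < 2}"
  have "L \<subseteq> {- \<lceil>2 / \<delta>\<rceil>..\<lceil>2 / \<delta>\<rceil>}"
  proof
    fix n assume "n \<in> L"
    then have "real_of_int \<bar>n\<bar> \<le> 2 / \<delta>" using \<delta> by (simp add: L_def field_simps)
    then have "\<bar>n\<bar> \<le> \<lceil>2 / \<delta>\<rceil>" by linarith
    then show "n \<in> {- \<lceil>2 / \<delta>\<rceil>..\<lceil>2 / \<delta>\<rceil>}" by auto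
  qed
  then have finL: "finite L" by (rule finite_subset) simp
  have hs: "(?c has_sum 1) UNIV"
    using parseval[OF f(1), of 1] by (simp add: f(2))
  have "infsum ?c UNIV \<le> sum ?c L + 1 / pi"
  proof (rule infsum_le_finite_sums)
    show "?c summable_on UNIV" using hs by (rule has_sum_imp_summable)
    fix F :: "int set" assume F: "finite F"
    have "sum ?c F \<le> sum ?c (L \<union> (F - L))" using F finL by (intro sum_mono2) auto
    also have "\<dots> = sum ?c L + sum ?c (F - L)" using F finL by (intro sum.union_disjoint) auto
    also have "sum ?c (F - L) \<le> 1 / pi"
      by (rule high_frequency_le[OF f \<delta>(1) b]) (use F in \<open>auto simp: L_def\<close>)
    finally show "sum ?c F \<le> sum ?c L + 1 / pi" by simp
  qed
  then have "1 \<le> sum ?c L + 1 / pi" using infsumI[OF hs] by simp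
  moreover have "1 / pi \<le> 1 / 2" using pi_ge_two by (intro divide_left_mono) auto
  ultimately have low: "1 / 2 \<le> sum ?c L" by linarith
  show ?thesis
  proof (cases "?w summable_on UNIV")
    case True
    have "\<delta> / 3 * (1 / 2) \<le> \<delta> / 3 * sum ?c L"
      using low \<delta> by (intro mult_left_mono) auto
    also have "\<dots> \<le> sum ?w L"
      unfolding sum_distrib_left
    proof (intro sum_mono mult_right_mono)
      fix n assume n: "n \<in> L"
      have "\<bar>real_of_int n\<bar> \<le> 2 / \<delta>" using n \<delta> by (simp add: L_def field_simps)
      then have "(real_of_int n)\<^sup>2 \<le> (2 / \<delta>)\<^sup>2" by (rule abs_le_square_iff[THEN iffD1, OF order_trans]) (use \<delta> in auto)
      moreover have "1 \<le> (1 / \<delta>)\<^sup>2" using \<delta> by (simp add: field_simps power_le_one)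
      \<comment> \<open>The sum is at most 5/\<delta>^2; it is rounded up to a square to make the
        root explicit.\<close>
      ultimately have "1 + (real_of_int n)\<^sup>2 \<le> (3 / \<delta>)\<^sup>2" by (simp add: power_divide)
      then have "((3 / \<delta>)\<^sup>2) powr (- 1 / 2) \<le> (1 + (real_of_int n)\<^sup>2) powr (- 1 / 2)"
        by (intro powr_mono2') (auto intro: add_pos_nonneg)
      moreover have "((3 / \<delta>)\<^sup>2) powr (- 1 / 2) = \<delta> / 3"
        using \<delta> by (simp add: powr_minus powr_half_sqrt real_sqrt_divide inverse_eq_divide real_sqrt_mult flip: minus_divide_left)
      ultimately show "\<delta> / 3 \<le> (1 + (real_of_int n)\<^sup>2) powr (- 1 / 2)" by simp
    qed simp
    also have "\<dots> \<le> infsum ?w UNIV"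
      by (rule finite_sum_le_infsum[OF True finL]) auto
    finally show ?thesis
      using True f(1) by (simp add: sobolev_enorm_class ennreal_leI)
  qed (use f(1) in \<open>simp add: sobolev_enorm_class\<close>)
qed

lemma torus_dist_zero:
  assumes "0 \<le> h" "h \<le> pi"
  shows "torus_dist h 0 = h"
proof (rule antisym)
  have bdd: "bdd_below (range (\<lambda>k::int. \<bar>h - 0 - 2 * pi * of_int k\<bar>))"
    by (rule bdd_belowI[of _ 0]) auto
  show "torus_dist h 0 \<le> h"
    unfolding torus_dist_def using cINF_lower[OF bdd, of 0] assms by simp
  show "h \<le> torus_dist h 0"
    unfolding torus_dist_def
  proof (rule cINF_greatest)
    fix k :: int
    consider "k = 0" | "k \<ge> 1" | "k \<le> -1" by linarith
    then show "h \<le> \<bar>h - 0 - 2 * pi * of_int k\<bar>"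
    proof cases
      case 2
      then have "2 * pi * 1 \<le> 2 * pi * of_int k" by (intro mult_left_mono) auto
      then show ?thesis using assms by linarith
    next
      case 3
      then have "2 * pi * of_int k \<le> 2 * pi * of_int (- 1)" by (intro mult_left_mono) auto
      then show ?thesis using assms pi_gt_zero by simp
    qed (use assms in simp)
  qed simp
qed

lemma besov_modulus:
  assumes "torus_class u \<in> besov \<alpha>" "torus_integrable u"
  obtains A where "1 \<le> A"
    "\<And>h. 0 < h \<Longrightarrow> h \<le> pi \<Longrightarrow> (TINT x. \<bar>u (x + h) - u x\<bar>) \<le> A * h powr \<alpha>"
proof -
  define S where "S = (SUP (x, y) \<in> {(x, y). torus_dist x y \<noteq> 0}.
        ennreal (norm (translate x (torus_class u) - translate y (torus_class u)) / torus_dist x y powr \<alpha>))"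
  have fin: "S < \<infinity>"
    using assms(1) by (auto simp: besov_def besov_enorm_def S_def)
  have main: "(TINT x. \<bar>u (x + h) - u x\<bar>) \<le> max 1 (enn2real S) * h powr \<alpha>"
    if h: "0 < h" "h \<le> pi" for h
  proof -
    have d: "torus_dist h 0 = h" using h by (intro torus_dist_zero) auto
    have tr: "translate h (torus_class u) - translate 0 (torus_class u) = torus_class (\<lambda>x. u (x + h) - u x)"
      using assms(2) by (simp add: translate_torus_class diff_torus_class torus_integrable_translate)
    have n: "norm (torus_class (\<lambda>x. u (x + h) - u x)) = (TINT x. \<bar>u (x + h) - u x\<bar>)"
      using assms(2) by (simp add: norm_torus_class torus_integrable_diff torus_integrable_translate)
    have "ennreal ((TINT x. \<bar>u (x + h) - u x\<bar>) / h powr \<alpha>) \<le> S"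
      unfolding S_def by (rule SUP_upper2[of "(h, 0)"]) (use h in \<open>auto simp: d tr n\<close>)
    also have "S = ennreal (enn2real S)" using fin by simp
    finally have "(TINT x. \<bar>u (x + h) - u x\<bar>) / h powr \<alpha> \<le> enn2real S"
      by (simp add: ennreal_le_iff)
    then have "(TINT x. \<bar>u (x + h) - u x\<bar>) \<le> enn2real S * h powr \<alpha>"
      using h by (simp add: field_simps)
    also have "\<dots> \<le> max 1 (enn2real S) * h powr \<alpha>" by (intro mult_right_mono) auto
    finally show ?thesis .
  qed
  \<comment> \<open>Taking the maximum with 1 ensures A t \<ge> 1 for t \<ge> 1, hence a step size
    of at most 1 in the rate estimate.\<close>
  show ?thesis by (rule that[of "max 1 (enn2real S)"]) (use main in auto)
qed

lemma sobolev_enorm_one: "sobolev_enorm s (torus_class (\<lambda>_. 1)) = 1"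
proof -
  have one: "(\<lambda>_. 1) = tchar 0" by (simp add: fun_eq_iff)
  have "((\<lambda>n::int. (1 + (of_int n)\<^sup>2) powr s * (norm (fcoef (\<lambda>_. 1) n))\<^sup>2) has_sum
      (\<Sum>n\<in>{0::int}. (1 + (of_int n)\<^sup>2) powr s * (norm (fcoef (\<lambda>_. 1) n))\<^sup>2)) UNIV"
    by (rule has_sum_finite_neutralI[of "{0}"]) (auto simp: one fcoef_tchar_self)
  then have hs: "((\<lambda>n::int. (1 + (of_int n)\<^sup>2) powr s * (norm (fcoef (\<lambda>_. 1) n))\<^sup>2) has_sum 1) UNIV"
    by (simp add: one fcoef_tchar_self)
  show ?thesis
    using has_sum_imp_summable[OF hs] infsumI[OF hs] torus_integrable_tchar[of 0]
    by (simp add: sobolev_enorm_class one)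
qed

lemma norm_cis_diff_le: "norm (cis a - cis b) \<le> \<bar>a - b\<bar>"
proof (rule power2_le_imp_le)
  have "(norm (cis a - cis b))\<^sup>2 = 2 - 2 * cos (a - b)"
    unfolding cmod_power2 using sin_cos_squared_add[of a] sin_cos_squared_add[of b]
    by (simp add: cos_diff power2_eq_square algebra_simps)
  also have "\<dots> = (2 * \<bar>sin ((a - b) / 2)\<bar>)\<^sup>2"
  proof -
    define y where "y = (a - b) / 2"
    have "a - b = 2 * y" by (simp add: y_def)
    then show ?thesis
      unfolding y_def[symmetric] by (simp add: cos_double_sin power_mult_distrib)
  qed
  also have "\<dots> \<le> (2 * \<bar>(a - b) / 2\<bar>)\<^sup>2"
    by (intro power_mono mult_left_mono abs_sin_x_le_abs_x) auto
  finally show "(norm (cis a - cis b))\<^sup>2 \<le> \<bar>a - b\<bar>\<^sup>2" by simp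
qed simp

lemma norm_phase_diff_le: "norm (phase \<tau> u x - phase \<sigma> v y) \<le> \<bar>\<tau> * u x - \<sigma> * v y\<bar>"
  using norm_cis_diff_le[of "- (\<tau> * u x)" "- (\<sigma> * v y)"] by (simp add: phase_def abs_minus_commute)

theorem mixing_rate_le:
  fixes \<alpha> :: real
  assumes \<alpha>: "0 < \<alpha>" and u: "u \<in> besov \<alpha>" and mix: "mixing_on_scale (1 / 2) u r"
  shows "\<exists>C>0. \<forall>t\<ge>1. r t \<le> C * t powr (1 / (2 * \<alpha>))"
proof -
  obtain u0 where u0: "torus_integrable u0" "u = torus_class u0" by (rule torus_class_cases)
  obtain A where A: "1 \<le> A"
    "\<And>h. 0 < h \<Longrightarrow> h \<le> pi \<Longrightarrow> (TINT x. \<bar>u0 (x + h) - u0 x\<bar>) \<le> A * h powr \<alpha>"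
    using besov_modulus u u0 by metis
  obtain C where C: "C > 0" "\<And>k::int. \<And>t. t \<ge> 1 \<Longrightarrow> k \<noteq> 0 \<Longrightarrow>
      phase_mult_opnorm (1 / 2) (t * of_int k) u \<le> ennreal C / ennreal (r (t * \<bar>of_int k\<bar>))"
    using mix unfolding mixing_on_scale_def by blast
  have main: "r t \<le> C * sqrt 6 * A powr (1 / (2 * \<alpha>)) * t powr (1 / (2 * \<alpha>))" if t: "t \<ge> 1" for t
  proof (cases "r t > 0")
    case True
    \<comment> \<open>This is the h that solves \<open>t * (A * h powr \<alpha>) = 1\<close>, the
      scale at which exp(-itu) starts to oscillate.\<close>
    define \<delta> where "\<delta> = (A * t) powr (- 1 / \<alpha>)"
    have At: "1 \<le> A * t" using mult_mono[of 1 A 1 t] A(1) t by simp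
    have \<delta>: "0 < \<delta>" "\<delta> \<le> 1"
      using At \<alpha> powr_mono[of "- 1 / \<alpha>" 0 "A * t"] by (auto simp: \<delta>_def split: if_splits)
    have \<delta>\<alpha>: "\<delta> powr \<alpha> = 1 / (A * t)"
      unfolding \<delta>_def powr_powr using At \<alpha> by (simp add: powr_minus_divide)
    define f where "f = phase t u0"
    have fi: "torus_integrable f" unfolding f_def by (rule torus_integrable_phase[OF u0(1)])
    have osc: "(TINT x. norm (f (x + h) - f x)) \<le> 1" if h: "0 < h" "h \<le> \<delta>" for h
    proof -
      have hpi: "h \<le> pi" using h \<delta> pi_ge_two by linarith
      have ti: "torus_integrable (\<lambda>x. u0 (x + h) - u0 x)" "torus_integrable (\<lambda>x. f (x + h) - f x)"
        by (intro torus_integrable_diff torus_integrable_translate u0 fi)+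
      have "(TINT x. norm (f (x + h) - f x)) \<le> (TINT x. t * \<bar>u0 (x + h) - u0 x\<bar>)"
      proof (rule integral_mono)
        show "norm (f (x + h) - f x) \<le> t * \<bar>u0 (x + h) - u0 x\<bar>" for x
          using norm_phase_diff_le[of t u0 "x + h" t u0 x] t
          by (simp add: f_def abs_mult flip: right_diff_distrib)
      qed (use torus_integrableD(3)[OF ti(1)] torus_integrableD(3)[OF ti(2)] in auto)
      also have "\<dots> \<le> t * (A * h powr \<alpha>)"
        using A(2)[OF h(1) hpi] t by (simp add: mult_left_mono)
      also have "\<dots> \<le> t * (A * \<delta> powr \<alpha>)"
        using h A(1) t \<alpha> by (intro mult_left_mono powr_mono2) auto
      also have "\<dots> = 1" using A(1) t by (simp add: \<delta>\<alpha>)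
      finally show ?thesis .
    qed
    have one: "torus_integrable (\<lambda>_. 1 :: complex)"
      by (rule torus_integrable_bounded[of _ 1]) auto
    have "ennreal (sqrt (\<delta> / 6)) \<le> sobolev_enorm (- 1 / 2) (torus_class f)"
      by (rule sobolev_neg_half_ge[OF fi _ \<delta> osc]) (auto simp: f_def)
    also have "\<dots> = sobolev_enorm (- (1 / 2)) (phase_mult t u (torus_class (\<lambda>_. 1)))"
      using one by (simp add: u0 phase_mult_torus_class f_def)
    also have "\<dots> \<le> phase_mult_opnorm (1 / 2) t u"
      unfolding phase_mult_opnorm_def by (rule SUP_upper) (simp add: sobolev_enorm_one)
    also have "\<dots> \<le> ennreal C / ennreal (r t)"
      using C(2)[of t 1] t by simp
    also have "\<dots> = ennreal (C / r t)"
      using True C(1) by (simp add: divide_ennreal)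
    finally have "sqrt (\<delta> / 6) \<le> C / r t"
      using True C(1) by (simp add: ennreal_le_iff)
    then have "r t \<le> C / sqrt (\<delta> / 6)"
      using True \<delta> by (simp add: field_simps)
    also have "\<dots> = C * sqrt 6 * \<delta> powr (- 1 / 2)"
      using \<delta> by (simp add: real_sqrt_divide powr_minus powr_half_sqrt field_simps flip: minus_divide_left)
    also have "\<delta> powr (- 1 / 2) = A powr (1 / (2 * \<alpha>)) * t powr (1 / (2 * \<alpha>))"
      using A(1) t \<alpha> by (simp add: \<delta>_def powr_powr powr_mult mult.commute)
    finally show ?thesis by (simp add: mult.assoc)
  next
    case False
    have "0 \<le> C * sqrt 6 * A powr (1 / (2 * \<alpha>)) * t powr (1 / (2 * \<alpha>))" using C(1) by simp
    with False show ?thesis by linarith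
  qed
  show ?thesis
    by (rule exI[of _ "C * sqrt 6 * A powr (1 / (2 * \<alpha>))"]) (use main C(1) A(1) in auto)
qed

section \<open>Multiplication operators\<close>

text \<open>The square of the Japanese bracket.\<close>

abbreviation jb :: "int \<Rightarrow> real" where
  "jb n \<equiv> 1 + (of_int n)\<^sup>2"

lemma jb_pos: "0 < jb n" by (simp add: add_pos_nonneg)

lemma jb_diff_le: "jb (n - k) \<le> 4 * max (jb n) (jb k)"
proof -
  have "jb (n - k) \<le> 2 * jb n + 2 * jb k"
    using zero_le_power2[of "of_int n + of_int k :: real"] by (simp add: power2_eq_square algebra_simps)
  then show ?thesis by (auto simp: max_def)
qed

lemma sum_jb_powr_bounded:
  assumes p: "1 / 2 < p"
  obtains Z where "0 < Z" "\<And>G. finite G \<Longrightarrow> (\<Sum>n\<in>G. jb n powr (- p)) \<le> Z"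
proof -
  define g where "g m = (1 + (real m)\<^sup>2) powr (- p)" for m
  have g0: "0 \<le> g m" for m by (simp add: g_def)
  have s: "summable g"
  proof (rule summable_comparison_test'[of "\<lambda>m. real m powr (- 2 * p)" 1])
    show "summable (\<lambda>m. real m powr (- 2 * p))"
      using p by (simp add: summable_real_powr_iff)
    fix m :: nat assume m: "1 \<le> m"
    have "g m \<le> ((real m)\<^sup>2) powr (- p)"
      unfolding g_def using p m by (intro powr_mono2') auto
    also have "((real m)\<^sup>2) powr (- p) = real m powr (- 2 * p)"
      using powr_powr[of "real m" 2 "- p"] m by simp
    finally show "norm (g m) \<le> real m powr (- 2 * p)"
      using g0[of m] by simp
  qed
  have half: "(\<Sum>n\<in>G. jb n powr (- p)) \<le> suminf g" if G: "finite G" "inj_on (\<lambda>n. nat \<bar>n\<bar>) G" for G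
  proof -
    have "(\<Sum>n\<in>G. jb n powr (- p)) = (\<Sum>n\<in>G. g (nat \<bar>n\<bar>))"
      by (intro sum.cong) (auto simp: g_def)
    also have "\<dots> = sum g ((\<lambda>n. nat \<bar>n\<bar>) ` G)"
      using sum.reindex[OF G(2), of g] by simp
    also have "\<dots> \<le> suminf g"
      by (rule sum_le_suminf[OF s]) (use G g0 in auto)
    finally show ?thesis .
  qed
  show ?thesis
  proof (rule that[of "2 * suminf g + 1"])
    show "0 < 2 * suminf g + 1" using suminf_nonneg[OF s g0] by simp
    fix G :: "int set" assume G: "finite G"
    have "(\<Sum>n\<in>G. jb n powr (- p)) = (\<Sum>n\<in>(G \<inter> {0..}) \<union> (G \<inter> {..<0}). jb n powr (- p))"
      by (intro sum.cong) auto
    also have "\<dots> = (\<Sum>n\<in>G \<inter> {0..}. jb n powr (- p)) + (\<Sum>n\<in>G \<inter> {..<0}. jb n powr (- p))"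
      using G by (intro sum.union_disjoint) auto
    also have "\<dots> \<le> suminf g + suminf g"
      using G by (intro add_mono half) (auto simp: inj_on_def)
    finally show "(\<Sum>n\<in>G. jb n powr (- p)) \<le> 2 * suminf g + 1" by simp
  qed
qed

text \<open>By symmetry let \<open>jb k \<le> jb n\<close>. Then \<open>jb (n - k)\<close> is at
  most four times \<open>jb n\<close>, and the combined exponent \<sigma>/2 - 1/4 of
  \<open>jb n\<close> is not positive, so \<open>jb n\<close> may be replaced by
  \<open>jb k\<close>. The constant 2 bounds \<open>4 powr (\<sigma> / 2)\<close>.\<close>

lemma multiplier_weight_le:
  assumes \<sigma>: "0 \<le> \<sigma>" "\<sigma> \<le> 1 / 2"
  shows "jb n powr (- 1 / 4) * jb (n - k) powr (\<sigma> / 2) * jb k powr (- 1 / 4)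
    \<le> 2 * (jb n powr (- (1 - \<sigma>) / 2) + jb k powr (- (1 - \<sigma>) / 2))"
proof -
  have main: "jb n powr (- 1 / 4) * jb (n - k) powr (\<sigma> / 2) * jb k powr (- 1 / 4)
      \<le> 2 * jb k powr (- (1 - \<sigma>) / 2)" if le: "jb k \<le> jb n" for n k
  proof -
    have "jb (n - k) powr (\<sigma> / 2) \<le> (4 * jb n) powr (\<sigma> / 2)"
      using jb_diff_le[of n k] le \<sigma> by (intro powr_mono2) auto
    also have "\<dots> = 4 powr (\<sigma> / 2) * jb n powr (\<sigma> / 2)"
      by (rule powr_mult)
    also have "4 powr (\<sigma> / 2) \<le> (4::real) powr (1 / 2)" using \<sigma> by (intro powr_mono) auto
    also have "(4::real) powr (1 / 2) = 2" by (simp add: powr_half_sqrt)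
    finally have 1: "jb (n - k) powr (\<sigma> / 2) \<le> 2 * jb n powr (\<sigma> / 2)"
      by (simp add: mult_right_mono)
    have "jb n powr (- 1 / 4) * jb (n - k) powr (\<sigma> / 2) * jb k powr (- 1 / 4)
      \<le> jb n powr (- 1 / 4) * (2 * jb n powr (\<sigma> / 2)) * jb k powr (- 1 / 4)"
      by (intro mult_right_mono mult_left_mono 1) auto
    also have "\<dots> = 2 * jb n powr (- 1 / 4 + \<sigma> / 2) * jb k powr (- 1 / 4)"
      by (simp only: powr_add mult_ac)
    also have "\<dots> \<le> 2 * jb k powr (- 1 / 4 + \<sigma> / 2) * jb k powr (- 1 / 4)"
      using \<sigma> le jb_pos[of k] by (intro mult_right_mono mult_left_mono powr_mono2') auto
    also have "\<dots> = 2 * jb k powr (- (1 - \<sigma>) / 2)"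
    proof -
      have "- 1 / 4 + \<sigma> / 2 + - 1 / 4 = - (1 - \<sigma>) / 2" by (simp add: diff_divide_distrib)
      then show ?thesis by (simp only: mult.assoc powr_add[symmetric])
    qed
    finally show ?thesis .
  qed
  show ?thesis
  proof (cases "jb k \<le> jb n")
    case True
    have "0 \<le> 2 * jb n powr (- (1 - \<sigma>) / 2)" by simp
    with main[OF True] show ?thesis unfolding distrib_left by linarith
  next
    case False
    have "jb (n - k) = jb (k - n)" by (simp add: power2_commute)
    then have "jb n powr (- 1 / 4) * jb (n - k) powr (\<sigma> / 2) * jb k powr (- 1 / 4)
        = jb k powr (- 1 / 4) * jb (k - n) powr (\<sigma> / 2) * jb n powr (- 1 / 4)"
      by (simp add: mult_ac)
    moreover have "0 \<le> 2 * jb k powr (- (1 - \<sigma>) / 2)" by simp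
    ultimately show ?thesis using main[of n k] False unfolding distrib_left by linarith
  qed
qed

lemma sum_shift_le:
  fixes \<Phi> :: "int \<Rightarrow> real"
  assumes "\<And>G. finite G \<Longrightarrow> sum \<Phi> G \<le> B" "finite F"
  shows "(\<Sum>k\<in>F. \<Phi> (n - k)) \<le> B" "(\<Sum>n\<in>F. \<Phi> (n - k)) \<le> B"
proof -
  have "(\<Sum>k\<in>F. \<Phi> (n - k)) = sum \<Phi> ((\<lambda>k. n - k) ` F)"
    using sum.reindex[of "\<lambda>k. n - k" F \<Phi>] by (simp add: inj_on_def)
  then show "(\<Sum>k\<in>F. \<Phi> (n - k)) \<le> B" using assms by simp
  have "(\<Sum>n\<in>F. \<Phi> (n - k)) = sum \<Phi> ((\<lambda>n. n - k) ` F)"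
    using sum.reindex[of "\<lambda>n. n - k" F \<Phi>] by (simp add: inj_on_def)
  then show "(\<Sum>n\<in>F. \<Phi> (n - k)) \<le> B" using assms by simp
qed

text \<open>With the weights absorbed into A and \<Phi>, \<open>multiplier_weight_le\<close> leaves
  two terms. If the weight falls on n, Cauchy-Schwarz in k bounds X and the sum over n costs Z. If
  it falls on k, Cauchy-Schwarz costs Z at once, and the remaining double sum is evaluated over n
  before k. The constant is 8 + 8, from (2p + 2q)^2 \<le> 8p^2 + 8q^2.\<close>

lemma multiplier_estimate:
  fixes a b :: "int \<Rightarrow> real"
  assumes \<sigma>: "0 \<le> \<sigma>" "\<sigma> \<le> 1 / 2" and ab: "\<And>k. 0 \<le> a k" "\<And>k. 0 \<le> b k"
    and a: "\<And>G. finite G \<Longrightarrow> (\<Sum>k\<in>G. jb k powr (1 / 2) * (a k)\<^sup>2) \<le> 1"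
    and b: "\<And>G. finite G \<Longrightarrow> (\<Sum>k\<in>G. jb k powr (- \<sigma>) * (b k)\<^sup>2) \<le> B"
    and Z: "\<And>G. finite G \<Longrightarrow> (\<Sum>n\<in>G. jb n powr (- (1 - \<sigma>))) \<le> Z"
    and F: "finite F" "finite N"
  shows "(\<Sum>n\<in>N. jb n powr (- 1 / 2) * (\<Sum>k\<in>F. a k * b (n - k))\<^sup>2) \<le> 16 * Z * B"
proof -
  define A where "A k = jb k powr (1 / 4) * a k" for k
  define \<Phi> where "\<Phi> k = jb k powr (- \<sigma> / 2) * b k" for k
  have A0: "0 \<le> A k" and \<Phi>0: "0 \<le> \<Phi> k" for k by (simp_all add: A_def \<Phi>_def ab)
  have A2: "(A k)\<^sup>2 = jb k powr (1 / 2) * (a k)\<^sup>2" for k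
    by (simp add: A_def power_mult_distrib power2_eq_square[of "_ powr _"] powr_add[symmetric])
  have \<Phi>2: "(\<Phi> k)\<^sup>2 = jb k powr (- \<sigma>) * (b k)\<^sup>2" for k
    by (simp add: \<Phi>_def power_mult_distrib power2_eq_square[of "_ powr _"] powr_add[symmetric])
  have j2: "(jb k powr (- (1 - \<sigma>) / 2))\<^sup>2 = jb k powr (- (1 - \<sigma>))" for k
    by (simp add: power2_eq_square[of "_ powr _"] flip: powr_add)
  have sA: "(\<Sum>k\<in>G. (A k)\<^sup>2) \<le> 1" if "finite G" for G using a[OF that] by (simp add: A2)
  have s\<Phi>: "(\<Sum>k\<in>G. (\<Phi> k)\<^sup>2) \<le> B" if "finite G" for G using b[OF that] by (simp add: \<Phi>2)
  have B0: "0 \<le> B" and Z0: "0 \<le> Z" using b[of "{}"] Z[of "{}"] by auto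
  have pt: "jb n powr (- 1 / 2) * (\<Sum>k\<in>F. a k * b (n - k))\<^sup>2
      \<le> 8 * B * jb n powr (- (1 - \<sigma>)) + 8 * Z * (\<Sum>k\<in>F. (A k)\<^sup>2 * (\<Phi> (n - k))\<^sup>2)" for n
  proof -
    define S where "S = jb n powr (- 1 / 4) * (\<Sum>k\<in>F. a k * b (n - k))"
    define X where "X = (\<Sum>k\<in>F. A k * \<Phi> (n - k))"
    define Y where "Y = (\<Sum>k\<in>F. jb k powr (- (1 - \<sigma>) / 2) * (A k * \<Phi> (n - k)))"
    have "S = (\<Sum>k\<in>F. jb n powr (- 1 / 4) * jb (n - k) powr (\<sigma> / 2) * jb k powr (- 1 / 4) * (A k * \<Phi> (n - k)))"
      unfolding S_def sum_distrib_left
    proof (intro sum.cong refl)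
      fix k
      have "jb k powr (- 1 / 4) * jb k powr (1 / 4) = 1"
        "jb (n - k) powr (\<sigma> / 2) * jb (n - k) powr (- \<sigma> / 2) = 1"
        using jb_pos[of k] jb_pos[of "n - k"] by (simp_all add: powr_add[symmetric])
      then have "jb n powr (- 1 / 4) * (a k * b (n - k)) = jb n powr (- 1 / 4) *
        (jb (n - k) powr (\<sigma> / 2) * jb (n - k) powr (- \<sigma> / 2)) * (jb k powr (- 1 / 4) * jb k powr (1 / 4)) * (a k * b (n - k))"
        by simp
      then show "jb n powr (- 1 / 4) * (a k * b (n - k)) =
        jb n powr (- 1 / 4) * jb (n - k) powr (\<sigma> / 2) * jb k powr (- 1 / 4) * (A k * \<Phi> (n - k))"
        unfolding A_def \<Phi>_def by (simp only: mult_ac)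
    qed
    also have "\<dots> \<le> (\<Sum>k\<in>F. 2 * (jb n powr (- (1 - \<sigma>) / 2) + jb k powr (- (1 - \<sigma>) / 2)) * (A k * \<Phi> (n - k)))"
      by (intro sum_mono mult_right_mono multiplier_weight_le \<sigma>) (simp add: A0 \<Phi>0)
    also have "\<dots> = 2 * (jb n powr (- (1 - \<sigma>) / 2) * X) + 2 * Y"
      unfolding X_def Y_def sum_distrib_left sum.distrib[symmetric]
      by (intro sum.cong refl) (simp add: algebra_simps)
    finally have SXY: "S \<le> 2 * (jb n powr (- (1 - \<sigma>) / 2) * X) + 2 * Y" .
    have S0: "0 \<le> S" by (simp add: S_def sum_nonneg ab)
    have "X\<^sup>2 \<le> (\<Sum>k\<in>F. (A k)\<^sup>2) * (\<Sum>k\<in>F. (\<Phi> (n - k))\<^sup>2)"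
      unfolding X_def by (rule Cauchy_Schwarz_ineq_sum)
    also have "\<dots> \<le> 1 * B"
      using sA[OF F(1)] sum_shift_le(1)[OF s\<Phi> F(1)] by (intro mult_mono) (auto intro: sum_nonneg)
    finally have X2: "X\<^sup>2 \<le> B" by simp
    have "Y\<^sup>2 \<le> (\<Sum>k\<in>F. (jb k powr (- (1 - \<sigma>) / 2))\<^sup>2) * (\<Sum>k\<in>F. (A k * \<Phi> (n - k))\<^sup>2)"
      unfolding Y_def by (rule Cauchy_Schwarz_ineq_sum)
    also have "\<dots> \<le> Z * (\<Sum>k\<in>F. (A k * \<Phi> (n - k))\<^sup>2)"
      unfolding j2 by (intro mult_right_mono Z F sum_nonneg) auto
    finally have Y2: "Y\<^sup>2 \<le> Z * (\<Sum>k\<in>F. (A k)\<^sup>2 * (\<Phi> (n - k))\<^sup>2)" by (simp add: power_mult_distrib)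
    have "S\<^sup>2 \<le> (2 * (jb n powr (- (1 - \<sigma>) / 2) * X) + 2 * Y)\<^sup>2"
      by (rule power_mono[OF SXY S0])
    also have "\<dots> \<le> 8 * (jb n powr (- (1 - \<sigma>) / 2) * X)\<^sup>2 + 8 * Y\<^sup>2"
      using zero_le_power2[of "2 * (jb n powr (- (1 - \<sigma>) / 2) * X) - 2 * Y"]
      by (simp add: power2_eq_square algebra_simps)
    also have "(jb n powr (- (1 - \<sigma>) / 2) * X)\<^sup>2 = jb n powr (- (1 - \<sigma>)) * X\<^sup>2"
      by (simp only: power_mult_distrib j2)
    also have "8 * (jb n powr (- (1 - \<sigma>)) * X\<^sup>2) + 8 * Y\<^sup>2 \<le> 8 * (jb n powr (- (1 - \<sigma>)) * B)
        + 8 * (Z * (\<Sum>k\<in>F. (A k)\<^sup>2 * (\<Phi> (n - k))\<^sup>2))"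
      by (intro add_mono mult_left_mono X2 Y2) auto
    finally have "S\<^sup>2 \<le> 8 * B * jb n powr (- (1 - \<sigma>)) + 8 * Z * (\<Sum>k\<in>F. (A k)\<^sup>2 * (\<Phi> (n - k))\<^sup>2)"
      by (simp add: mult_ac)
    moreover have "S\<^sup>2 = jb n powr (- 1 / 2) * (\<Sum>k\<in>F. a k * b (n - k))\<^sup>2"
      by (simp add: S_def power_mult_distrib power2_eq_square[of "_ powr _"] powr_add[symmetric])
    ultimately show ?thesis by simp
  qed
  have "(\<Sum>n\<in>N. \<Sum>k\<in>F. (A k)\<^sup>2 * (\<Phi> (n - k))\<^sup>2) = (\<Sum>k\<in>F. (A k)\<^sup>2 * (\<Sum>n\<in>N. (\<Phi> (n - k))\<^sup>2))"
    by (subst sum.swap) (simp add: sum_distrib_left)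
  also have "\<dots> \<le> (\<Sum>k\<in>F. (A k)\<^sup>2 * B)"
    by (intro sum_mono mult_left_mono sum_shift_le(2)[OF s\<Phi>] F) auto
  also have "\<dots> \<le> 1 * B"
    unfolding sum_distrib_right[symmetric] by (intro mult_right_mono sA F B0)
  finally have double: "(\<Sum>n\<in>N. \<Sum>k\<in>F. (A k)\<^sup>2 * (\<Phi> (n - k))\<^sup>2) \<le> B" by simp
  have "(\<Sum>n\<in>N. jb n powr (- 1 / 2) * (\<Sum>k\<in>F. a k * b (n - k))\<^sup>2)
      \<le> (\<Sum>n\<in>N. 8 * B * jb n powr (- (1 - \<sigma>)) + 8 * Z * (\<Sum>k\<in>F. (A k)\<^sup>2 * (\<Phi> (n - k))\<^sup>2))"
    by (intro sum_mono pt)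
  also have "\<dots> = 8 * B * (\<Sum>n\<in>N. jb n powr (- (1 - \<sigma>)))
      + 8 * Z * (\<Sum>n\<in>N. \<Sum>k\<in>F. (A k)\<^sup>2 * (\<Phi> (n - k))\<^sup>2)"
    by (simp only: sum.distrib sum_distrib_left)
  also have "\<dots> \<le> 8 * B * Z + 8 * Z * B"
    using B0 Z0 by (intro add_mono mult_left_mono Z F double) auto
  finally show ?thesis by (simp add: mult_ac)
qed

lemma sobolev_sum_le_1:
  assumes g: "torus_integrable g" "sobolev_enorm s (torus_class g) \<le> 1" and F: "finite F"
  shows "(\<Sum>n\<in>F. jb n powr s * (norm (fcoef g n))\<^sup>2) \<le> 1"
proof -
  let ?w = "\<lambda>n. jb n powr s * (norm (fcoef g n))\<^sup>2"
  have sm: "?w summable_on UNIV"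
    using g by (simp add: sobolev_enorm_class top_unique split: if_splits)
  then have "ennreal (sqrt (infsum ?w UNIV)) \<le> 1"
    using g by (simp add: sobolev_enorm_class)
  then have "sqrt (infsum ?w UNIV) \<le> 1" by simp
  then have "infsum ?w UNIV \<le> 1" by simp
  moreover have "sum ?w F \<le> infsum ?w UNIV"
    by (rule finite_sum_le_infsum[OF sm F]) auto
  ultimately show ?thesis by simp
qed

text \<open>A function in the unit ball has square-summable coefficients, so those of the product
  are limits of finite convolutions; the bound of \<open>multiplier_estimate\<close> is uniform in
  the truncation and survives the limit.\<close>

theorem phase_mult_opnorm_le:
  assumes u: "torus_integrable u" and \<sigma>: "0 \<le> \<sigma>" "\<sigma> \<le> 1 / 2"
    and b: "\<And>G. finite G \<Longrightarrow> (\<Sum>k\<in>G. jb k powr (- \<sigma>) * (norm (fcoef (phase \<tau> u) k))\<^sup>2) \<le> B"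
    and Z: "\<And>G. finite G \<Longrightarrow> (\<Sum>n\<in>G. jb n powr (- (1 - \<sigma>))) \<le> Z"
  shows "phase_mult_opnorm (1 / 2) \<tau> (torus_class u) \<le> ennreal (sqrt (16 * Z * B))"
  unfolding phase_mult_opnorm_def
proof (rule SUP_least, clarify)
  fix g' :: "complex torus_L1" assume g': "sobolev_enorm (1 / 2) g' \<le> 1"
  obtain g where g: "torus_integrable g" "g' = torus_class g" by (rule torus_class_cases)
  have a: "(\<Sum>k\<in>G. jb k powr (1 / 2) * (norm (fcoef g k))\<^sup>2) \<le> 1" if "finite G" for G
    using sobolev_sum_le_1[OF g(1) _ that] g' g(2) by blast
  have "(\<Sum>k\<in>G. (norm (fcoef g k))\<^sup>2) \<le> 1" if "finite G" for G
  proof -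
    have "(\<Sum>k\<in>G. (norm (fcoef g k))\<^sup>2) \<le> (\<Sum>k\<in>G. jb k powr (1 / 2) * (norm (fcoef g k))\<^sup>2)"
      by (intro sum_mono) (simp add: mult_le_cancel_right1 ge_one_powr_ge_zero)
    also have "\<dots> \<le> 1" by (rule a[OF that])
    finally show ?thesis .
  qed
  then have sm: "(\<lambda>n. (norm (fcoef g n))\<^sup>2) summable_on UNIV"
    by (intro nonneg_bdd_above_summable_on bdd_aboveI[of _ 1]) auto
  let ?f = "phase \<tau> u"
  have fi: "torus_integrable ?f" by (rule torus_integrable_phase[OF u])
  obtain F where F: "\<And>j. finite (F j)"
    "\<And>n. (\<lambda>j. \<Sum>k\<in>F j. fcoef g k * fcoef ?f (n - k)) \<longlonglongrightarrow> fcoef (\<lambda>x. ?f x * g x) n"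
    using fcoef_mult_tendsto[OF torus_integrableD(1)[OF fi] _ fi g(1) sm, of 1] by auto
  let ?h = "\<lambda>x. ?f x * g x"
  have hi: "torus_integrable ?h"
    by (rule torus_integrable_bounded_mult[of _ 1])
       (use torus_integrableD(1,2)[OF fi] g(1) in auto)
  have bound: "(\<Sum>n\<in>N. jb n powr (- 1 / 2) * (norm (fcoef ?h n))\<^sup>2) \<le> 16 * Z * B" if N: "finite N" for N
  proof (rule LIMSEQ_le_const2)
    show "(\<lambda>j. \<Sum>n\<in>N. jb n powr (- 1 / 2) * (norm (\<Sum>k\<in>F j. fcoef g k * fcoef ?f (n - k)))\<^sup>2)
        \<longlonglongrightarrow> (\<Sum>n\<in>N. jb n powr (- 1 / 2) * (norm (fcoef ?h n))\<^sup>2)"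
      by (intro tendsto_intros F(2))
    have "(\<Sum>n\<in>N. jb n powr (- 1 / 2) * (norm (\<Sum>k\<in>F j. fcoef g k * fcoef ?f (n - k)))\<^sup>2)
       \<le> (\<Sum>n\<in>N. jb n powr (- 1 / 2) * (\<Sum>k\<in>F j. norm (fcoef g k) * norm (fcoef ?f (n - k)))\<^sup>2)" for j
      by (intro sum_mono mult_left_mono power_mono order_trans[OF norm_sum]) (auto simp: norm_mult)
    also have "\<dots> j \<le> 16 * Z * B" for j
      by (rule multiplier_estimate[OF \<sigma> _ _ a b Z F(1) N]) auto
    finally show "\<exists>M. \<forall>j\<ge>M. (\<Sum>n\<in>N. jb n powr (- 1 / 2) * (norm (\<Sum>k\<in>F j. fcoef g k * fcoef ?f (n - k)))\<^sup>2) \<le> 16 * Z * B"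
      by blast
  qed
  have sh: "(\<lambda>n. jb n powr (- 1 / 2) * (norm (fcoef ?h n))\<^sup>2) summable_on UNIV"
    by (intro nonneg_bdd_above_summable_on bdd_aboveI[of _ "16 * Z * B"]) (use bound in auto)
  have "infsum (\<lambda>n. jb n powr (- 1 / 2) * (norm (fcoef ?h n))\<^sup>2) UNIV \<le> 16 * Z * B"
    by (rule infsum_le_finite_sums[OF sh bound])
  then have "sobolev_enorm (- 1 / 2) (torus_class ?h) \<le> ennreal (sqrt (16 * Z * B))"
    using sh hi by (simp add: sobolev_enorm_class ennreal_leI)
  then show "sobolev_enorm (- (1 / 2)) (phase_mult \<tau> (torus_class u) g') \<le> ennreal (sqrt (16 * Z * B))"
    using u g by (simp add: phase_mult_torus_class)
qed

section \<open>From decay of Fourier coefficients to mixing\<close>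

text \<open>The growing factor in n makes the bound trivial once n exceeds a suitable power of
  \<tau>, so that only polynomially many frequencies need a probabilistic estimate for each
  \<tau>.\<close>

definition phase_decay :: "real \<Rightarrow> real \<Rightarrow> real \<Rightarrow> (real \<Rightarrow> real) \<Rightarrow> bool" where
  "phase_decay \<alpha> \<epsilon> M u \<longleftrightarrow> (\<forall>\<tau> n. 1 \<le> \<bar>\<tau>\<bar> \<longrightarrow>
     norm (fcoef (phase \<tau> u) n) \<le> M * \<bar>\<tau>\<bar> powr (\<epsilon> - 1 / (2 * \<alpha>)) * jb n powr \<epsilon>)"

text \<open>Frequencies with \<open>jb n\<close> up to \<Lambda> use the supremum bound, summed
  against a convergent weight; the others use that the squared coefficients sum to at most 1. The
  low exponent is -(1/2 - \<epsilon>) + 2\<epsilon> = -(1/2 + \<epsilon>) + 4\<epsilon>, and the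
  surplus 4\<epsilon> is evaluated at \<Lambda>.\<close>

lemma sobolev_sum_of_sup_bound:
  assumes f: "torus_integrable f" "\<And>x. norm (f x) = 1" and \<epsilon>: "0 < \<epsilon>" "\<epsilon> < 1 / 2"
    and b: "0 \<le> b" "\<And>n. norm (fcoef f n) \<le> b * jb n powr \<epsilon>"
    and Z: "\<And>G. finite G \<Longrightarrow> (\<Sum>n\<in>G. jb n powr (- (1 / 2 + \<epsilon>))) \<le> Z"
    and \<Lambda>: "0 < \<Lambda>" and G: "finite G"
  shows "(\<Sum>n\<in>G. jb n powr (- (1 / 2 - \<epsilon>)) * (norm (fcoef f n))\<^sup>2)
     \<le> \<Lambda> powr (- (1 / 2 - \<epsilon>)) * (Z * (b\<^sup>2 * \<Lambda> powr (1 / 2 + 3 * \<epsilon>)) + 1)"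
proof -
  let ?c = "\<lambda>n. (norm (fcoef f n))\<^sup>2"
  define s where "s = 1 / 2 - \<epsilon>"
  have s0: "0 < s" using \<epsilon> by (simp add: s_def)
  have pt: "jb n powr (- s) * ?c n \<le> \<Lambda> powr (- s) * (jb n powr (- (1 / 2 + \<epsilon>)) * (b\<^sup>2 * \<Lambda> powr (1 / 2 + 3 * \<epsilon>)))
      + \<Lambda> powr (- s) * ?c n" for n
  proof (cases "jb n \<le> \<Lambda>")
    case True
    have "?c n \<le> (b * jb n powr \<epsilon>)\<^sup>2" by (intro power_mono b) auto
    also have "\<dots> = b\<^sup>2 * jb n powr (2 * \<epsilon>)"
      by (simp add: power_mult_distrib power2_eq_square[of "_ powr _"] flip: powr_add)
    finally have "jb n powr (- s) * ?c n \<le> jb n powr (- s) * (b\<^sup>2 * jb n powr (2 * \<epsilon>))"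
      by (intro mult_left_mono) auto
    also have "\<dots> = b\<^sup>2 * (jb n powr (- (1 / 2 + \<epsilon>)) * jb n powr (4 * \<epsilon>))"
      by (simp add: s_def flip: powr_add)
    also have "\<dots> \<le> b\<^sup>2 * (jb n powr (- (1 / 2 + \<epsilon>)) * \<Lambda> powr (4 * \<epsilon>))"
      using True \<epsilon> jb_pos[of n] by (intro mult_left_mono powr_mono2) auto
    also have "\<Lambda> powr (4 * \<epsilon>) = \<Lambda> powr (- s) * \<Lambda> powr (1 / 2 + 3 * \<epsilon>)"
      by (simp add: s_def flip: powr_add)
    finally have "jb n powr (- s) * ?c n \<le> \<Lambda> powr (- s) * (jb n powr (- (1 / 2 + \<epsilon>)) * (b\<^sup>2 * \<Lambda> powr (1 / 2 + 3 * \<epsilon>)))"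
      by (simp only: mult_ac)
    moreover have "0 \<le> \<Lambda> powr (- s) * ?c n" by simp
    ultimately show ?thesis by linarith
  next
    case False
    have "jb n powr (- s) * ?c n \<le> \<Lambda> powr (- s) * ?c n"
      using False \<Lambda> s0 by (intro mult_right_mono powr_mono2') auto
    moreover have "0 \<le> \<Lambda> powr (- s) * (jb n powr (- (1 / 2 + \<epsilon>)) * (b\<^sup>2 * \<Lambda> powr (1 / 2 + 3 * \<epsilon>)))"
      by simp
    ultimately show ?thesis by linarith
  qed
  have "(\<Sum>n\<in>G. jb n powr (- s) * ?c n)
      \<le> (\<Sum>n\<in>G. \<Lambda> powr (- s) * (jb n powr (- (1 / 2 + \<epsilon>)) * (b\<^sup>2 * \<Lambda> powr (1 / 2 + 3 * \<epsilon>))) + \<Lambda> powr (- s) * ?c n)"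
    by (intro sum_mono pt)
  also have "\<dots> = \<Lambda> powr (- s) * ((\<Sum>n\<in>G. jb n powr (- (1 / 2 + \<epsilon>))) * (b\<^sup>2 * \<Lambda> powr (1 / 2 + 3 * \<epsilon>)) + sum ?c G)"
    by (simp only: sum.distrib sum_distrib_left sum_distrib_right distrib_left)
  also have "\<dots> \<le> \<Lambda> powr (- s) * (Z * (b\<^sup>2 * \<Lambda> powr (1 / 2 + 3 * \<epsilon>)) + 1)"
  proof (intro mult_left_mono add_mono mult_right_mono Z G)
    show "sum ?c G \<le> 1"
      using bessel[OF f(1) _ G, of 1] by (simp add: f(2))
  qed auto
  finally show ?thesis by (simp only: s_def)
qed

lemma phase_mult_opnorm_decay:
  assumes u: "torus_integrable u" and \<alpha>: "0 < \<alpha>" and \<epsilon>: "0 < \<epsilon>" "\<epsilon> < 1 / 2"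
    and M: "0 \<le> M" "phase_decay \<alpha> \<epsilon> M u"
    and Z: "\<And>G. finite G \<Longrightarrow> (\<Sum>n\<in>G. jb n powr (- (1 / 2 + \<epsilon>))) \<le> Z"
    and \<tau>: "1 \<le> \<bar>\<tau>\<bar>"
    and \<kappa>: "1 / \<beta> \<le> (1 / \<alpha> - 2 * \<epsilon>) / (1 / 2 + 3 * \<epsilon>) * (1 / 2 - \<epsilon>)"
  shows "phase_mult_opnorm (1 / 2) \<tau> (torus_class u)
    \<le> ennreal (sqrt (16 * Z * (Z * M\<^sup>2 + 1)) * \<bar>\<tau>\<bar> powr (- 1 / (2 * \<beta>)))"
proof -
  define T where "T = \<bar>\<tau>\<bar>"
  \<comment> \<open>The cutoff \<open>T powr \<kappa>\<close> balances the two parts: it makes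
    \<open>b\<^sup>2 * \<Lambda> powr (1 / 2 + 3 * \<epsilon>)\<close> equal to the constant
    \<open>M\<^sup>2\<close>.\<close>
  define \<kappa> where "\<kappa> = (1 / \<alpha> - 2 * \<epsilon>) / (1 / 2 + 3 * \<epsilon>)"
  define \<Lambda> where "\<Lambda> = T powr \<kappa>"
  define b where "b = M * T powr (\<epsilon> - 1 / (2 * \<alpha>))"
  have T: "1 \<le> T" using \<tau> by (simp add: T_def)
  have Z0: "0 \<le> Z" using Z[of "{}"] by simp
  have \<Lambda>: "0 < \<Lambda>" using T by (simp add: \<Lambda>_def)
  have b0: "0 \<le> b" using M by (simp add: b_def)
  have key: "b\<^sup>2 * \<Lambda> powr (1 / 2 + 3 * \<epsilon>) = M\<^sup>2"
  proof -
    have "\<kappa> * (1 / 2 + 3 * \<epsilon>) = 1 / \<alpha> - 2 * \<epsilon>" using \<epsilon> by (simp add: \<kappa>_def)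
    then have "\<Lambda> powr (1 / 2 + 3 * \<epsilon>) = T powr (1 / \<alpha> - 2 * \<epsilon>)"
      by (simp only: \<Lambda>_def powr_powr)
    moreover have "(T powr (\<epsilon> - 1 / (2 * \<alpha>)))\<^sup>2 = T powr (2 * \<epsilon> - 1 / \<alpha>)"
      by (simp add: power2_eq_square field_simps flip: powr_add)
    ultimately have "b\<^sup>2 * \<Lambda> powr (1 / 2 + 3 * \<epsilon>) = M\<^sup>2 * (T powr (2 * \<epsilon> - 1 / \<alpha>) * T powr (1 / \<alpha> - 2 * \<epsilon>))"
      by (simp add: b_def power_mult_distrib)
    also have "\<dots> = M\<^sup>2" using T by (simp flip: powr_add)
    finally show ?thesis .
  qed
  have "\<Lambda> powr (- (1 / 2 - \<epsilon>)) = T powr (- (\<kappa> * (1 / 2 - \<epsilon>)))"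
    by (simp only: \<Lambda>_def powr_powr mult_minus_right)
  also have "\<dots> \<le> T powr (- 1 / \<beta>)"
    using T \<kappa> by (intro powr_mono) (auto simp: \<kappa>_def)
  finally have \<Lambda>T: "\<Lambda> powr (- (1 / 2 - \<epsilon>)) \<le> T powr (- 1 / \<beta>)" .
  have "phase_mult_opnorm (1 / 2) \<tau> (torus_class u) \<le> ennreal (sqrt (16 * Z * (T powr (- 1 / \<beta>) * (Z * M\<^sup>2 + 1))))"
  proof (rule phase_mult_opnorm_le[OF u])
    show "0 \<le> 1 / 2 - \<epsilon>" "1 / 2 - \<epsilon> \<le> 1 / 2" using \<epsilon> by auto
    fix G :: "int set" assume G: "finite G"
    have "(\<Sum>n\<in>G. jb n powr (- (1 / 2 - \<epsilon>)) * (norm (fcoef (phase \<tau> u) n))\<^sup>2)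
       \<le> \<Lambda> powr (- (1 / 2 - \<epsilon>)) * (Z * (b\<^sup>2 * \<Lambda> powr (1 / 2 + 3 * \<epsilon>)) + 1)"
    proof (rule sobolev_sum_of_sup_bound[OF torus_integrable_phase[OF u] _ \<epsilon> b0 _ Z \<Lambda> G])
      show "norm (fcoef (phase \<tau> u) n) \<le> b * jb n powr \<epsilon>" for n
        using M(2) \<tau> by (simp add: phase_decay_def b_def T_def)
    qed simp_all
    also have "\<dots> \<le> T powr (- 1 / \<beta>) * (Z * M\<^sup>2 + 1)"
      unfolding key using \<Lambda>T Z0 by (intro mult_right_mono) auto
    finally show "(\<Sum>n\<in>G. jb n powr (- (1 / 2 - \<epsilon>)) * (norm (fcoef (phase \<tau> u) n))\<^sup>2)
       \<le> T powr (- 1 / \<beta>) * (Z * M\<^sup>2 + 1)" .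
    have "- (1 - (1 / 2 - \<epsilon>)) = - (1 / 2 + \<epsilon>)" by simp
    then show "(\<Sum>n\<in>G. jb n powr (- (1 - (1 / 2 - \<epsilon>)))) \<le> Z" using Z[OF G] by (simp only:)
  qed
  also have "sqrt (16 * Z * (T powr (- 1 / \<beta>) * (Z * M\<^sup>2 + 1))) = sqrt (16 * Z * (Z * M\<^sup>2 + 1)) * sqrt (T powr (- 1 / \<beta>))"
    by (simp only: real_sqrt_mult mult_ac)
  also have "sqrt (T powr (- 1 / \<beta>)) = T powr (- 1 / (2 * \<beta>))"
    by (simp add: powr_half_sqrt[symmetric] powr_powr mult.commute)
  finally show ?thesis by (simp only: T_def)
qed

lemma is_rate_powr: "0 < a \<Longrightarrow> is_rate (\<lambda>t. t powr a)"
  unfolding is_rate_def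
proof (intro conjI)
  assume "0 < a"
  then show "continuous_on {0..} (\<lambda>t. t powr a)"
    by (intro continuous_on_powr' continuous_on_id continuous_on_const) auto
  show "mono_on {0..} (\<lambda>t. t powr a)"
    using \<open>0 < a\<close> by (auto intro!: mono_onI powr_mono2)
qed auto

theorem mixing_of_phase_decay:
  assumes u: "torus_integrable u" and \<alpha>: "0 < \<alpha>" and \<beta>: "\<alpha> < \<beta>"
    and decay: "\<And>j::nat. \<exists>M. phase_decay \<alpha> (1 / real (Suc j)) M u"
  shows "\<exists>r. mixing_on_scale (1 / 2) (torus_class u) r \<and> (\<exists>c>0. \<forall>t\<ge>1. r t \<ge> c * t powr (1 / (2 * \<beta>)))"
proof -
  have "(\<lambda>j. 1 / real (Suc j)) \<longlonglongrightarrow> 0" by (rule lim_1_over_n[THEN LIMSEQ_Suc])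
  \<comment> \<open>The decay exponent obtained with loss \<epsilon> = 1/(j + 1) tends to
    1/\<alpha>, which exceeds 1/\<beta>; some j therefore suffices, depending on \<beta>.\<close>
  then have "(\<lambda>j. (1 / \<alpha> - 2 * (1 / real (Suc j))) / (1 / 2 + 3 * (1 / real (Suc j))) * (1 / 2 - 1 / real (Suc j)))
      \<longlonglongrightarrow> (1 / \<alpha> - 2 * 0) / (1 / 2 + 3 * 0) * (1 / 2 - 0)"
    by (intro tendsto_intros) auto
  moreover have "1 / \<beta> < (1 / \<alpha> - 2 * 0) / (1 / 2 + 3 * 0) * (1 / 2 - 0)"
    using \<alpha> \<beta> by (simp add: field_simps)
  ultimately have "eventually (\<lambda>j. 1 / \<beta> < (1 / \<alpha> - 2 * (1 / real (Suc j))) / (1 / 2 + 3 * (1 / real (Suc j)))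
      * (1 / 2 - 1 / real (Suc j))) sequentially"
    by (rule order_tendstoD)
  moreover have "eventually (\<lambda>j. 1 / real (Suc j) < 1 / 2) sequentially"
    by (rule eventually_sequentiallyI[of 2]) auto
  ultimately have "eventually (\<lambda>j. 1 / \<beta> < (1 / \<alpha> - 2 * (1 / real (Suc j))) / (1 / 2 + 3 * (1 / real (Suc j)))
      * (1 / 2 - 1 / real (Suc j)) \<and> 1 / real (Suc j) < 1 / 2) sequentially"
    by (rule eventually_conj)
  then obtain j where j: "1 / \<beta> < (1 / \<alpha> - 2 * (1 / real (Suc j))) / (1 / 2 + 3 * (1 / real (Suc j)))
      * (1 / 2 - 1 / real (Suc j))" "1 / real (Suc j) < 1 / 2"
    using eventually_happens' sequentially_bot by blast
  define \<epsilon> where "\<epsilon> = 1 / real (Suc j)"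
  have \<epsilon>: "0 < \<epsilon>" "\<epsilon> < 1 / 2" using j(2) by (auto simp: \<epsilon>_def)
  obtain M where M: "phase_decay \<alpha> \<epsilon> M u" using decay[of j] unfolding \<epsilon>_def by blast
  have "phase_decay \<alpha> \<epsilon> \<bar>M\<bar> u"
    unfolding phase_decay_def
  proof (intro allI impI)
    fix \<tau> :: real and n :: int assume "1 \<le> \<bar>\<tau>\<bar>"
    then have "norm (fcoef (phase \<tau> u) n) \<le> M * \<bar>\<tau>\<bar> powr (\<epsilon> - 1 / (2 * \<alpha>)) * jb n powr \<epsilon>"
      using M unfolding phase_decay_def by blast
    also have "\<dots> \<le> \<bar>M\<bar> * \<bar>\<tau>\<bar> powr (\<epsilon> - 1 / (2 * \<alpha>)) * jb n powr \<epsilon>"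
      by (intro mult_right_mono) auto
    finally show "norm (fcoef (phase \<tau> u) n) \<le> \<bar>M\<bar> * \<bar>\<tau>\<bar> powr (\<epsilon> - 1 / (2 * \<alpha>)) * jb n powr \<epsilon>" .
  qed
  note M = this
  obtain Z where Z: "0 < Z" "\<And>G. finite G \<Longrightarrow> (\<Sum>n\<in>G. jb n powr (- (1 / 2 + \<epsilon>))) \<le> Z"
    using sum_jb_powr_bounded[of "1 / 2 + \<epsilon>"] \<epsilon> by auto
  define C where "C = sqrt (16 * Z * (Z * \<bar>M\<bar>\<^sup>2 + 1))"
  have "0 < Z * \<bar>M\<bar>\<^sup>2 + 1" using Z by (intro add_nonneg_pos) auto
  then have C: "0 < C" using Z by (simp add: C_def)
  have \<kappa>: "1 / \<beta> \<le> (1 / \<alpha> - 2 * \<epsilon>) / (1 / 2 + 3 * \<epsilon>) * (1 / 2 - \<epsilon>)"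
    using j(1) unfolding \<epsilon>_def by (rule less_imp_le)
  have "phase_mult_opnorm (1 / 2) (t * of_int k) (torus_class u)
      \<le> ennreal C / ennreal ((t * \<bar>of_int k\<bar>) powr (1 / (2 * \<beta>)))" if t: "1 \<le> t" and k: "k \<noteq> 0" for t :: real and k :: int
  proof -
    have k1: "1 \<le> real_of_int \<bar>k\<bar>" using k by linarith
    have abs: "\<bar>t * of_int k\<bar> = t * \<bar>of_int k\<bar>" using t by (simp add: abs_mult)
    have one: "1 \<le> t * \<bar>of_int k\<bar>" using mult_mono[of 1 t 1 "real_of_int \<bar>k\<bar>"] t k1 by simp
    have "phase_mult_opnorm (1 / 2) (t * of_int k) (torus_class u)
      \<le> ennreal (C * (t * \<bar>of_int k\<bar>) powr (- 1 / (2 * \<beta>)))"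
      using phase_mult_opnorm_decay[OF u \<alpha> \<epsilon> _ M Z(2) _ \<kappa>, of "t * of_int k"] one abs
      by (simp add: C_def)
    also have "C * (t * \<bar>of_int k\<bar>) powr (- 1 / (2 * \<beta>)) = C / (t * \<bar>of_int k\<bar>) powr (1 / (2 * \<beta>))"
      using one by (simp add: powr_minus_divide)
    also have "ennreal \<dots> = ennreal C / ennreal ((t * \<bar>of_int k\<bar>) powr (1 / (2 * \<beta>)))"
      using C one k1 by (intro divide_ennreal[symmetric]) auto
    finally show ?thesis .
  qed
  then have "mixing_on_scale (1 / 2) (torus_class u) (\<lambda>t. t powr (1 / (2 * \<beta>)))"
    unfolding mixing_on_scale_def using C \<alpha> \<beta> by (auto intro!: is_rate_powr exI[of _ C])
  then show ?thesis
    by (intro exI[of _ "\<lambda>t. t powr (1 / (2 * \<beta>))"] conjI exI[of _ 1]) auto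
qed

section \<open>Series of dyadic step functions\<close>

definition grid_index :: "nat \<Rightarrow> real \<Rightarrow> int" where
  "grid_index m x = \<lfloor>2 ^ m * x / (2 * pi)\<rfloor>"

definition cell :: "nat \<Rightarrow> real \<Rightarrow> nat" where
  "cell m x = nat (grid_index m x mod 2 ^ m)"

lemma grid_index_period: "grid_index m (x + 2 * pi) = grid_index m x + 2 ^ m"
proof -
  have "2 ^ m * (x + 2 * pi) / (2 * pi) = 2 ^ m * x / (2 * pi) + of_int (2 ^ m)"
    by (simp add: field_simps)
  then show ?thesis unfolding grid_index_def by (simp only: floor_add_int[symmetric])
qed

lemma cell_period: "cell m (x + 2 * pi) = cell m x"
  by (simp add: cell_def grid_index_period)

lemma cell_less: "cell m x < 2 ^ m"
proof -
  have "grid_index m x mod 2 ^ m < 2 ^ m" by simp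
  then show ?thesis unfolding cell_def by (simp add: nat_less_iff)
qed

lemma measurable_grid_index [measurable]: "grid_index m \<in> borel \<rightarrow>\<^sub>M count_space UNIV"
  unfolding grid_index_def [abs_def] by measurable

lemma measurable_cell [measurable]: "cell m \<in> borel \<rightarrow>\<^sub>M count_space UNIV"
  unfolding cell_def [abs_def] by measurable

text \<open>The grid index is monotone and increases by \<open>2 ^ m\<close> per period, which gives the integral of
  its increments without describing the jump set.\<close>

lemma integral_grid_index_diff:
  assumes "h' \<le> h"
  shows "integrable torus_measure (\<lambda>x. \<bar>real_of_int (grid_index m (x + h) - grid_index m (x + h'))\<bar>)"
    "(TINT x. \<bar>real_of_int (grid_index m (x + h) - grid_index m (x + h'))\<bar>) = 2 ^ m * (h - h')"
proof -
  \<comment> \<open>This is a periodic sawtooth. Its translates have equal integrals, so only the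
    linear part of the grid index contributes to the increment.\<close>
  define p where "p x = real_of_int (grid_index m x) - 2 ^ m * x / (2 * pi)" for x
  have ti: "torus_integrable p"
  proof (rule torus_integrable_bounded[of _ 1])
    show "p \<in> borel_measurable borel" unfolding p_def [abs_def] by measurable
    show "p (x + 2 * pi) = p x" for x
      unfolding p_def grid_index_period by (simp add: field_simps)
    show "norm (p x) \<le> 1" for x
      unfolding p_def grid_index_def using floor_correct[of "2 ^ m * x / (2 * pi)"] by simp linarith
  qed
  have eq: "\<bar>real_of_int (grid_index m (x + h) - grid_index m (x + h'))\<bar>
      = p (x + h) - p (x + h') + 2 ^ m * (h - h') / (2 * pi)" for x
  proof -
    have "2 ^ m * (x + h') / (2 * pi) \<le> 2 ^ m * (x + h) / (2 * pi)"
      using assms by (intro divide_right_mono mult_left_mono) auto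
    then have "grid_index m (x + h') \<le> grid_index m (x + h)"
      unfolding grid_index_def by (rule floor_mono)
    then show ?thesis by (simp add: p_def field_simps)
  qed
  have int: "integrable torus_measure (\<lambda>x. p (x + h))" for h
    by (rule torus_integrableD(3)[OF torus_integrable_translate[OF ti]])
  show "integrable torus_measure (\<lambda>x. \<bar>real_of_int (grid_index m (x + h) - grid_index m (x + h'))\<bar>)"
    unfolding eq using int by simp
  have "(TINT x. \<bar>real_of_int (grid_index m (x + h) - grid_index m (x + h'))\<bar>)
      = (TINT x. p (x + h)) - (TINT x. p (x + h')) + 2 ^ m * (h - h')"
    unfolding eq using int by simp
  then show "(TINT x. \<bar>real_of_int (grid_index m (x + h) - grid_index m (x + h'))\<bar>) = 2 ^ m * (h - h')"
    by (simp only: torus_integral_translate[OF ti])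
qed

lemma torus_integrable_step: "torus_integrable (\<lambda>x. b (cell m x) :: real)"
proof (rule torus_integrable_bounded[of _ "\<Sum>k<2 ^ m. \<bar>b k\<bar>"])
  show "norm (b (cell m x)) \<le> (\<Sum>k<2 ^ m. \<bar>b k\<bar>)" for x
    using member_le_sum[of "cell m x" "{..<2 ^ m}" "\<lambda>k. \<bar>b k\<bar>"] cell_less by auto
qed (auto simp: cell_period)

text \<open>The values at the two shifted points differ only if the grid index differs, and then the
  difference, at most 2B, is paid for by an index increment of at least 1.\<close>

lemma step_translate_le:
  fixes b :: "nat \<Rightarrow> real"
  assumes b: "\<And>k. k < 2 ^ m \<Longrightarrow> \<bar>b k\<bar> \<le> B"
  shows "(TINT x. \<bar>b (cell m (x + h)) - b (cell m (x + h'))\<bar>) \<le> 2 * B * 2 ^ m * \<bar>h - h'\<bar>"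
proof -
  have B0: "0 \<le> B" using b[of 0] by fastforce
  have main: "(TINT x. \<bar>b (cell m (x + h)) - b (cell m (x + h'))\<bar>) \<le> 2 * B * 2 ^ m * (h - h')"
    if "h' \<le> h" for h h'
  proof -
    have "(TINT x. \<bar>b (cell m (x + h)) - b (cell m (x + h'))\<bar>)
       \<le> (TINT x. 2 * B * \<bar>real_of_int (grid_index m (x + h) - grid_index m (x + h'))\<bar>)"
    proof (rule integral_mono)
      show "integrable torus_measure (\<lambda>x. \<bar>b (cell m (x + h)) - b (cell m (x + h'))\<bar>)"
        by (intro integrable_abs Bochner_Integration.integrable_diff
            torus_integrableD(3)[OF torus_integrable_translate[OF torus_integrable_step]])
      show "integrable torus_measure (\<lambda>x. 2 * B * \<bar>real_of_int (grid_index m (x + h) - grid_index m (x + h'))\<bar>)"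
        using integral_grid_index_diff(1)[OF that] by simp
      fix x
      show "\<bar>b (cell m (x + h)) - b (cell m (x + h'))\<bar>
         \<le> 2 * B * \<bar>real_of_int (grid_index m (x + h) - grid_index m (x + h'))\<bar>"
      proof (cases "grid_index m (x + h) = grid_index m (x + h')")
        case True
        then show ?thesis by (simp add: cell_def)
      next
        case False
        then have "1 \<le> \<bar>real_of_int (grid_index m (x + h) - grid_index m (x + h'))\<bar>" by linarith
        from mult_left_mono[OF this, of "2 * B"] B0
        show ?thesis using b[OF cell_less[of m "x + h"]] b[OF cell_less[of m "x + h'"]] by linarith
      qed
    qed
    also have "\<dots> = 2 * B * 2 ^ m * (h - h')"
      using integral_grid_index_diff(2)[OF that, of m] by simp
    finally show ?thesis .
  qed
  show ?thesis
  proof (cases "h' \<le> h")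
    case False
    then show ?thesis using main[of h h'] by (simp add: abs_minus_commute)
  qed (use main[of h' h] in simp)
qed

lemma torus_dist_nonneg: "0 \<le> torus_dist x y"
  unfolding torus_dist_def by (rule cINF_greatest) auto

text \<open>Interpolates between the Lipschitz bound and the trivial bound through min(1, y) \<le>
  \<open>y powr \<alpha>\<close> at y = \<open>2 ^ m * d\<close>. Periodicity gives the Lipschitz
  bound for every representative of the distance, hence for the infimum.\<close>

lemma step_translate_torus_dist_le:
  fixes b :: "nat \<Rightarrow> real"
  assumes b: "\<And>k. k < 2 ^ m \<Longrightarrow> \<bar>b k\<bar> \<le> B" and \<alpha>: "0 < \<alpha>" "\<alpha> < 1"
  shows "(TINT z. \<bar>b (cell m (z + x)) - b (cell m (z + y))\<bar>)
    \<le> 4 * pi * (B * 2 powr (m * \<alpha>)) * torus_dist x y powr \<alpha>"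
proof -
  define I where "I = (TINT z. \<bar>b (cell m (z + x)) - b (cell m (z + y))\<bar>)"
  define d where "d = torus_dist x y"
  have B0: "0 \<le> B" using b[of 0] by fastforce
  have d0: "0 \<le> d" unfolding d_def by (rule torus_dist_nonneg)
  have per: "\<forall>z. cell m (z + 2 * pi) = cell m z" by (simp add: cell_period)
  have Ik: "I \<le> 2 * B * 2 ^ m * \<bar>x - y - 2 * pi * of_int k\<bar>" for k :: int
  proof -
    have "cell m (z + (y + 2 * pi * of_int k)) = cell m (z + y)" for z
      using periodic_int[OF per, of "z + y" k] by (simp add: add.assoc)
    then have "I = (TINT z. \<bar>b (cell m (z + x)) - b (cell m (z + (y + 2 * pi * of_int k)))\<bar>)"
      by (simp add: I_def)
    also have "\<dots> \<le> 2 * B * 2 ^ m * \<bar>x - (y + 2 * pi * of_int k)\<bar>"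
      by (rule step_translate_le[OF b])
    finally show ?thesis by (simp add: diff_diff_eq)
  qed
  have I1: "I \<le> 2 * B * 2 ^ m * d"
  proof (cases "B = 0")
    case True
    then show ?thesis using Ik[of 0] by simp
  next
    case False
    then have c: "0 < 2 * B * 2 ^ m" using B0 by simp
    have "I / (2 * B * 2 ^ m) \<le> d"
      unfolding d_def torus_dist_def
    proof (rule cINF_greatest)
      fix k :: int
      show "I / (2 * B * 2 ^ m) \<le> \<bar>x - y - 2 * pi * of_int k\<bar>"
        unfolding pos_divide_le_eq[OF c] using Ik[of k] by (simp only: mult_ac)
    qed simp
    then show ?thesis unfolding pos_divide_le_eq[OF c] by (simp only: mult_ac)
  qed
  have I2: "I \<le> 4 * pi * B"
  proof -
    have "I \<le> (TINT z. 2 * B)"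
      unfolding I_def
    proof (rule integral_mono)
      show "integrable torus_measure (\<lambda>z. \<bar>b (cell m (z + x)) - b (cell m (z + y))\<bar>)"
        by (intro integrable_abs Bochner_Integration.integrable_diff
            torus_integrableD(3)[OF torus_integrable_translate[OF torus_integrable_step]])
      show "\<bar>b (cell m (z + x)) - b (cell m (z + y))\<bar> \<le> 2 * B" for z
        using b[OF cell_less[of m "z + x"]] b[OF cell_less[of m "z + y"]] by linarith
    qed simp
    then show ?thesis by simp
  qed
  have pow: "(2::real) powr (m * \<alpha>) = (2 ^ m) powr \<alpha>"
    by (simp add: powr_powr flip: powr_realpow)
  consider "d = 0" | "0 < d" "2 ^ m * d \<le> 1" | "0 < d" "1 \<le> 2 ^ m * d" using d0 by linarith
  then have "I \<le> 4 * pi * (B * 2 powr (m * \<alpha>)) * d powr \<alpha>"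
  proof cases
    case 1
    then show ?thesis using I1 by simp
  next
    case 2
    have "2 ^ m * d \<le> (2 ^ m * d) powr \<alpha>"
      using powr_mono'[of \<alpha> 1 "2 ^ m * d"] 2 \<alpha> by simp
    also have "\<dots> = 2 powr (m * \<alpha>) * d powr \<alpha>"
      using d0 by (simp add: powr_mult pow)
    finally have "2 * B * (2 ^ m * d) \<le> 2 * B * (2 powr (m * \<alpha>) * d powr \<alpha>)"
      using B0 by (intro mult_left_mono) auto
    also have "\<dots> \<le> 4 * pi * B * (2 powr (m * \<alpha>) * d powr \<alpha>)"
      using B0 pi_ge_two by (intro mult_right_mono) (auto simp: mult_right_mono)
    finally show ?thesis using I1 by (simp add: mult_ac)
  next
    case 3
    have "1 \<le> (2 ^ m * d) powr \<alpha>"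
      using 3 \<alpha> by (intro ge_one_powr_ge_zero) auto
    also have "\<dots> = 2 powr (m * \<alpha>) * d powr \<alpha>"
      using d0 by (simp add: powr_mult pow)
    finally have "4 * pi * B * 1 \<le> 4 * pi * B * (2 powr (m * \<alpha>) * d powr \<alpha>)"
      using B0 by (intro mult_left_mono) auto
    then show ?thesis using I2 by (simp add: mult_ac)
  qed
  then show ?thesis by (simp only: I_def d_def)
qed

definition step_series :: "(nat \<Rightarrow> nat \<Rightarrow> real) \<Rightarrow> real \<Rightarrow> real" where
  "step_series b x = (\<Sum>m. b m (cell m x))"

text \<open>Up to a constant, \<open>B m * 2 powr (m * \<alpha>)\<close> bounds the Besov norm of
  level m. The majorant is a separate parameter because the locale serves both a random function and
  the difference of two, where B measures how close the samples are.\<close>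

locale step_coefficients =
  fixes \<alpha> :: real and b :: "nat \<Rightarrow> nat \<Rightarrow> real" and B :: "nat \<Rightarrow> real"
  assumes \<alpha>: "0 < \<alpha>" "\<alpha> < 1"
    and bound: "\<And>m k. k < 2 ^ m \<Longrightarrow> \<bar>b m k\<bar> \<le> B m"
    and summable_B: "summable (\<lambda>m. B m * 2 powr (m * \<alpha>))"
begin

lemma B_nonneg: "0 \<le> B m"
  using bound[of 0 m] by fastforce

lemma B_le: "B m \<le> B m * 2 powr (m * \<alpha>)"
  using B_nonneg[of m] \<alpha> by (simp add: mult_le_cancel_left1 ge_one_powr_ge_zero)

lemma summable_B': "summable B"
  by (rule summable_comparison_test'[OF summable_B, of 0]) (use B_nonneg B_le in auto)

lemma cell_bound: "\<bar>b m (cell m x)\<bar> \<le> B m"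
  by (intro bound cell_less)

lemma summable_cells: "summable (\<lambda>m. b m (cell m x))"
  by (rule summable_comparison_test'[OF summable_B', of 0]) (use cell_bound in auto)

lemma torus_integrable_step_series: "torus_integrable (step_series b)"
proof (rule torus_integrable_bounded[of _ "suminf B"])
  show "step_series b \<in> borel_measurable borel"
    unfolding step_series_def [abs_def] by measurable
  show "step_series b (x + 2 * pi) = step_series b x" for x
    by (simp add: step_series_def cell_period)
  show "norm (step_series b x) \<le> suminf B" for x
    unfolding step_series_def by (rule norm_suminf_le) (use cell_bound summable_B' in auto)
qed

lemma norm_step_series_le: "norm (torus_class (step_series b)) \<le> 2 * pi * (\<Sum>m. B m * 2 powr (m * \<alpha>))"
proof -
  have "\<bar>step_series b x\<bar> \<le> (\<Sum>m. B m * 2 powr (m * \<alpha>))" for x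
  proof -
    have "norm (step_series b x) \<le> suminf B"
      unfolding step_series_def by (rule norm_suminf_le) (use cell_bound summable_B' in auto)
    also have "\<dots> \<le> (\<Sum>m. B m * 2 powr (m * \<alpha>))"
      by (intro suminf_le B_le summable_B' summable_B)
    finally show ?thesis by simp
  qed
  then have "(TINT x. \<bar>step_series b x\<bar>) \<le> (TINT x. (\<Sum>m. B m * 2 powr (m * \<alpha>)))"
    using torus_integrableD(3)[OF torus_integrable_step_series] by (intro integral_mono) auto
  then show ?thesis
    by (simp add: norm_torus_class torus_integrable_step_series)
qed

lemma translate_step_series_le:
  "norm (translate x (torus_class (step_series b)) - translate y (torus_class (step_series b)))
    \<le> 4 * pi * (\<Sum>m. B m * 2 powr (m * \<alpha>)) * torus_dist x y powr \<alpha>"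
proof -
  define d where "d m z = b m (cell m (z + x)) - b m (cell m (z + y))" for m z
  have di: "integrable torus_measure (d m)" for m
    unfolding d_def by (intro Bochner_Integration.integrable_diff
        torus_integrableD(3)[OF torus_integrable_translate[OF torus_integrable_step]])
  have db: "norm (d m z) \<le> 2 * B m" for m z
    unfolding d_def using cell_bound[of m "z + x"] cell_bound[of m "z + y"] by simp
  have ds: "summable (\<lambda>m. norm (d m z))" for z
    by (rule summable_comparison_test'[OF summable_mult[OF summable_B', of 2], of 0]) (use db in auto)
  have dI: "(TINT z. norm (d m z)) \<le> 4 * pi * torus_dist x y powr \<alpha> * (B m * 2 powr (m * \<alpha>))" for m
    using step_translate_torus_dist_le[where b = "b m" and m = m and B = "B m" and x = x and y = y, OF bound \<alpha>]
    by (simp add: d_def mult_ac)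
  have sI: "summable (\<lambda>m. 4 * pi * torus_dist x y powr \<alpha> * (B m * 2 powr (m * \<alpha>)))"
    by (intro summable_mult summable_B)
  have sd: "summable (\<lambda>m. TINT z. norm (d m z))"
    by (rule AE_summable_norm(2)[OF di dI sI])
  have ti: "torus_integrable (\<lambda>z. step_series b (z + x) - step_series b (z + y))"
    by (intro torus_integrable_diff torus_integrable_translate torus_integrable_step_series)
  have eq: "step_series b (z + x) - step_series b (z + y) = (\<Sum>m. d m z)" for z
    unfolding step_series_def d_def by (intro suminf_diff summable_cells)
  have "norm (translate x (torus_class (step_series b)) - translate y (torus_class (step_series b)))
      = (TINT z. norm (\<Sum>m. d m z))"
    using ti torus_integrable_step_series
    by (simp add: translate_torus_class diff_torus_class torus_integrable_translate norm_torus_class eq)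
  also have "\<dots> \<le> (TINT z. (\<Sum>m. norm (d m z)))"
  proof (rule integral_mono)
    show "integrable torus_measure (\<lambda>z. norm (\<Sum>m. d m z))"
      using torus_integrableD(3)[OF ti] by (simp add: eq)
    show "integrable torus_measure (\<lambda>z. \<Sum>m. norm (d m z))"
      by (rule integrable_suminf) (use di ds sd in auto)
    show "norm (\<Sum>m. d m z) \<le> (\<Sum>m. norm (d m z))" for z
      by (rule summable_norm[OF ds])
  qed
  also have "\<dots> = (\<Sum>m. TINT z. norm (d m z))"
    by (rule integral_suminf) (use di ds sd in auto)
  also have "\<dots> \<le> (\<Sum>m. 4 * pi * torus_dist x y powr \<alpha> * (B m * 2 powr (m * \<alpha>)))"
    by (intro suminf_le dI sd sI)
  also have "\<dots> = 4 * pi * (\<Sum>m. B m * 2 powr (m * \<alpha>)) * torus_dist x y powr \<alpha>"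
    unfolding suminf_mult[OF summable_B] by (simp only: mult_ac)
  finally show ?thesis .
qed

lemma besov_enorm_step_series_le:
  "besov_enorm \<alpha> (torus_class (step_series b)) \<le> ennreal (6 * pi * (\<Sum>m. B m * 2 powr (m * \<alpha>)))"
proof -
  define S where "S = (\<Sum>m. B m * 2 powr (m * \<alpha>))"
  have S0: "0 \<le> S" unfolding S_def by (intro suminf_nonneg summable_B) (simp add: B_nonneg)
  have "(SUP (x, y) \<in> {(x, y). torus_dist x y \<noteq> 0}.
      ennreal (norm (translate x (torus_class (step_series b)) - translate y (torus_class (step_series b)))
        / torus_dist x y powr \<alpha>)) \<le> ennreal (4 * pi * S)"
  proof (rule SUP_least, clarify)
    fix x y assume "torus_dist x y \<noteq> 0"
    then have "0 < torus_dist x y powr \<alpha>" using torus_dist_nonneg[of x y] by simp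
    then show "ennreal (norm (translate x (torus_class (step_series b)) - translate y (torus_class (step_series b)))
        / torus_dist x y powr \<alpha>) \<le> ennreal (4 * pi * S)"
      using translate_step_series_le[of x y] by (intro ennreal_leI) (simp add: pos_divide_le_eq S_def)
  qed
  then have "besov_enorm \<alpha> (torus_class (step_series b)) \<le> ennreal (2 * pi * S) + ennreal (4 * pi * S)"
    unfolding besov_enorm_def by (intro add_mono ennreal_leI norm_step_series_le[folded S_def])
  also have "\<dots> = ennreal (6 * pi * S)"
    using S0 by (simp flip: ennreal_plus)
  finally show ?thesis by (simp only: S_def)
qed

end

section \<open>A random step series\<close>

text \<open>Samples range over all real arrays. Clipping makes every one of them yield a bounded
  function, so that integrability, continuity and compactness hold without exceptional sets; on
  [0, 1], where the law lives, it is the identity.\<close>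

definition clip :: "real \<Rightarrow> real" where
  "clip t = max 0 (min 1 t)"

text \<open>The cubic factor makes the Besov norms of the levels summable, for \<open>m\<close> copies per cell.\<close>

definition amp :: "real \<Rightarrow> nat \<Rightarrow> real" where
  "amp \<alpha> m = 2 powr (- (real m * \<alpha>)) / (real m + 1) ^ 3"

type_synonym sample = "nat \<Rightarrow> nat \<Rightarrow> nat \<Rightarrow> real"

text \<open>Level \<open>m\<close> carries \<open>m\<close> independent copies per cell, so that the characteristic function of a
  coefficient decays like a power whose order grows with \<open>m\<close>.\<close>

definition rcoef :: "real \<Rightarrow> sample \<Rightarrow> nat \<Rightarrow> nat \<Rightarrow> real" where
  "rcoef \<alpha> \<omega> m k = amp \<alpha> m * (\<Sum>i<m. clip (\<omega> m k i))"

definition rfun :: "real \<Rightarrow> sample \<Rightarrow> real \<Rightarrow> real" where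
  "rfun \<alpha> \<omega> = step_series (rcoef \<alpha> \<omega>)"

lemma clip_bounds: "0 \<le> clip t" "clip t \<le> 1"
  by (auto simp: clip_def)

lemma clip_clip [simp]: "clip (clip t) = clip t"
  by (auto simp: clip_def)

lemma amp_pos: "0 < amp \<alpha> m"
  by (simp add: amp_def)

lemma rcoef_bounds: "0 \<le> rcoef \<alpha> \<omega> m k" "rcoef \<alpha> \<omega> m k \<le> amp \<alpha> m * m"
proof -
  show "0 \<le> rcoef \<alpha> \<omega> m k"
    unfolding rcoef_def using amp_pos[of \<alpha> m]
    by (intro mult_nonneg_nonneg sum_nonneg) (auto simp: clip_bounds)
  have "(\<Sum>i<m. clip (\<omega> m k i)) \<le> (\<Sum>i<m. 1)" by (intro sum_mono clip_bounds)
  then show "rcoef \<alpha> \<omega> m k \<le> amp \<alpha> m * m"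
    unfolding rcoef_def using amp_pos[of \<alpha> m] by (intro mult_left_mono) auto
qed

lemma amp_weight: "amp \<alpha> m * 2 powr (real m * \<alpha>) = 1 / (real m + 1) ^ 3"
  by (simp add: amp_def powr_minus_divide)

lemma summable_amp:
  fixes \<alpha> c :: real
  shows "summable (\<lambda>m. c * (amp \<alpha> m * m) * 2 powr (real m * \<alpha>))"
proof -
  have "summable (\<lambda>m. 1 / (real m + 1) ^ 2)"
    using summable_Suc_iff[of "\<lambda>m. inverse (real m ^ 2)"] inverse_power_summable[of 2, where 'a = real]
    by (simp add: inverse_eq_divide add.commute)
  then have "summable (\<lambda>m. \<bar>c\<bar> * (1 / (real m + 1) ^ 2))" by (rule summable_mult)
  then show ?thesis
  proof (rule summable_comparison_test'[of _ 0])
    fix m :: nat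
    have "real m / (real m + 1) ^ 3 \<le> (real m + 1) / (real m + 1) ^ 3"
      by (intro divide_right_mono) auto
    also have "\<dots> = 1 / (real m + 1) ^ 2" by (simp add: power2_eq_square power3_eq_cube)
    finally have le: "real m / (real m + 1) ^ 3 \<le> 1 / (real m + 1) ^ 2" .
    have "c * (amp \<alpha> m * m) * 2 powr (real m * \<alpha>) = c * (real m / (real m + 1) ^ 3)"
      using amp_weight[of \<alpha> m] by (simp add: mult_ac)
    then have "norm (c * (amp \<alpha> m * m) * 2 powr (real m * \<alpha>)) = \<bar>c\<bar> * (real m / (real m + 1) ^ 3)"
      by (simp add: abs_mult)
    also have "\<dots> \<le> \<bar>c\<bar> * (1 / (real m + 1) ^ 2)" by (intro mult_left_mono le) auto
    finally show "norm (c * (amp \<alpha> m * m) * 2 powr (real m * \<alpha>)) \<le> \<bar>c\<bar> * (1 / (real m + 1) ^ 2)" .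
  qed
qed

lemma step_coefficients_rcoef:
  fixes \<alpha> :: real
  assumes "0 < \<alpha>" "\<alpha> < 1"
  shows "step_coefficients \<alpha> (rcoef \<alpha> \<omega>) (\<lambda>m. amp \<alpha> m * m)"
  using assms rcoef_bounds[where \<alpha> = \<alpha> and \<omega> = \<omega>] summable_amp[where c = 1 and \<alpha> = \<alpha>] by unfold_locales (auto simp: abs_le_iff intro: order_trans)

section \<open>Continuity and compactness of the random family\<close>

text \<open>The sum over cells is continuous in the samples and bounds the difference of the
  coefficients. The minimum adds a majorant independent of the samples, which is what the M-test in
  \<open>continuous_rmod\<close> requires.\<close>

definition rdist :: "real \<Rightarrow> sample \<Rightarrow> sample \<Rightarrow> nat \<Rightarrow> real" where
  "rdist \<alpha> \<omega> \<omega>' m = min (amp \<alpha> m * m) (\<Sum>k<2 ^ m. \<bar>rcoef \<alpha> \<omega> m k - rcoef \<alpha> \<omega>' m k\<bar>)"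

definition rmod :: "real \<Rightarrow> sample \<Rightarrow> sample \<Rightarrow> real" where
  "rmod \<alpha> \<omega> \<omega>' = (\<Sum>m. rdist \<alpha> \<omega> \<omega>' m * 2 powr (real m * \<alpha>))"

lemma rdist_bounds: "0 \<le> rdist \<alpha> \<omega> \<omega>' m" "rdist \<alpha> \<omega> \<omega>' m \<le> amp \<alpha> m * m"
  using amp_pos[of \<alpha> m] by (auto simp: rdist_def intro!: sum_nonneg)

lemma rdist_weight_le:
  fixes \<alpha> :: real
  shows "norm (rdist \<alpha> \<omega> \<omega>' m * 2 powr (real m * \<alpha>)) \<le> 1 * (amp \<alpha> m * m) * 2 powr (real m * \<alpha>)"
  using rdist_bounds[of \<alpha> \<omega> \<omega>' m] by (simp add: mult_right_mono)

lemma step_coefficients_rdist: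
  fixes \<alpha> :: real
  assumes "0 < \<alpha>" "\<alpha> < 1"
  shows "step_coefficients \<alpha> (\<lambda>m k. rcoef \<alpha> \<omega> m k - rcoef \<alpha> \<omega>' m k) (rdist \<alpha> \<omega> \<omega>')"
proof
  show "summable (\<lambda>m. rdist \<alpha> \<omega> \<omega>' m * 2 powr (real m * \<alpha>))"
    by (rule summable_comparison_test'[OF summable_amp[where c = 1 and \<alpha> = \<alpha>], of 0 ]) (rule rdist_weight_le)
  fix m k :: nat assume k: "k < 2 ^ m"
  have "\<bar>rcoef \<alpha> \<omega> m k - rcoef \<alpha> \<omega>' m k\<bar> \<le> amp \<alpha> m * m"
    using rcoef_bounds[of \<alpha> \<omega> m k] rcoef_bounds[of \<alpha> \<omega>' m k] by linarith
  moreover have "\<bar>rcoef \<alpha> \<omega> m k - rcoef \<alpha> \<omega>' m k\<bar> \<le> (\<Sum>k<2 ^ m. \<bar>rcoef \<alpha> \<omega> m k - rcoef \<alpha> \<omega>' m k\<bar>)"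
    using k by (intro member_le_sum) auto
  ultimately show "\<bar>rcoef \<alpha> \<omega> m k - rcoef \<alpha> \<omega>' m k\<bar> \<le> rdist \<alpha> \<omega> \<omega>' m"
    by (simp add: rdist_def)
qed (use assms in auto)

lemma continuous_rcoef: "continuous_on UNIV (\<lambda>\<omega>. rcoef \<alpha> \<omega> m k)"
proof -
  have "continuous_on UNIV (\<lambda>\<omega>::sample. \<omega> m k i)" for i
    by (rule continuous_on_product_then_coordinatewise[OF continuous_on_product_then_coordinatewise[OF
        continuous_on_product_coordinates]])
  then show ?thesis
    unfolding rcoef_def clip_def
    by (intro continuous_on_mult continuous_on_const continuous_on_sum continuous_on_max continuous_on_min)
qed

lemma continuous_rmod: "continuous_on UNIV (rmod \<alpha> \<omega>)"
proof -
  have "uniform_limit UNIV (\<lambda>n \<omega>'. \<Sum>m<n. rdist \<alpha> \<omega> \<omega>' m * 2 powr (real m * \<alpha>))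
     (\<lambda>\<omega>'. \<Sum>m. rdist \<alpha> \<omega> \<omega>' m * 2 powr (real m * \<alpha>)) sequentially"
    by (rule Weierstrass_m_test[OF rdist_weight_le summable_amp])
  then have "continuous_on UNIV (\<lambda>\<omega>'. \<Sum>m. rdist \<alpha> \<omega> \<omega>' m * 2 powr (real m * \<alpha>))"
  proof (rule uniform_limit_theorem[rotated])
    show "\<forall>\<^sub>F n in sequentially. continuous_on UNIV (\<lambda>\<omega>'. \<Sum>m<n. rdist \<alpha> \<omega> \<omega>' m * 2 powr (real m * \<alpha>))"
      unfolding rdist_def
      by (intro always_eventually allI continuous_on_sum continuous_on_mult continuous_on_min
          continuous_on_const continuous_on_rabs continuous_on_diff continuous_rcoef)
  qed simp
  then show ?thesis by (simp add: rmod_def [abs_def])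
qed

lemma rmod_self [simp]: "rmod \<alpha> \<omega> \<omega> = 0"
proof -
  have "rdist \<alpha> \<omega> \<omega> m = 0" for m using amp_pos[of \<alpha> m] by (simp add: rdist_def)
  then show ?thesis by (simp add: rmod_def)
qed

lemma rmod_nonneg: "0 \<le> rmod \<alpha> \<omega> \<omega>'"
  unfolding rmod_def
  by (rule suminf_nonneg[OF summable_comparison_test'[OF summable_amp rdist_weight_le]])
     (simp add: rdist_bounds)

lemma compact_functions:
  fixes K :: "'b::topological_space set"
  assumes "compact K"
  shows "compact {f :: nat \<Rightarrow> 'b. \<forall>i. f i \<in> K}"
proof -
  have "compactin (product_topology (\<lambda>_. euclidean) (UNIV :: nat set)) (PiE UNIV (\<lambda>_. K))"
    using assms by (simp add: compactin_PiE)
  moreover have "PiE UNIV (\<lambda>_. K) = {f :: nat \<Rightarrow> 'b. \<forall>i. f i \<in> K}" by auto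
  ultimately show ?thesis by (simp add: euclidean_product_topology)
qed

abbreviation besov_topology :: "real \<Rightarrow> real torus_L1 topology" where
  "besov_topology \<alpha> \<equiv> norm_topology (besov \<alpha>) (besov_norm \<alpha>)"

context
  fixes \<alpha> :: real
  assumes \<alpha>: "0 < \<alpha>" "\<alpha> < 1"
begin

lemma torus_integrable_rfun: "torus_integrable (rfun \<alpha> \<omega>)"
  unfolding rfun_def by (rule step_coefficients.torus_integrable_step_series[OF step_coefficients_rcoef[OF \<alpha>]])

lemma rfun_in_besov: "torus_class (rfun \<alpha> \<omega>) \<in> besov \<alpha>"
  using step_coefficients.besov_enorm_step_series_le[OF step_coefficients_rcoef[OF \<alpha>], of \<omega>]
  by (auto simp: besov_def rfun_def intro: le_less_trans)

lemma rfun_diff: "rfun \<alpha> \<omega> x - rfun \<alpha> \<omega>' x = step_series (\<lambda>m k. rcoef \<alpha> \<omega> m k - rcoef \<alpha> \<omega>' m k) x"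
  unfolding rfun_def step_series_def
  by (intro suminf_diff step_coefficients.summable_cells[OF step_coefficients_rcoef[OF \<alpha>]])

lemma rfun_class_diff:
  "torus_class (rfun \<alpha> \<omega>) - torus_class (rfun \<alpha> \<omega>')
     = torus_class (step_series (\<lambda>m k. rcoef \<alpha> \<omega> m k - rcoef \<alpha> \<omega>' m k))"
  by (simp add: diff_torus_class torus_integrable_rfun rfun_diff)

lemma besov_norm_rfun_diff_le:
  "besov_norm \<alpha> (torus_class (rfun \<alpha> \<omega>) - torus_class (rfun \<alpha> \<omega>')) \<le> 6 * pi * rmod \<alpha> \<omega> \<omega>'"
  using step_coefficients.besov_enorm_step_series_le[OF step_coefficients_rdist[OF \<alpha>], of \<omega> \<omega>']
    rmod_nonneg[of \<alpha> \<omega> \<omega>']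
  unfolding besov_norm_def rfun_class_diff
  by (simp add: enn2real_leI flip: rmod_def)

lemma L1_rfun_diff_le: "(TINT x. \<bar>rfun \<alpha> \<omega> x - rfun \<alpha> \<omega>' x\<bar>) \<le> 2 * pi * rmod \<alpha> \<omega> \<omega>'"
  using step_coefficients.norm_step_series_le[OF step_coefficients_rdist[OF \<alpha>], of \<omega> \<omega>']
  by (simp add: rfun_diff rmod_def norm_torus_class
      step_coefficients.torus_integrable_step_series[OF step_coefficients_rdist[OF \<alpha>]])

text \<open>This continuity serves twice: for compactness of the range, and for measurability into
  the Borel sets of the Besov norm, since by \<open>sets_rand\<close> open sets of samples are
  measurable.\<close>

lemma open_vimage_rfun:
  assumes "openin (besov_topology \<alpha>) U"
  shows "open {\<omega>. torus_class (rfun \<alpha> \<omega>) \<in> U}"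
proof (subst open_subopen, clarify)
  interpret Metric_space "besov \<alpha>" "\<lambda>u v. besov_norm \<alpha> (u - v)" by (rule Metric_space_besov)
  fix \<omega> assume "torus_class (rfun \<alpha> \<omega>) \<in> U"
  then obtain r where r: "0 < r" "mball (torus_class (rfun \<alpha> \<omega>)) r \<subseteq> U"
    using assms by (auto simp: norm_topology_def openin_mtopology)
  have "open {\<omega>'. 6 * pi * rmod \<alpha> \<omega> \<omega>' < r}"
    by (intro open_Collect_less continuous_intros continuous_rmod)
  moreover have "{\<omega>'. 6 * pi * rmod \<alpha> \<omega> \<omega>' < r} \<subseteq> {\<omega>. torus_class (rfun \<alpha> \<omega>) \<in> U}"
  proof clarify
    fix \<omega>' assume "6 * pi * rmod \<alpha> \<omega> \<omega>' < r"
    then have "torus_class (rfun \<alpha> \<omega>') \<in> mball (torus_class (rfun \<alpha> \<omega>)) r"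
      using besov_norm_rfun_diff_le[of \<omega> \<omega>'] by (simp add: in_mball rfun_in_besov)
    then show "torus_class (rfun \<alpha> \<omega>') \<in> U" using r by blast
  qed
  ultimately show "\<exists>T. open T \<and> \<omega> \<in> T \<and> T \<subseteq> {\<omega>. torus_class (rfun \<alpha> \<omega>) \<in> U}"
    using r(1) by (intro exI[of _ "{\<omega>'. 6 * pi * rmod \<alpha> \<omega> \<omega>' < r}"]) simp
qed

text \<open>Clipping a sample does not change its function, so the range is already the image of a
  product of unit intervals.\<close>

lemma compactin_range_rfun:
  "compactin (besov_topology \<alpha>) (range (\<lambda>\<omega>. torus_class (rfun \<alpha> \<omega>)))"
proof -
  interpret Metric_space "besov \<alpha>" "\<lambda>u v. besov_norm \<alpha> (u - v)" by (rule Metric_space_besov)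
  define C :: "sample set"
    where "C = {\<omega>. \<forall>m. \<omega> m \<in> {y. \<forall>k. y k \<in> {z. \<forall>i. z i \<in> {0..1}}}}"
  have C: "compact C" unfolding C_def by (intro compact_functions compact_Icc)
  have "torus_class (rfun \<alpha> \<omega>) \<in> (\<lambda>\<omega>. torus_class (rfun \<alpha> \<omega>)) ` C" for \<omega>
  proof (rule image_eqI)
    show "torus_class (rfun \<alpha> \<omega>) = torus_class (rfun \<alpha> (\<lambda>m k i. clip (\<omega> m k i)))"
      by (simp add: rfun_def rcoef_def [abs_def])
    show "(\<lambda>m k i. clip (\<omega> m k i)) \<in> C" by (simp add: C_def clip_bounds)
  qed
  then have "range (\<lambda>\<omega>. torus_class (rfun \<alpha> \<omega>)) = (\<lambda>\<omega>. torus_class (rfun \<alpha> \<omega>)) ` C"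
    by blast
  moreover have "continuous_map euclidean (besov_topology \<alpha>) (\<lambda>\<omega>. torus_class (rfun \<alpha> \<omega>))"
    using open_vimage_rfun by (auto simp: continuous_map_def rfun_in_besov norm_topology_def)
  ultimately show ?thesis
    using image_compactin[of euclidean C] C by simp
qed

end

text \<open>Both arguments vary: equal \<tau> and \<sigma> give continuity in the function, equal
  functions give the comparison of \<tau> with a nearby grid point.\<close>

lemma fcoef_phase_diff_le:
  assumes u: "torus_integrable u" and v: "torus_integrable v"
  shows "norm (fcoef (phase \<tau> u) n - fcoef (phase \<sigma> v) n)
     \<le> (TINT x. \<bar>\<tau> * u x - \<sigma> * v x\<bar>) / (2 * pi)"
proof -
  have ti: "torus_integrable (\<lambda>x. phase \<tau> u x - phase \<sigma> v x)"
    by (intro torus_integrable_diff torus_integrable_phase u v)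
  have "norm (fcoef (phase \<tau> u) n - fcoef (phase \<sigma> v) n) = norm (fcoef (\<lambda>x. phase \<tau> u x - phase \<sigma> v x) n)"
    by (simp add: fcoef_diff torus_integrable_phase u v)
  also have "\<dots> \<le> (TINT x. norm (phase \<tau> u x - phase \<sigma> v x)) / (2 * pi)"
    by (rule fcoef_bound[OF ti])
  also have "\<dots> \<le> (TINT x. \<bar>\<tau> * u x - \<sigma> * v x\<bar>) / (2 * pi)"
    using torus_integrableD(3)[OF ti] torus_integrableD(3)[OF u] torus_integrableD(3)[OF v]
    by (intro divide_right_mono integral_mono norm_phase_diff_le) auto
  finally show ?thesis .
qed

lemma continuous_fcoef_rfun:
  assumes \<alpha>: "0 < \<alpha>" "\<alpha> < 1" and v: "torus_integrable v"
  shows "continuous_on UNIV (\<lambda>\<omega>. fcoef (phase \<tau> (\<lambda>x. rfun \<alpha> \<omega> x - v x)) n)"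
  unfolding continuous_on_def
proof
  fix \<omega>
  let ?F = "\<lambda>\<omega>. fcoef (phase \<tau> (\<lambda>x. rfun \<alpha> \<omega> x - v x)) n"
  have "norm (?F \<omega>' - ?F \<omega>) \<le> \<bar>\<tau>\<bar> * rmod \<alpha> \<omega> \<omega>'" for \<omega>'
  proof -
    have ti: "torus_integrable (\<lambda>x. rfun \<alpha> \<omega> x - v x)" for \<omega>
      by (intro torus_integrable_diff torus_integrable_rfun \<alpha> v)
    have "norm (?F \<omega> - ?F \<omega>') \<le> (TINT x. \<bar>\<tau> * (rfun \<alpha> \<omega> x - v x) - \<tau> * (rfun \<alpha> \<omega>' x - v x)\<bar>) / (2 * pi)"
      by (rule fcoef_phase_diff_le[OF ti ti])
    also have "\<dots> = \<bar>\<tau>\<bar> * (TINT x. \<bar>rfun \<alpha> \<omega> x - rfun \<alpha> \<omega>' x\<bar>) / (2 * pi)"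
      by (simp add: abs_mult flip: right_diff_distrib)
    also have "\<dots> \<le> \<bar>\<tau>\<bar> * (2 * pi * rmod \<alpha> \<omega> \<omega>') / (2 * pi)"
      by (intro divide_right_mono mult_left_mono L1_rfun_diff_le \<alpha>) auto
    finally show ?thesis by (simp add: norm_minus_commute)
  qed
  note le = this
  have "(rmod \<alpha> \<omega> \<longlongrightarrow> rmod \<alpha> \<omega> \<omega>) (at \<omega>)"
    using continuous_rmod[of \<alpha> \<omega>] unfolding continuous_on_def by blast
  then have "((\<lambda>\<omega>'. \<bar>\<tau>\<bar> * rmod \<alpha> \<omega> \<omega>') \<longlongrightarrow> \<bar>\<tau>\<bar> * rmod \<alpha> \<omega> \<omega>) (at \<omega>)"
    by (rule tendsto_mult_left)
  then have lim: "((\<lambda>\<omega>'. \<bar>\<tau>\<bar> * rmod \<alpha> \<omega> \<omega>') \<longlongrightarrow> 0) (at \<omega>)" by simp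
  have "((\<lambda>\<omega>'. ?F \<omega>' - ?F \<omega>) \<longlongrightarrow> 0) (at \<omega>)"
    by (rule Lim_null_comparison[OF always_eventually[OF allI[OF le]] lim])
  then show "(?F \<longlongrightarrow> ?F \<omega>) (at \<omega> within UNIV)"
    by (simp add: LIM_zero_iff)
qed

section \<open>Law of the random coefficients and concentration inequalities\<close>

definition unif :: "real measure" where
  "unif = uniform_measure lborel {0..1}"

text \<open>The products are nested over copies, cells and levels, following the currying of
  \<open>sample\<close>: a whole level can then be split off as one coordinate, and within it the
  cells are independent coordinates.\<close>

definition copy_measure :: "(nat \<Rightarrow> real) measure" where
  "copy_measure = PiM UNIV (\<lambda>_. unif)"

definition level_measure :: "(nat \<Rightarrow> nat \<Rightarrow> real) measure" where
  "level_measure = PiM UNIV (\<lambda>_. copy_measure)"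

definition rand_measure :: "sample measure" where
  "rand_measure = PiM UNIV (\<lambda>_. level_measure)"

lemma prob_space_unif: "prob_space unif"
  unfolding unif_def by (rule prob_space_uniform_measure) auto

lemma prob_space_copy: "prob_space copy_measure"
  unfolding copy_measure_def by (intro prob_space_PiM prob_space_unif)

lemma prob_space_level: "prob_space level_measure"
  unfolding level_measure_def by (intro prob_space_PiM prob_space_copy)

lemma prob_space_rand: "prob_space rand_measure"
  unfolding rand_measure_def by (intro prob_space_PiM prob_space_level)

lemma sets_unif [measurable_cong, simp]: "sets unif = sets borel"
  by (simp add: unif_def)

lemma sets_copy [measurable_cong, simp]: "sets copy_measure = sets borel"
proof -
  have "sets copy_measure = sets (PiM UNIV (\<lambda>_::nat. borel :: real measure))"
    unfolding copy_measure_def by (intro sets_PiM_cong) auto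
  then show ?thesis by (simp add: sets_PiM_equal_borel)
qed

lemma sets_level [measurable_cong, simp]: "sets level_measure = sets borel"
proof -
  have "sets level_measure = sets (PiM UNIV (\<lambda>_::nat. borel :: (nat \<Rightarrow> real) measure))"
    unfolding level_measure_def by (intro sets_PiM_cong) auto
  then show ?thesis by (simp add: sets_PiM_equal_borel)
qed

lemma sets_rand [measurable_cong, simp]: "sets rand_measure = sets borel"
proof -
  have "sets rand_measure = sets (PiM UNIV (\<lambda>_::nat. borel :: (nat \<Rightarrow> nat \<Rightarrow> real) measure))"
    unfolding rand_measure_def by (intro sets_PiM_cong) auto
  then show ?thesis by (simp add: sets_PiM_equal_borel)
qed

lemma space_rand [simp]: "space rand_measure = UNIV"
  using sets_eq_imp_space_eq[OF sets_rand] by simp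

lemma space_level [simp]: "space level_measure = UNIV"
  using sets_eq_imp_space_eq[OF sets_level] by simp

lemma indep_vars_coordinates:
  assumes "prob_space N"
  shows "prob_space.indep_vars (PiM (UNIV :: nat set) (\<lambda>_. N)) (\<lambda>_. N) (\<lambda>i x. x i) UNIV"
proof -
  have p: "prob_space (PiM (UNIV :: nat set) (\<lambda>_. N))" by (intro prob_space_PiM assms)
  have "distr (PiM UNIV (\<lambda>_. N)) (PiM UNIV (\<lambda>_. N)) (\<lambda>x. \<lambda>i\<in>UNIV. x i) = PiM (UNIV :: nat set) (\<lambda>_. N)"
    by (simp add: restrict_UNIV)
  moreover have "distr (PiM UNIV (\<lambda>_. N)) N (\<lambda>x. x i) = N" for i :: nat
    by (rule distr_PiM_component) (auto intro: assms)
  ultimately show ?thesis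
    by (subst prob_space.indep_vars_iff_distr_eq_PiM[OF p]) auto
qed

lemma norm_char_unif_le:
  assumes "\<xi> \<noteq> 0"
  shows "norm (\<integral>z. cis (- (\<xi> * clip z)) \<partial>unif) \<le> 2 / \<bar>\<xi>\<bar>"
proof -
  \<comment> \<open>An antiderivative of the integrand on [0, 1], of modulus 1/|\<xi>| everywhere;
    the two endpoints give the constant 2.\<close>
  define F where "F z = \<i> / of_real \<xi> * cis (- (\<xi> * z))" for z
  have m: "(\<lambda>z. cis (- (\<xi> * clip z))) \<in> borel_measurable borel"
    unfolding clip_def by measurable
  have unif_eq: "unif = density lborel (\<lambda>x. ennreal (indicator {0..1} x))"
    by (simp add: unif_def uniform_measure_def ennreal_indicator divide_ennreal_def)
  have "(\<integral>z. cis (- (\<xi> * clip z)) \<partial>unif) = (\<integral>z. indicator {0..1} z *\<^sub>R cis (- (\<xi> * clip z)) \<partial>lborel)"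
    unfolding unif_eq by (subst integral_density) (use m in auto)
  also have "\<dots> = (\<integral>z. indicator {0..1} z *\<^sub>R cis (- (\<xi> * z)) \<partial>lborel)"
    by (intro Bochner_Integration.integral_cong refl) (auto simp: indicator_def clip_def)
  also have "\<dots> = F 1 - F 0"
  proof (rule integral_FTC_Icc)
    show "(F has_vector_derivative cis (- (\<xi> * z))) (at z within {0..1})" for z
    proof -
      have "((\<lambda>z. cis (- (\<xi> * z))) has_vector_derivative (- \<xi>) *\<^sub>R (\<i> * cis (- (\<xi> * z)))) (at z within {0..1})"
        unfolding cis_conv_exp
        by (auto intro!: derivative_eq_intros has_vector_derivative_real_field simp: scaleR_conv_of_real)
      then have "((\<lambda>z. \<i> / of_real \<xi> * cis (- (\<xi> * z))) has_vector_derivative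
          \<i> / of_real \<xi> * ((- \<xi>) *\<^sub>R (\<i> * cis (- (\<xi> * z))))) (at z within {0..1})"
        by (rule has_vector_derivative_mult_right)
      then show ?thesis
        using assms by (simp add: F_def [abs_def] scaleR_conv_of_real)
    qed
    show "continuous_on {0..1} (\<lambda>z. cis (- (\<xi> * z)))" by (intro continuous_intros)
  qed simp
  finally have "norm (\<integral>z. cis (- (\<xi> * clip z)) \<partial>unif) \<le> norm (F 1) + norm (F 0)"
    by (simp add: norm_triangle_ineq4)
  then show ?thesis by (simp add: F_def norm_mult norm_divide)
qed

lemma norm_char_copies_le:
  assumes "\<xi> \<noteq> 0"
  shows "norm (\<integral>z. cis (- (\<xi> * (\<Sum>i<m. clip (z i)))) \<partial>copy_measure) \<le> (2 / \<bar>\<xi>\<bar>) ^ m"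
proof -
  interpret prob_space copy_measure by (rule prob_space_copy)
  have iv: "indep_vars (\<lambda>_. unif) (\<lambda>i x. x i) UNIV"
    using indep_vars_coordinates[OF prob_space_unif] by (simp add: copy_measure_def)
  have mc: "(\<lambda>t. cis (- (\<xi> * clip t))) \<in> borel_measurable unif"
    unfolding clip_def by measurable
  have "indep_vars (\<lambda>_. borel) (\<lambda>i x. cis (- (\<xi> * clip (x i)))) UNIV"
    by (rule indep_vars_compose2[OF iv mc])
  then have iv': "indep_vars (\<lambda>_. borel) (\<lambda>i x. cis (- (\<xi> * clip (x i)))) {..<m}"
    by (rule indep_vars_subset) simp
  have rv: "(\<lambda>x. cis (- (\<xi> * clip (x i)))) \<in> borel_measurable copy_measure" for i
    using iv' by (metis (no_types, lifting) \<open>indep_vars (\<lambda>_. borel) (\<lambda>i x. cis (- (\<xi> * clip (x i)))) UNIV\<close> UNIV_I indep_vars_def)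
  have prod: "cis (- (\<xi> * (\<Sum>i<m. clip (z i)))) = (\<Prod>i<m. cis (- (\<xi> * clip (z i))))" for z
  proof (induction m)
    case (Suc m)
    have "- (\<xi> * (\<Sum>i<Suc m. clip (z i))) = - (\<xi> * (\<Sum>i<m. clip (z i))) + - (\<xi> * clip (z m))"
      by (simp add: distrib_left)
    then show ?case by (simp only: prod.lessThan_Suc cis_mult[symmetric] Suc)
  qed simp
  have int: "integrable copy_measure (\<lambda>x. cis (- (\<xi> * clip (x i))))" for i
    by (rule integrable_const_bound[of _ 1]) (use rv in auto)
  have comp: "(\<integral>z. cis (- (\<xi> * clip (z i))) \<partial>copy_measure) = (\<integral>t. cis (- (\<xi> * clip t)) \<partial>unif)" for i
  proof -
    have d: "distr copy_measure unif (\<lambda>x. x i) = unif"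
      unfolding copy_measure_def by (rule distr_PiM_component) (auto intro: prob_space_unif)
    have "(\<integral>t. cis (- (\<xi> * clip t)) \<partial>distr copy_measure unif (\<lambda>x. x i)) = (\<integral>z. cis (- (\<xi> * clip (z i))) \<partial>copy_measure)"
      by (rule integral_distr) (use mc in \<open>auto simp: copy_measure_def\<close>)
    then show ?thesis by (simp add: d)
  qed
  have "(\<integral>z. cis (- (\<xi> * (\<Sum>i<m. clip (z i)))) \<partial>copy_measure)
      = (\<Prod>i<m. \<integral>z. cis (- (\<xi> * clip (z i))) \<partial>copy_measure)"
    unfolding prod by (rule indep_vars_lebesgue_integral[OF _ iv' int]) simp
  then have "norm (\<integral>z. cis (- (\<xi> * (\<Sum>i<m. clip (z i)))) \<partial>copy_measure)
      = norm (\<integral>t. cis (- (\<xi> * clip t)) \<partial>unif) ^ m"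
    by (simp add: comp norm_power)
  also have "\<dots> \<le> (2 / \<bar>\<xi>\<bar>) ^ m"
    by (intro power_mono norm_char_unif_le assms) simp
  finally show ?thesis .
qed

text \<open>Real and imaginary parts lie in [-c, c] and are treated separately: each contributes one
  \<epsilon> to the threshold and one two-sided bound to the factor 4, while \<delta> pays for the
  mean of the sum.\<close>

lemma complex_hoeffding:
  fixes X :: "'i \<Rightarrow> 'a \<Rightarrow> complex" and c \<delta> \<epsilon> :: real
  assumes M: "prob_space M" and iv: "prob_space.indep_vars M (\<lambda>_. borel) X I" and I: "finite I" "I \<noteq> {}"
    and c: "0 < c" "\<And>k x. k \<in> I \<Longrightarrow> norm (X k x) \<le> c"
    and \<delta>: "norm (\<Sum>k\<in>I. \<integral>x. X k x \<partial>M) \<le> \<delta>" and \<epsilon>: "0 < \<epsilon>"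
  shows "measure M {x \<in> space M. 2 * \<epsilon> + \<delta> \<le> norm (\<Sum>k\<in>I. X k x)} \<le> 4 * exp (- (\<epsilon>\<^sup>2 / (2 * card I * c\<^sup>2)))"
proof -
  interpret prob_space M by fact
  have rv: "X k \<in> borel_measurable M" if "k \<in> I" for k
    using iv that by (simp add: indep_vars_def)
  have ivR: "indep_vars (\<lambda>_. borel) (\<lambda>k x. Re (X k x)) I"
    by (rule indep_vars_compose2[OF iv]) simp
  have ivI: "indep_vars (\<lambda>_. borel) (\<lambda>k x. Im (X k x)) I"
    by (rule indep_vars_compose2[OF iv]) simp
  have R: "Hoeffding_ineq M I (\<lambda>k x. Re (X k x)) (\<lambda>_. - c) (\<lambda>_. c)"
    unfolding Hoeffding_ineq_def indep_interval_bounded_random_variables_def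
      indep_interval_bounded_random_variables_axioms_def
    using M I ivR order_trans[OF abs_Re_le_cmod c(2)] by (auto simp: abs_le_iff minus_le_iff)
  have Im: "Hoeffding_ineq M I (\<lambda>k x. Im (X k x)) (\<lambda>_. - c) (\<lambda>_. c)"
    unfolding Hoeffding_ineq_def indep_interval_bounded_random_variables_def
      indep_interval_bounded_random_variables_axioms_def
    using M I ivI order_trans[OF abs_Im_le_cmod c(2)] by (auto simp: abs_le_iff minus_le_iff)
  have card: "0 < card I" using I by (simp add: card_gt_0_iff)
  have tot: "(\<Sum>k\<in>I. (c - - c)\<^sup>2) = 4 * (card I * c\<^sup>2)"
    by (simp add: power2_eq_square)
  have pos: "0 < (\<Sum>k\<in>I. (c - - c)\<^sup>2)" unfolding tot using card c by simp
  have ex: "- 2 * \<epsilon>\<^sup>2 / (\<Sum>k\<in>I. (c - - c)\<^sup>2) = - (\<epsilon>\<^sup>2 / (2 * card I * c\<^sup>2))"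
    unfolding tot using card c by (simp add: field_simps)
  define ER where "ER = (\<Sum>k\<in>I. expectation (\<lambda>x. Re (X k x)))"
  define EI where "EI = (\<Sum>k\<in>I. expectation (\<lambda>x. Im (X k x)))"
  define SR where "SR = {x \<in> space M. \<epsilon> \<le> \<bar>(\<Sum>k\<in>I. Re (X k x)) - ER\<bar>}"
  define SI where "SI = {x \<in> space M. \<epsilon> \<le> \<bar>(\<Sum>k\<in>I. Im (X k x)) - EI\<bar>}"
  have SR: "measure M SR \<le> 2 * exp (- (\<epsilon>\<^sup>2 / (2 * card I * c\<^sup>2)))"
    using Hoeffding_ineq.Hoeffding_ineq_abs_ge[OF R _ pos, of \<epsilon>] \<epsilon> unfolding ex by (simp add: SR_def ER_def)
  have SI: "measure M SI \<le> 2 * exp (- (\<epsilon>\<^sup>2 / (2 * card I * c\<^sup>2)))"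
    using Hoeffding_ineq.Hoeffding_ineq_abs_ge[OF Im _ pos, of \<epsilon>] \<epsilon> unfolding ex by (simp add: SI_def EI_def)
  have int: "integrable M (X k)" if "k \<in> I" for k
    by (rule integrable_const_bound[of _ c]) (use rv c that in auto)
  have E: "(\<Sum>k\<in>I. expectation (X k)) = Complex ER EI"
    using int by (simp add: complex_eq_iff ER_def EI_def)
  have meas: "SR \<in> events" "SI \<in> events"
    unfolding SR_def SI_def using rv by measurable
  have "{x \<in> space M. 2 * \<epsilon> + \<delta> \<le> norm (\<Sum>k\<in>I. X k x)} \<subseteq> SR \<union> SI"
  proof (rule subsetI, rule ccontr)
    fix x assume *: "x \<in> {x \<in> space M. 2 * \<epsilon> + \<delta> \<le> norm (\<Sum>k\<in>I. X k x)}" "x \<notin> SR \<union> SI"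
    have x: "2 * \<epsilon> + \<delta> \<le> norm (\<Sum>k\<in>I. X k x)"
      "\<bar>(\<Sum>k\<in>I. Re (X k x)) - ER\<bar> < \<epsilon>" "\<bar>(\<Sum>k\<in>I. Im (X k x)) - EI\<bar> < \<epsilon>"
      using * unfolding SR_def SI_def by simp_all
    have "norm ((\<Sum>k\<in>I. X k x) - Complex ER EI) < 2 * \<epsilon>"
      using cmod_le[of "(\<Sum>k\<in>I. X k x) - Complex ER EI"] x(2,3) by simp
    moreover have "norm (\<Sum>k\<in>I. X k x) \<le> norm ((\<Sum>k\<in>I. X k x) - Complex ER EI) + norm (Complex ER EI)"
      using norm_triangle_sub[of "\<Sum>k\<in>I. X k x" "Complex ER EI"] by (simp add: add.commute)
    moreover have "norm (Complex ER EI) \<le> \<delta>" using \<delta> by (simp only: E)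
    ultimately show False using x(1) by linarith
  qed
  then have "measure M {x \<in> space M. 2 * \<epsilon> + \<delta> \<le> norm (\<Sum>k\<in>I. X k x)} \<le> measure M (SR \<union> SI)"
    using meas by (intro finite_measure_mono) auto
  also have "\<dots> \<le> measure M SR + measure M SI"
    by (rule measure_Un_le[OF meas])
  finally show ?thesis using SR SI by linarith
qed

lemma integral_cell_le: "(TINT x. indicator {x. cell m x = k} x) \<le> 2 * pi / 2 ^ m"
proof -
  define a where "a = 2 * pi / 2 ^ m * real k"
  define b where "b = 2 * pi / 2 ^ m * (real k + 1)"
  have [measurable]: "{x. cell m x = k} \<in> sets borel"
    using measurable_sets[OF measurable_cell, of "{k}" m] by (simp add: vimage_def)
  \<comment> \<open>The right endpoint wraps around to cell 0 and would lie outside the interval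
    from a to b.\<close>
  have "AE x in lborel. x \<noteq> 2 * pi" by (rule AE_lborel_singleton)
  then have ae: "AE x in torus_measure. x \<noteq> 2 * pi" by (rule AE_torus)
  have "(TINT x. indicator {x. cell m x = k} x) \<le> (TINT x. indicator {a..b} x :: real)"
  proof (rule integral_mono_AE)
    have "AE x in torus_measure. x \<in> {0..2 * pi}" by (rule AE_I2) simp
    with ae show "AE x in torus_measure. (indicator {x. cell m x = k} x :: real) \<le> indicator {a..b} x"
    proof eventually_elim
      case (elim x)
      show ?case
      proof (cases "cell m x = k")
        case True
        have x: "0 \<le> x" "x < 2 * pi" using elim by auto
        have n: "0 \<le> 2 ^ m * x / (2 * pi)" "2 ^ m * x / (2 * pi) < 2 ^ m"
          using x by (auto simp: field_simps)
        have "0 \<le> grid_index m x" unfolding grid_index_def using n by simp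
        moreover have "grid_index m x < 2 ^ m"
          unfolding grid_index_def floor_less_iff using n by simp
        ultimately have "int k = grid_index m x" using True by (simp add: cell_def)
        then have "real k = of_int \<lfloor>2 ^ m * x / (2 * pi)\<rfloor>"
          unfolding grid_index_def by (metis of_int_of_nat_eq)
        then have "real k \<le> 2 ^ m * x / (2 * pi)" "2 ^ m * x / (2 * pi) \<le> real k + 1" by linarith+
        then have "x \<in> {a..b}" by (simp add: a_def b_def field_simps)
        then show ?thesis by simp
      qed simp
    qed
  qed (auto intro!: torus.integrable_const_bound[of _ 1] borel_measurable_torus)
  also have "\<dots> \<le> b - a"
  proof -
    have ab: "a \<le> b" unfolding a_def b_def by (intro mult_left_mono) auto
    have "(TINT x. indicator {a..b} x :: real) = (\<integral>x. indicator {0..2 * pi} x * indicator {a..b} x \<partial>lborel)"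
      by (simp only: set_lebesgue_integral_def real_scaleR_def LBINT_torus[symmetric])
    also have "\<dots> \<le> (\<integral>x. indicator {a..b} x \<partial>lborel)"
    proof (rule integral_mono)
      show ii: "integrable lborel (indicator {a..b} :: real \<Rightarrow> real)"
        by (rule integrable_real_indicator) (use ab in auto)
      from integrable_real_mult_indicator[OF _ ii, of "{0..2 * pi}"]
      show "integrable lborel (\<lambda>x. indicator {0..2 * pi} x * indicator {a..b} x :: real)"
        by (simp add: mult.commute)
    qed (auto split: split_indicator)
    also have "\<dots> = b - a" using ab by simp
    finally show ?thesis .
  qed
  also have "b - a = 2 * pi / 2 ^ m" by (simp add: a_def b_def field_simps)
  finally show ?thesis .
qed

section \<open>Resampling a single level\<close>

context
  fixes \<alpha> :: real and v :: "real \<Rightarrow> real"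
  assumes \<alpha>: "0 < \<alpha>" "\<alpha> < 1" and v: "torus_integrable v"
begin

abbreviation rcf :: "real \<Rightarrow> int \<Rightarrow> sample \<Rightarrow> complex" where
  "rcf \<tau> n \<omega> \<equiv> fcoef (phase \<tau> (\<lambda>x. rfun \<alpha> \<omega> x - v x)) n"

lemma rfun_update:
  "rfun \<alpha> (Z(m := y)) x = rfun \<alpha> (Z(m := \<lambda>_ _. 0)) x + amp \<alpha> m * (\<Sum>i<m. clip (y (cell m x) i))"
proof -
  let ?d = "\<lambda>j k. rcoef \<alpha> (Z(m := y)) j k - rcoef \<alpha> (Z(m := \<lambda>_ _. 0)) j k"
  have "rfun \<alpha> (Z(m := y)) x - rfun \<alpha> (Z(m := \<lambda>_ _. 0)) x = (\<Sum>j. ?d j (cell j x))"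
    unfolding rfun_diff[OF \<alpha>] step_series_def ..
  also have "\<dots> = (\<Sum>j\<in>{m}. ?d j (cell j x))"
    by (rule suminf_finite) (auto simp: rcoef_def)
  also have "\<dots> = amp \<alpha> m * (\<Sum>i<m. clip (y (cell m x) i))"
    by (simp add: rcoef_def clip_def)
  finally show ?thesis by simp
qed

text \<open>On each cell of level m the new coefficient is constant, so the phase splits into that
  constant's phase and the phase of V, which collects all other levels and the translation.
  \<open>A k\<close> is the coefficient of the latter restricted to cell k: it does not depend on y,
  and its size is at most the relative length of the cell.\<close>

lemma rcf_update:
  obtains A :: "nat \<Rightarrow> complex" where "\<And>k. norm (A k) \<le> 1 / 2 ^ m"
    "\<And>y. rcf \<tau> n (Z(m := y)) = (\<Sum>k<2 ^ m. A k * cis (- (\<tau> * amp \<alpha> m * (\<Sum>i<m. clip (y k i)))))"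
proof -
  define V where "V x = rfun \<alpha> (Z(m := \<lambda>_ _. 0)) x - v x" for x
  define g where "g k x = of_real (indicator {x. cell m x = k} x) * phase \<tau> V x" for k x
  define \<xi> where "\<xi> y k = cis (- (\<tau> * amp \<alpha> m * (\<Sum>i<m. clip (y k i))))" for y :: "nat \<Rightarrow> nat \<Rightarrow> real" and k
  have V: "torus_integrable V"
    unfolding V_def [abs_def] by (intro torus_integrable_diff torus_integrable_rfun \<alpha> v)
  have ms: "{x. cell m x = k} \<in> sets borel" for k
    using measurable_sets[OF measurable_cell, of "{k}" m] by (simp add: vimage_def)
  have mi: "(\<lambda>x. complex_of_real (indicator {x. cell m x = k} x)) \<in> borel_measurable borel" for k
    using ms by simp
  have gi: "torus_integrable (g k)" for k
    unfolding g_def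
    by (rule torus_integrable_bounded_mult[of _ 1, OF mi _ _ torus_integrable_phase[OF V]])
       (auto simp: indicator_def cell_period)
  have gb: "norm (fcoef (g k) n) \<le> 1 / 2 ^ m" for k
  proof -
    have "norm (fcoef (g k) n) \<le> (TINT x. norm (g k x)) / (2 * pi)"
      by (rule fcoef_bound[OF gi])
    also have "(TINT x. norm (g k x)) = (TINT x. indicator {x. cell m x = k} x)"
      by (simp add: g_def norm_mult)
    also have "\<dots> / (2 * pi) \<le> (2 * pi / 2 ^ m) / (2 * pi)"
      by (intro divide_right_mono integral_cell_le) auto
    finally show ?thesis by simp
  qed
  have "rcf \<tau> n (Z(m := y)) = (\<Sum>k<2 ^ m. fcoef (g k) n * \<xi> y k)" for y
  proof -
    have "phase \<tau> (\<lambda>x. rfun \<alpha> (Z(m := y)) x - v x) x = (\<Sum>k<2 ^ m. \<xi> y k * g k x)" for x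
    proof -
      have "(\<Sum>k<2 ^ m. \<xi> y k * g k x) = (\<Sum>k<2 ^ m. if k = cell m x then \<xi> y k * phase \<tau> V x else 0)"
        by (intro sum.cong) (auto simp: g_def)
      also have "\<dots> = \<xi> y (cell m x) * phase \<tau> V x" using cell_less by simp
      also have "\<dots> = cis (- (\<tau> * amp \<alpha> m * (\<Sum>i<m. clip (y (cell m x) i))) + - (\<tau> * V x))"
        by (simp only: \<xi>_def phase_def cis_mult)
      also have "- (\<tau> * amp \<alpha> m * (\<Sum>i<m. clip (y (cell m x) i))) + - (\<tau> * V x)
          = - (\<tau> * (rfun \<alpha> (Z(m := y)) x - v x))"
        unfolding rfun_update[of Z m y x] V_def by (simp add: algebra_simps)
      finally show ?thesis by (simp add: phase_def)
    qed
    then have "phase \<tau> (\<lambda>x. rfun \<alpha> (Z(m := y)) x - v x) = (\<lambda>x. \<Sum>k<2 ^ m. \<xi> y k * g k x)"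
      by (rule ext)
    then have "rcf \<tau> n (Z(m := y)) = fcoef (\<lambda>x. \<Sum>k<2 ^ m. \<xi> y k * g k x) n"
      by (rule arg_cong[where f = "\<lambda>h. fcoef h n"])
    also have "\<dots> = (\<Sum>k<2 ^ m. fcoef (\<lambda>x. \<xi> y k * g k x) n)"
    proof (rule fcoef_sum)
      show "torus_integrable (\<lambda>x. \<xi> y k * g k x)" for k
        by (rule torus_integrable_bounded_mult[of "\<lambda>_. \<xi> y k" "norm (\<xi> y k)"]) (auto intro: gi)
    qed simp
    finally show ?thesis by (simp add: fcoef_cmult mult.commute)
  qed
  then show ?thesis by (intro that[of "\<lambda>k. fcoef (g k) n"] gb) (simp only: \<xi>_def)
qed

text \<open>Hoeffding's inequality with \<open>2 ^ m\<close> terms of size \<open>1 / 2 ^ m\<close>.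
  Each mean carries the characteristic function of m copies at
  \<open>\<tau> * amp \<alpha> m\<close>, and the weights \<open>A k\<close> sum to at most 1 in
  modulus, so the mean of the sum obeys the same bound as a single characteristic function.\<close>

lemma prob_level_le:
  assumes \<tau>: "\<tau> \<noteq> 0" and \<epsilon>: "0 < \<epsilon>"
  shows "measure level_measure {y. 2 * \<epsilon> + (2 / (\<bar>\<tau>\<bar> * amp \<alpha> m)) ^ m \<le> norm (rcf \<tau> n (Z(m := y)))}
     \<le> 4 * exp (- (\<epsilon>\<^sup>2 * 2 ^ m / 2))"
proof -
  interpret L: prob_space level_measure by (rule prob_space_level)
  interpret C: prob_space copy_measure by (rule prob_space_copy)
  obtain A where A: "\<And>k. norm (A k) \<le> 1 / 2 ^ m"
    "\<And>y. rcf \<tau> n (Z(m := y)) = (\<Sum>k<2 ^ m. A k * cis (- (\<tau> * amp \<alpha> m * (\<Sum>i<m. clip (y k i)))))"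
    using rcf_update[where m = m and \<tau> = \<tau> and n = n and Z = Z] by blast
  define \<phi> where "\<phi> z = cis (- (\<tau> * amp \<alpha> m * (\<Sum>i<m. clip (z i))))" for z :: "nat \<Rightarrow> real"
  define \<delta> where "\<delta> = (2 / (\<bar>\<tau>\<bar> * amp \<alpha> m)) ^ m"
  have ap: "0 < amp \<alpha> m" by (rule amp_pos)
  have "continuous_on UNIV (\<lambda>z::nat \<Rightarrow> real. z i)" for i by (rule continuous_on_product_coordinates)
  then have "continuous_on UNIV \<phi>"
    unfolding \<phi>_def clip_def
    by (intro continuous_on_cis continuous_on_minus continuous_on_mult continuous_on_const continuous_on_sum
        continuous_on_max continuous_on_min)
  then have m\<phi>: "\<phi> \<in> borel_measurable borel" by (rule borel_measurable_continuous_onI)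
  then have m\<phi>': "\<phi> \<in> borel_measurable copy_measure" by simp
  have iv: "L.indep_vars (\<lambda>_. copy_measure) (\<lambda>k y. y k) UNIV"
    using indep_vars_coordinates[OF prob_space_copy] by (simp add: level_measure_def)
  have iv': "L.indep_vars (\<lambda>_. borel) (\<lambda>k y. A k * \<phi> (y k)) {..<2 ^ m}"
    by (rule L.indep_vars_subset[OF L.indep_vars_compose2[OF iv, of "\<lambda>k z. A k * \<phi> z"]]) (use m\<phi>' in auto)
  have mean: "norm (\<integral>y. A k * \<phi> (y k) \<partial>level_measure) \<le> 1 / 2 ^ m * \<delta>" for k
  proof -
    have d: "distr level_measure copy_measure (\<lambda>y. y k) = copy_measure"
      unfolding level_measure_def by (rule distr_PiM_component) (auto intro: prob_space_copy)
    have "(\<integral>z. \<phi> z \<partial>distr level_measure copy_measure (\<lambda>y. y k)) = (\<integral>y. \<phi> (y k) \<partial>level_measure)"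
      by (rule integral_distr) (use m\<phi>' in \<open>auto simp: level_measure_def\<close>)
    then have "norm (\<integral>y. \<phi> (y k) \<partial>level_measure) \<le> \<delta>"
      using norm_char_copies_le[of "\<tau> * amp \<alpha> m" m] \<tau> ap
      unfolding d \<phi>_def \<delta>_def by (simp add: abs_mult)
    then show ?thesis
      using mult_mono[OF A(1)[of k], of "norm (\<integral>y. \<phi> (y k) \<partial>level_measure)" \<delta>] by (simp add: norm_mult)
  qed
  have "norm (\<Sum>k<2 ^ m. \<integral>y. A k * \<phi> (y k) \<partial>level_measure) \<le> (\<Sum>k<(2::nat) ^ m. 1 / 2 ^ m * \<delta>)"
    by (rule sum_norm_le) (rule mean)
  then have mean': "norm (\<Sum>k\<in>{..<2 ^ m}. \<integral>y. A k * \<phi> (y k) \<partial>level_measure) \<le> \<delta>" by simp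
  have "measure level_measure {y \<in> space level_measure. 2 * \<epsilon> + \<delta> \<le> norm (\<Sum>k\<in>{..<2 ^ m}. A k * \<phi> (y k))}
     \<le> 4 * exp (- (\<epsilon>\<^sup>2 / (2 * card {..<(2::nat) ^ m} * (1 / 2 ^ m)\<^sup>2)))"
  proof (rule complex_hoeffding[OF prob_space_level iv' _ _ _ _ mean' \<epsilon>])
    show "norm (A k * \<phi> (y k)) \<le> 1 / 2 ^ m" for k y
      using A(1)[of k] by (simp add: norm_mult \<phi>_def)
  qed (auto simp: lessThan_empty_iff)
  also have "\<epsilon>\<^sup>2 / (2 * card {..<(2::nat) ^ m} * (1 / 2 ^ m)\<^sup>2) = \<epsilon>\<^sup>2 * 2 ^ m / 2"
    by (simp add: power2_eq_square field_simps)
  finally show ?thesis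
    unfolding A(2) by (simp add: \<phi>_def \<delta>_def)
qed

lemma measurable_rcf [measurable]: "rcf \<tau> n \<in> borel_measurable borel"
  by (rule borel_measurable_continuous_onI[OF continuous_fcoef_rfun[OF \<alpha> v]])

text \<open>Splits off level m as an independent factor; the bound of \<open>prob_level_le\<close>
  is uniform in the other levels Z and integrates over them.\<close>

lemma prob_rand_le:
  assumes \<tau>: "\<tau> \<noteq> 0" and \<epsilon>: "0 < \<epsilon>"
  shows "measure rand_measure {\<omega>. 2 * \<epsilon> + (2 / (\<bar>\<tau>\<bar> * amp \<alpha> m)) ^ m \<le> norm (rcf \<tau> n \<omega>)}
     \<le> 4 * exp (- (\<epsilon>\<^sup>2 * 2 ^ m / 2))"
proof -
  interpret R: prob_space rand_measure by (rule prob_space_rand)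
  define N where "N = PiM (UNIV - {m}) (\<lambda>_. level_measure)"
  define E where "E = {\<omega>. 2 * \<epsilon> + (2 / (\<bar>\<tau>\<bar> * amp \<alpha> m)) ^ m \<le> norm (rcf \<tau> n \<omega>)}"
  interpret L: prob_space level_measure by (rule prob_space_level)
  interpret N: prob_space N unfolding N_def by (intro prob_space_PiM prob_space_level)
  interpret P: pair_prob_space level_measure N ..
  have E: "E \<in> sets rand_measure" unfolding E_def by simp
  have d: "distr (level_measure \<Otimes>\<^sub>M N) rand_measure (\<lambda>(y, Z). Z(m := y)) = rand_measure"
    using distr_pair_PiM_eq_PiM[of "UNIV - {m}" "\<lambda>_. level_measure" m] prob_space_level
    by (simp add: N_def rand_measure_def insert_UNIV insert_Diff_if)
  have f: "(\<lambda>(y, Z). Z(m := y)) \<in> level_measure \<Otimes>\<^sub>M N \<rightarrow>\<^sub>M rand_measure"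
  proof -
    have "(\<lambda>(Z, y). Z(m := y)) \<in> N \<Otimes>\<^sub>M level_measure \<rightarrow>\<^sub>M PiM (insert m (UNIV - {m})) (\<lambda>_. level_measure)"
      unfolding N_def by (rule measurable_add_dim)
    then have "(\<lambda>(Z, y). Z(m := y)) \<in> N \<Otimes>\<^sub>M level_measure \<rightarrow>\<^sub>M rand_measure"
      by (simp add: rand_measure_def insert_Diff_if)
    from measurable_pair_swap[OF this] show ?thesis by simp
  qed
  have "emeasure rand_measure E = emeasure (level_measure \<Otimes>\<^sub>M N) ((\<lambda>(y, Z). Z(m := y)) -` E \<inter> space (level_measure \<Otimes>\<^sub>M N))"
    by (subst d[symmetric], subst emeasure_distr[OF f E]) simp
  also have "\<dots> = (\<integral>\<^sup>+Z. emeasure level_measure ((\<lambda>y. (y, Z)) -` ((\<lambda>(y, Z). Z(m := y)) -` E \<inter> space (level_measure \<Otimes>\<^sub>M N))) \<partial>N)"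
    by (rule P.emeasure_pair_measure_alt2) (rule measurable_sets[OF f E])
  also have "\<dots> \<le> (\<integral>\<^sup>+Z. ennreal (4 * exp (- (\<epsilon>\<^sup>2 * 2 ^ m / 2))) \<partial>N)"
  proof (rule nn_integral_mono)
    fix Z assume Z: "Z \<in> space N"
    have "(\<lambda>y. (y, Z)) -` ((\<lambda>(y, Z). Z(m := y)) -` E \<inter> space (level_measure \<Otimes>\<^sub>M N))
        = {y. 2 * \<epsilon> + (2 / (\<bar>\<tau>\<bar> * amp \<alpha> m)) ^ m \<le> norm (rcf \<tau> n (Z(m := y)))}"
      using Z by (auto simp: E_def space_pair_measure)
    then show "emeasure level_measure ((\<lambda>y. (y, Z)) -` ((\<lambda>(y, Z). Z(m := y)) -` E \<inter> space (level_measure \<Otimes>\<^sub>M N)))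
        \<le> ennreal (4 * exp (- (\<epsilon>\<^sup>2 * 2 ^ m / 2)))"
      using prob_level_le[OF \<tau> \<epsilon>, where m = m and n = n and Z = Z] by (simp add: L.emeasure_eq_measure ennreal_leI)
  qed
  also have "\<dots> = ennreal (4 * exp (- (\<epsilon>\<^sup>2 * 2 ^ m / 2)))"
    by (simp add: N.emeasure_space_1)
  finally show ?thesis
    by (simp add: R.emeasure_eq_measure E_def ennreal_le_iff)
qed

end

section \<open>Decay uniform in the frequency and in the time parameter\<close>

text \<open>The level must be fine enough for strong concentration and coarse enough for
  \<open>s * amp \<alpha> m\<close> to stay large. Going short of the critical scale by
  \<open>s powr \<epsilon>\<close> keeps it above a positive power of s, and the m-th power of this
  small gain beats any fixed power of s because m grows like log s.\<close>

lemma level_choice: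
  fixes \<alpha> \<epsilon> :: real
  assumes \<alpha>: "0 < \<alpha>" "\<alpha> < 1" and \<epsilon>: "0 < \<epsilon>" "\<epsilon> \<le> 1"
  shows "eventually (\<lambda>s. \<exists>m::nat. s powr (1 / \<alpha> - \<epsilon>) / 2 \<le> 2 ^ m \<and>
     (2 / (s * amp \<alpha> m)) ^ m \<le> s powr (\<epsilon> - 1 / (2 * \<alpha>)) / 2) at_top"
proof -
  define \<kappa> where "\<kappa> = 1 / \<alpha> - \<epsilon>"
  define a where "a = \<alpha> * \<epsilon>"
  \<comment> \<open>Beyond the target exponent, the extra 1 supplies the factor 1/2, since
    \<open>s powr (- 1) \<le> 1 / 2\<close> for s \<ge> 2.\<close>
  define c where "c = 1 + 1 / (2 * \<alpha>)"
  have "1 < 1 / \<alpha>" using \<alpha> by simp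
  then have \<kappa>: "0 < \<kappa>" using \<epsilon> by (simp add: \<kappa>_def)
  have a: "0 < a" using \<alpha> \<epsilon> by (simp add: a_def)
  have \<kappa>\<alpha>: "\<kappa> * \<alpha> = 1 - a" using \<alpha> by (simp add: \<kappa>_def a_def field_simps)
  have E1: "eventually (\<lambda>s::real. 2 \<le> s) at_top" by (rule eventually_ge_at_top)
  \<comment> \<open>Half of the gained power a absorbs the logarithmic factor that stems from the
    cube in \<open>amp\<close>.\<close>
  have E2: "eventually (\<lambda>s::real. 2 * (\<kappa> * log 2 s + 1) ^ 3 * s powr (- a) \<le> s powr (- (a / 2))) at_top"
    using \<kappa> a by real_asymp
  have E3: "eventually (\<lambda>s::real. c \<le> a / 2 * (\<kappa> * log 2 s - 1)) at_top"
    using \<kappa> a by real_asymp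
  show ?thesis
    using E1 E2 E3
  proof eventually_elim
    case (elim s)
    \<comment> \<open>The largest level with \<open>2 ^ m \<le> s powr \<kappa>\<close>; rounding
      down loses at most a factor 2.\<close>
    define m where "m = nat \<lfloor>\<kappa> * log 2 s\<rfloor>"
    have l0: "0 \<le> \<kappa> * log 2 s" using \<kappa> elim by simp
    have m: "real m \<le> \<kappa> * log 2 s" "\<kappa> * log 2 s - 1 \<le> real m"
      using l0 unfolding m_def by linarith+
    have slog: "2 powr (\<kappa> * log 2 s) = s powr \<kappa>"
      using elim by (simp add: powr_powr[symmetric] mult.commute[of \<kappa>])
    have "s powr \<kappa> / 2 = 2 powr (\<kappa> * log 2 s - 1)"
      by (simp add: powr_diff slog)
    also have "\<dots> \<le> 2 powr (real m)" using m by (intro powr_mono) auto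
    finally have 1: "s powr \<kappa> / 2 \<le> 2 ^ m" by (simp add: powr_realpow)
    have "2 powr (real m * \<alpha>) \<le> 2 powr (\<kappa> * log 2 s * \<alpha>)"
      using m \<alpha> by (intro powr_mono mult_right_mono) auto
    also have "\<dots> = (2 powr (\<kappa> * log 2 s)) powr \<alpha>" by (simp only: powr_powr)
    also have "\<dots> = s powr (1 - a)" by (simp only: slog powr_powr \<kappa>\<alpha>)
    finally have 2: "2 powr (real m * \<alpha>) \<le> s powr (1 - a)" .
    have "2 / (s * amp \<alpha> m) = 2 * (real m + 1) ^ 3 * 2 powr (real m * \<alpha>) / s"
      by (simp add: amp_def powr_minus field_simps)
    also have "\<dots> \<le> 2 * (\<kappa> * log 2 s + 1) ^ 3 * s powr (1 - a) / s"
      using m elim l0 by (intro divide_right_mono mult_mono 2 power_mono mult_nonneg_nonneg zero_le_power) auto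
    also have "\<dots> = 2 * (\<kappa> * log 2 s + 1) ^ 3 * s powr (- a)"
      using elim by (simp add: powr_diff powr_minus field_simps)
    also have "\<dots> \<le> s powr (- (a / 2))" by (rule elim(2))
    finally have "(2 / (s * amp \<alpha> m)) ^ m \<le> (s powr (- (a / 2))) ^ m"
      using elim amp_pos[of \<alpha> m] by (intro power_mono) auto
    also have "\<dots> = s powr (- (a / 2 * real m))"
      using elim by (simp add: powr_realpow[symmetric] powr_powr)
    also have "\<dots> \<le> s powr (- c)"
    proof (rule powr_mono)
      have "c \<le> a / 2 * (\<kappa> * log 2 s - 1)" by (rule elim(3))
      also have "\<dots> \<le> a / 2 * real m" using m a by (intro mult_left_mono) auto
      finally show "- (a / 2 * real m) \<le> - c" by simp
    qed (use elim in auto)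
    also have "\<dots> = s powr (- 1) * s powr (- 1 / (2 * \<alpha>))"
    proof -
      have "- c = - 1 + - 1 / (2 * \<alpha>)" by (simp add: c_def)
      then show ?thesis by (simp only: powr_add)
    qed
    also have "\<dots> \<le> (1 / 2) * s powr (\<epsilon> - 1 / (2 * \<alpha>))"
      using elim \<epsilon> by (intro mult_mono powr_mono) (auto simp: powr_minus_divide)
    finally have "(2 / (s * amp \<alpha> m)) ^ m \<le> s powr (\<epsilon> - 1 / (2 * \<alpha>)) / 2" by simp
    with 1 show ?case unfolding \<kappa>_def by blast
  qed
qed

context
  fixes \<alpha> \<epsilon> :: real and v :: "real \<Rightarrow> real"
  assumes \<alpha>: "0 < \<alpha>" "\<alpha> < 1" and \<epsilon>: "0 < \<epsilon>" "\<epsilon> \<le> 1" and v: "torus_integrable v"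
begin

text \<open>Half of the threshold t covers the mean, the other half is two deviations of t/4. The
  exponent is \<open>(t / 4)\<^sup>2 * 2 ^ m / 2\<close>, where t^2 times the lower bound for
  \<open>2 ^ m\<close> equals \<open>s powr \<epsilon> / 2\<close>; hence the 64.\<close>

lemma prob_threshold_le:
  "eventually (\<lambda>s. \<forall>\<tau> n. \<bar>\<tau>\<bar> = s \<longrightarrow> measure rand_measure {\<omega>. s powr (\<epsilon> - 1 / (2 * \<alpha>)) \<le> norm (rcf \<alpha> v \<tau> n \<omega>)}
     \<le> 4 * exp (- (s powr \<epsilon> / 64))) at_top"
  using level_choice[OF \<alpha> \<epsilon>] eventually_gt_at_top[of 0]
proof eventually_elim
  case (elim s)
  interpret R: prob_space rand_measure by (rule prob_space_rand)
  obtain m :: nat where m: "s powr (1 / \<alpha> - \<epsilon>) / 2 \<le> 2 ^ m"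
    "(2 / (s * amp \<alpha> m)) ^ m \<le> s powr (\<epsilon> - 1 / (2 * \<alpha>)) / 2"
    using elim by blast
  define t where "t = s powr (\<epsilon> - 1 / (2 * \<alpha>))"
  have t: "0 < t" using elim by (simp add: t_def)
  show ?case
  proof (intro allI impI)
    fix \<tau> n assume \<tau>: "\<bar>\<tau>\<bar> = s"
    have \<tau>0: "\<tau> \<noteq> 0" using \<tau> elim by auto
    have "measure rand_measure {\<omega>. t \<le> norm (rcf \<alpha> v \<tau> n \<omega>)}
       \<le> measure rand_measure {\<omega>. 2 * (t / 4) + (2 / (\<bar>\<tau>\<bar> * amp \<alpha> m)) ^ m \<le> norm (rcf \<alpha> v \<tau> n \<omega>)}"
    proof (rule R.finite_measure_mono)
      have "2 * (t / 4) + (2 / (\<bar>\<tau>\<bar> * amp \<alpha> m)) ^ m \<le> t" using m(2) \<tau> by (simp add: t_def)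
      then show "{\<omega>. t \<le> norm (rcf \<alpha> v \<tau> n \<omega>)} \<subseteq> {\<omega>. 2 * (t / 4) + (2 / (\<bar>\<tau>\<bar> * amp \<alpha> m)) ^ m \<le> norm (rcf \<alpha> v \<tau> n \<omega>)}"
        by auto
      have [measurable]: "rcf \<alpha> v \<tau> n \<in> borel_measurable borel" by (rule measurable_rcf[OF \<alpha> v])
      show "{\<omega>. 2 * (t / 4) + (2 / (\<bar>\<tau>\<bar> * amp \<alpha> m)) ^ m \<le> norm (rcf \<alpha> v \<tau> n \<omega>)} \<in> R.events" by simp
    qed
    also have "\<dots> \<le> 4 * exp (- ((t / 4)\<^sup>2 * 2 ^ m / 2))"
      by (rule prob_rand_le[OF \<alpha> v \<tau>0]) (use t in simp)
    also have "\<dots> \<le> 4 * exp (- (s powr \<epsilon> / 64))"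
    proof -
      have "s powr \<epsilon> = t\<^sup>2 * s powr (1 / \<alpha> - \<epsilon>)"
        using \<alpha> by (simp add: t_def power2_eq_square field_simps flip: powr_add)
      then have "s powr \<epsilon> / 64 = (t / 4)\<^sup>2 * (s powr (1 / \<alpha> - \<epsilon>) / 2) / 2"
        by (simp add: power_divide)
      also have "\<dots> \<le> (t / 4)\<^sup>2 * 2 ^ m / 2"
        by (intro divide_right_mono mult_left_mono m) auto
      finally show ?thesis by simp
    qed
    finally show "measure rand_measure {\<omega>. s powr (\<epsilon> - 1 / (2 * \<alpha>)) \<le> norm (rcf \<alpha> v \<tau> n \<omega>)}
     \<le> 4 * exp (- (s powr \<epsilon> / 64))" by (simp only: t_def)
  qed
qed

text \<open>The q-th grid point involves two signs and 2q + 1 frequencies, hence polynomially many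
  events, each of stretched-exponentially small probability. Larger R refines the grid without
  affecting summability.\<close>

lemma AE_grid:
  assumes R: "0 < (R::nat)"
  shows "AE \<omega> in rand_measure. eventually (\<lambda>q::nat. \<forall>\<tau> n. \<bar>\<tau>\<bar> = real q powr (1 / R) \<longrightarrow> \<bar>n\<bar> \<le> int q \<longrightarrow>
     norm (rcf \<alpha> v \<tau> n \<omega>) \<le> (real q powr (1 / R)) powr (\<epsilon> - 1 / (2 * \<alpha>))) sequentially"
proof -
  interpret R: prob_space rand_measure by (rule prob_space_rand)
  define s where "s q = real q powr (1 / R)" for q :: nat
  define e where "e = \<epsilon> - 1 / (2 * \<alpha>)"
  define B where "B q = (\<lambda>(\<sigma>, n). {\<omega>. s q powr e \<le> norm (rcf \<alpha> v (\<sigma> * s q) n \<omega>)})" for q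
  define I where "I q = {-1, 1 :: real} \<times> {- int q..int q}" for q
  define A where "A q = (\<Union>p\<in>I q. B q p)" for q
  have finI: "finite (I q)" for q by (simp add: I_def)
  have cardI: "card (I q) = 2 * (2 * q + 1)" for q
    by (simp add: I_def card_cartesian_product)
  have Bm: "B q p \<in> R.events" for q p
  proof -
    have [measurable]: "rcf \<alpha> v \<tau> n \<in> borel_measurable borel" for \<tau> n by (rule measurable_rcf[OF \<alpha> v])
    show ?thesis unfolding B_def by (cases p) simp
  qed
  have Am: "A q \<in> R.events" for q unfolding A_def using finI Bm by (intro sets.finite_UN) auto
  have slim: "filterlim s at_top sequentially"
    unfolding s_def [abs_def] using R by real_asymp
  have ev1: "eventually (\<lambda>q. \<forall>\<tau> n. \<bar>\<tau>\<bar> = s q \<longrightarrow> measure rand_measure {\<omega>. s q powr e \<le> norm (rcf \<alpha> v \<tau> n \<omega>)}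
     \<le> 4 * exp (- (s q powr \<epsilon> / 64))) sequentially"
    using eventually_compose_filterlim[OF prob_threshold_le slim] by (simp add: e_def)
  have ev2: "eventually (\<lambda>q::nat. (16 * real q + 8) * exp (- (real q powr (\<epsilon> / R) / 64)) \<le> real q powr (- 2)) sequentially"
  proof -
    have "0 < \<epsilon> / R" using \<epsilon> R by simp
    then show ?thesis by real_asymp
  qed
  have "summable (\<lambda>q. measure rand_measure (A q))"
  proof (rule summable_comparison_test_ev)
    show "summable (\<lambda>q. real q powr (- 2))" by (simp add: summable_real_powr_iff)
    show "eventually (\<lambda>q. norm (measure rand_measure (A q)) \<le> real q powr (- 2)) sequentially"
      using ev1 ev2
    proof eventually_elim
      case (elim q)
      have "measure rand_measure (A q) \<le> (\<Sum>p\<in>I q. measure rand_measure (B q p))"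
        unfolding A_def by (rule measure_UNION_le[OF finI]) (rule Bm)
      also have "\<dots> \<le> (\<Sum>p\<in>I q. 4 * exp (- (s q powr \<epsilon> / 64)))"
      proof (rule sum_mono)
        fix p assume "p \<in> I q"
        then have "\<bar>fst p * s q\<bar> = s q" by (auto simp: I_def s_def)
        then show "measure rand_measure (B q p) \<le> 4 * exp (- (s q powr \<epsilon> / 64))"
          using elim(1) by (simp add: B_def case_prod_beta)
      qed
      also have "\<dots> = (16 * real q + 8) * exp (- (real q powr (\<epsilon> / R) / 64))"
        by (simp add: cardI s_def powr_powr algebra_simps)
      finally show ?case using elim(2) by simp
    qed
  qed
  then have "AE \<omega> in rand_measure. eventually (\<lambda>q. \<omega> \<in> space rand_measure - A q) sequentially"
    by (intro borel_cantelli_AE1 Am) (auto simp: R.emeasure_eq_measure)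
  then show ?thesis
  proof eventually_elim
    case (elim \<omega>)
    then show ?case
    proof eventually_elim
      case (elim q)
      show ?case
      proof (intro allI impI)
        fix \<tau> n assume \<tau>: "\<bar>\<tau>\<bar> = real q powr (1 / real R)" and n: "\<bar>n\<bar> \<le> int q"
        define \<sigma> :: real where "\<sigma> = (if \<tau> < 0 then -1 else 1)"
        have "\<tau> = \<sigma> * s q" using \<tau> by (auto simp: \<sigma>_def s_def)
        moreover have "(\<sigma>, n) \<in> I q" using n by (auto simp: I_def \<sigma>_def)
        then have "\<omega> \<notin> B q (\<sigma>, n)" using elim by (auto simp: A_def)
        ultimately show "norm (rcf \<alpha> v \<tau> n \<omega>) \<le> (real q powr (1 / real R)) powr (\<epsilon> - 1 / (2 * \<alpha>))"
          by (simp add: B_def s_def e_def)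
      qed
    qed
  qed
qed

end

lemma norm_fcoef_phase_le_1:
  assumes "torus_integrable u"
  shows "norm (fcoef (phase \<tau> u) n) \<le> 1"
  using fcoef_bound[OF torus_integrable_phase[OF assms], of \<tau> n] by simp

text \<open>Frequencies above \<open>\<bar>\<tau>\<bar> ^ R\<close> are handled by the trivial bound, the others by comparison with
  the grid point just below \<open>\<bar>\<tau>\<bar>\<close>.\<close>

lemma phase_decay_of_grid:
  assumes u: "torus_integrable u" and \<alpha>: "0 < \<alpha>" and \<epsilon>: "0 < \<epsilon>"
    and R: "1 + 1 / (2 * \<alpha>) \<le> real R" "1 / (2 * \<alpha>) \<le> 2 * real R * \<epsilon>"
    and ev: "eventually (\<lambda>q::nat. \<forall>\<tau> n. \<bar>\<tau>\<bar> = real q powr (1 / R) \<longrightarrow> \<bar>n\<bar> \<le> int q \<longrightarrow>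
     norm (fcoef (phase \<tau> u) n) \<le> (real q powr (1 / R)) powr (\<epsilon> - 1 / (2 * \<alpha>))) sequentially"
  shows "\<exists>M. phase_decay \<alpha> \<epsilon> M u"
proof -
  obtain q0 where q0: "\<And>q \<tau> n. q0 \<le> q \<Longrightarrow> \<bar>\<tau>\<bar> = real q powr (1 / R) \<Longrightarrow> \<bar>n\<bar> \<le> int q \<Longrightarrow>
     norm (fcoef (phase \<tau> u) n) \<le> (real q powr (1 / R)) powr (\<epsilon> - 1 / (2 * \<alpha>))"
    using ev unfolding eventually_sequentially by blast
  define \<theta> where "\<theta> = 1 / (2 * \<alpha>)"
  define e where "e = \<epsilon> - 1 / (2 * \<alpha>)"
  define L where "L = (TINT x. \<bar>u x\<bar>) / (2 * pi)"
  \<comment> \<open>The summands pay, in order, for comparing t with a grid point no smaller than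
    t/2, for the Lipschitz dependence on \<tau>, for the finitely many initial grid points, and for
    M \<ge> 1 in the trivial bound.\<close>
  define M where "M = 2 powr \<theta> + L + (real q0 + 1) powr \<theta> + 1"
  have \<theta>: "0 < \<theta>" using \<alpha> by (simp add: \<theta>_def)
  have L0: "0 \<le> L" by (simp add: L_def)
  have M1: "1 \<le> M" "(real q0 + 1) powr \<theta> \<le> M" "2 powr \<theta> + L \<le> M"
    using L0 by (auto simp: M_def intro!: add_nonneg_nonneg)
  have R1: "1 \<le> real R" using R(1) \<theta> unfolding \<theta>_def by linarith
  have R0: "0 < R" using R1 by (cases R) auto
  have jb1: "1 \<le> jb n powr \<epsilon>" for n using \<epsilon> by (intro ge_one_powr_ge_zero) auto
  have "norm (fcoef (phase \<tau> u) n) \<le> M * \<bar>\<tau>\<bar> powr e * jb n powr \<epsilon>" if \<tau>: "1 \<le> \<bar>\<tau>\<bar>" for \<tau> n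
  proof -
    define t where "t = \<bar>\<tau>\<bar>"
    have t: "1 \<le> t" using \<tau> by (simp add: t_def)
    define q where "q = nat \<lfloor>t ^ R\<rfloor>"
    have tR: "1 \<le> t ^ R" using t by (rule one_le_power)
    then have "1 \<le> \<lfloor>t ^ R\<rfloor>" by simp
    then have q: "real q \<le> t ^ R" "t ^ R < real q + 1" "1 \<le> real q"
      unfolding q_def by linarith+
    have te: "t powr e = t powr \<epsilon> * t powr (- \<theta>)"
      by (simp add: e_def \<theta>_def flip: powr_add)
    have t\<epsilon>: "1 \<le> t powr \<epsilon>" using t \<epsilon> by (intro ge_one_powr_ge_zero) auto
    have t\<theta>: "t powr (- \<theta>) \<le> t powr e" using te t\<epsilon> by (simp add: mult_le_cancel_right1)
    consider "q < q0" | "int q < \<bar>n\<bar>" | "q0 \<le> q" "\<bar>n\<bar> \<le> int q" by linarith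
    then have "norm (fcoef (phase \<tau> u) n) \<le> M * t powr e * jb n powr \<epsilon>"
    proof cases
      case 1
      \<comment> \<open>Below the threshold q0 of the almost sure bound, t is bounded, and the
        trivial bound 1 fits under the constant M.\<close>
      have "t \<le> t ^ R" using t R0 by (intro self_le_power) auto
      then have "t \<le> real q0 + 1" using q 1 by linarith
      then have "t powr \<theta> \<le> (real q0 + 1) powr \<theta>" using t \<theta> by (intro powr_mono2) auto
      then have "t powr \<theta> \<le> M" using M1 by linarith
      then have "t powr \<theta> * t powr (- \<theta>) \<le> M * t powr e"
        using M1 t\<theta> by (intro mult_mono) auto
      moreover have "t powr \<theta> * t powr (- \<theta>) = 1" using t by (simp flip: powr_add)
      ultimately have "1 \<le> M * t powr e" by simp
      from mult_mono[OF this jb1[of n]] have "1 \<le> M * t powr e * jb n powr \<epsilon>" using M1 by simp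
      then show ?thesis using norm_fcoef_phase_le_1[OF u, of \<tau> n] by linarith
    next
      case 2
      then have "real q + 1 \<le> \<bar>real_of_int n\<bar>" by linarith
      then have "t ^ R \<le> \<bar>real_of_int n\<bar>" using q by linarith
      then have "(t ^ R)\<^sup>2 \<le> \<bar>real_of_int n\<bar>\<^sup>2" using tR by (intro power_mono) auto
      then have "(t ^ R)\<^sup>2 \<le> jb n" by simp
      then have "((t ^ R)\<^sup>2) powr \<epsilon> \<le> jb n powr \<epsilon>" using \<epsilon> by (intro powr_mono2) auto
      moreover have "((t ^ R)\<^sup>2) powr \<epsilon> = t powr (2 * real R * \<epsilon>)"
      proof -
        have "(t ^ R)\<^sup>2 = t powr (2 * real R)"
          using t powr_realpow[of t "R * 2"] by (simp add: power_mult[symmetric] mult.commute)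
        then show ?thesis by (simp only: powr_powr)
      qed
      moreover have "t powr \<theta> \<le> t powr (2 * real R * \<epsilon>)"
        using R(2) t by (intro powr_mono) (auto simp: \<theta>_def)
      ultimately have j: "t powr \<theta> \<le> jb n powr \<epsilon>" by linarith
      have "1 = t powr (- \<theta>) * t powr \<theta>" using t by (simp flip: powr_add)
      also have "\<dots> \<le> t powr e * jb n powr \<epsilon>" by (intro mult_mono t\<theta> j) auto
      also have "\<dots> \<le> M * (t powr e * jb n powr \<epsilon>)"
        using mult_right_mono[OF M1(1), of "t powr e * jb n powr \<epsilon>"] by simp
      finally have "1 \<le> M * t powr e * jb n powr \<epsilon>" by (simp only: mult.assoc)
      then show ?thesis using norm_fcoef_phase_le_1[OF u, of \<tau> n] by linarith
    next
      case 3
      define s where "s = real q powr (1 / real R)"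
      have s0: "0 < s" using q by (simp add: s_def)
      have sR: "s ^ R = real q"
        using q R0 s0 by (simp add: s_def powr_realpow[symmetric] powr_powr)
      have st: "s \<le> t"
        by (rule power_le_imp_le_base[of _ "R - 1"]) (use sR q R0 t in auto)
      have ts: "t / 2 \<le> s"
      proof -
        have "(t / 2) ^ R \<le> t ^ R / 2"
        proof -
          have "(2::real) ^ 1 \<le> 2 ^ R" using R0 by (intro power_increasing) auto
          then show ?thesis
            using tR divide_left_mono[of 2 "2 ^ R" "t ^ R"] by (simp add: power_divide)
        qed
        also have "\<dots> \<le> s ^ R" unfolding sR using q by linarith
        finally have "(t / 2) ^ Suc (R - 1) \<le> s ^ Suc (R - 1)" using R0 by simp
        then show ?thesis by (rule power_le_imp_le_base) (use s0 in simp)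
      qed
      \<comment> \<open>The R-th powers of t and s differ by at most 1, so t and s differ by at most
        \<open>1 / t ^ (R - 1)\<close>; the first lower bound on R turns this into the required
        power.\<close>
      have diff: "t - s \<le> t powr (- \<theta>)"
      proof -
        have Rs: "R = Suc (R - 1)" using R0 by simp
        have "s ^ R \<le> s * t ^ (R - 1)"
          using s0 st by (subst Rs, simp only: power_Suc) (intro mult_left_mono power_mono, auto)
        moreover have "t ^ R = t * t ^ (R - 1)" by (subst Rs) (simp only: power_Suc)
        ultimately have "(t - s) * t ^ (R - 1) \<le> t ^ R - s ^ R" by (simp add: algebra_simps)
        also have "\<dots> \<le> 1" using q sR by simp
        finally have "t - s \<le> 1 / t ^ (R - 1)" using t by (simp add: field_simps)
        also have "\<dots> = t powr (- real (R - 1))" using t by (simp add: powr_minus_divide powr_realpow)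
        also have "\<dots> \<le> t powr (- \<theta>)"
          using R(1) R0 t by (intro powr_mono) (auto simp: \<theta>_def of_nat_diff)
        finally show ?thesis .
      qed
      define \<sigma> where "\<sigma> = (if \<tau> < 0 then - s else s)"
      have \<sigma>: "\<bar>\<sigma>\<bar> = s" "\<bar>\<tau> - \<sigma>\<bar> = t - s" using s0 st by (auto simp: \<sigma>_def t_def)
      have "norm (fcoef (phase \<tau> u) n - fcoef (phase \<sigma> u) n) \<le> (t - s) * L"
      proof -
        have "norm (fcoef (phase \<tau> u) n - fcoef (phase \<sigma> u) n)
           \<le> (TINT x. \<bar>\<tau> * u x - \<sigma> * u x\<bar>) / (2 * pi)"
          by (rule fcoef_phase_diff_le[OF u u])
        also have "\<dots> = \<bar>\<tau> - \<sigma>\<bar> * L"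
          by (simp add: L_def abs_mult flip: left_diff_distrib)
        finally show ?thesis by (simp only: \<sigma>)
      qed
      also have "\<dots> \<le> t powr (- \<theta>) * L" by (intro mult_right_mono diff L0)
      also have "\<dots> \<le> t powr e * L" by (intro mult_right_mono t\<theta> L0)
      finally have 1: "norm (fcoef (phase \<tau> u) n - fcoef (phase \<sigma> u) n) \<le> t powr e * L" .
      have "norm (fcoef (phase \<sigma> u) n) \<le> s powr e"
        using q0[OF 3(1) _ 3(2), of \<sigma>] \<sigma> by (simp add: s_def e_def)
      \<comment> \<open>The exponent e may have either sign, so its two parts are compared
        separately: s \<le> t for the first factor, s \<ge> t/2 for the second.\<close>
      also have "\<dots> = s powr \<epsilon> * s powr (- \<theta>)" by (simp add: e_def \<theta>_def flip: powr_add)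
      also have "\<dots> \<le> t powr \<epsilon> * (t / 2) powr (- \<theta>)"
        using s0 st ts t \<epsilon> \<theta> by (intro mult_mono powr_mono2 powr_mono2') auto
      also have "(t / 2) powr (- \<theta>) = 2 powr \<theta> * t powr (- \<theta>)"
        using t by (simp add: powr_divide powr_minus field_simps)
      finally have 2: "norm (fcoef (phase \<sigma> u) n) \<le> 2 powr \<theta> * t powr e"
        by (simp only: te mult_ac)
      have "norm (fcoef (phase \<tau> u) n) \<le> norm (fcoef (phase \<tau> u) n - fcoef (phase \<sigma> u) n) + norm (fcoef (phase \<sigma> u) n)"
        using norm_triangle_sub[of "fcoef (phase \<tau> u) n" "fcoef (phase \<sigma> u) n"] by simp
      also have "\<dots> \<le> (2 powr \<theta> + L) * t powr e" using 1 2 by (simp add: algebra_simps)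
      also have "\<dots> \<le> M * t powr e" by (intro mult_right_mono M1) simp
      also have "\<dots> \<le> M * t powr e * jb n powr \<epsilon>"
        using mult_left_mono[OF jb1[of n], of "M * t powr e"] M1(1) by simp
      finally show ?thesis .
    qed
    then show ?thesis by (simp only: t_def)
  qed
  then show ?thesis unfolding phase_decay_def e_def by blast
qed

lemma AE_phase_decay:
  assumes \<alpha>: "0 < \<alpha>" "\<alpha> < 1" and \<epsilon>: "0 < \<epsilon>" "\<epsilon> \<le> 1" and v: "torus_integrable v"
  shows "AE \<omega> in rand_measure. \<exists>M. phase_decay \<alpha> \<epsilon> M (\<lambda>x. rfun \<alpha> \<omega> x - v x)"
proof -
  \<comment> \<open>The first bound makes the grid fine enough for interpolation in \<tau>, the
    second makes the frequency weight beat the trivial bound beyond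
    \<open>\<bar>\<tau>\<bar> ^ R\<close>.\<close>
  obtain R :: nat where R: "max (1 + 1 / (2 * \<alpha>)) (1 / (2 * \<alpha>) / (2 * \<epsilon>)) \<le> real R"
    using real_arch_simple by blast
  have R1: "1 + 1 / (2 * \<alpha>) \<le> real R" using R by simp
  have R2: "1 / (2 * \<alpha>) \<le> 2 * real R * \<epsilon>"
  proof -
    have "1 / (2 * \<alpha>) / (2 * \<epsilon>) \<le> real R" using R by simp
    then have "1 / (2 * \<alpha>) \<le> real R * (2 * \<epsilon>)"
      using \<epsilon> pos_divide_le_eq[of "2 * \<epsilon>" "1 / (2 * \<alpha>)" "real R"] by auto
    then show ?thesis by (simp only: mult_ac)
  qed
  have "0 < 1 / (2 * \<alpha>)" using \<alpha> by simp
  then have "0 < real R" using R1 by linarith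
  then have R0: "0 < R" by simp
  show ?thesis
    using AE_grid[OF \<alpha> \<epsilon> v R0]
  proof eventually_elim
    case (elim \<omega>)
    show ?case
      by (rule phase_decay_of_grid[OF torus_integrable_diff[OF torus_integrable_rfun[OF \<alpha>] v] \<alpha>(1) \<epsilon>(1) R1 R2 elim])
  qed
qed

section \<open>Prevalence\<close>

text \<open>The form of \<open>phase_decay\<close> for classes, with \<epsilon> and the constant
  restricted to countable families so that the good set stays Borel. Applying
  \<open>phase_mult\<close> to the constant 1 recovers the class of exp(-i\<tau>u).\<close>

definition decay_set :: "real \<Rightarrow> nat \<Rightarrow> nat \<Rightarrow> real torus_L1 set" where
  "decay_set \<alpha> j M = {u \<in> besov \<alpha>. \<forall>\<tau> n. 1 \<le> \<bar>\<tau>\<bar> \<longrightarrow>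
     norm (fourier_coeff (phase_mult \<tau> u (torus_class (\<lambda>_. 1))) n)
       \<le> real M * \<bar>\<tau>\<bar> powr (1 / real (Suc j) - 1 / (2 * \<alpha>)) * jb n powr (1 / real (Suc j))}"

lemma torus_integrable_one: "torus_integrable (\<lambda>_. 1 :: complex)"
  by (rule torus_integrable_bounded[of _ 1]) auto

lemma fourier_coeff_phase_class:
  "torus_integrable u \<Longrightarrow> fourier_coeff (phase_mult \<tau> (torus_class u) (torus_class (\<lambda>_. 1))) = fcoef (phase \<tau> u)"
  by (simp add: phase_mult_torus_class torus_integrable_one fourier_coeff_torus_class torus_integrable_phase)

lemma decay_set_class:
  "torus_integrable u \<Longrightarrow> torus_class u \<in> decay_set \<alpha> j M \<longleftrightarrow>
     torus_class u \<in> besov \<alpha> \<and> phase_decay \<alpha> (1 / real (Suc j)) (real M) u"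
  by (simp add: decay_set_def phase_decay_def fourier_coeff_phase_class)

lemma fourier_coeff_phase_diff_le:
  "norm (fourier_coeff (phase_mult \<tau> u (torus_class (\<lambda>_. 1))) n - fourier_coeff (phase_mult \<tau> w (torus_class (\<lambda>_. 1))) n)
     \<le> \<bar>\<tau>\<bar> * norm (u - w)"
proof -
  obtain u0 where u0: "torus_integrable u0" "u = torus_class u0" by (rule torus_class_cases)
  obtain w0 where w0: "torus_integrable w0" "w = torus_class w0" by (rule torus_class_cases)
  have n: "norm (u - w) = (TINT x. \<bar>u0 x - w0 x\<bar>)"
    using u0 w0 by (simp add: diff_torus_class norm_torus_class torus_integrable_diff)
  have "norm (fcoef (phase \<tau> u0) n - fcoef (phase \<tau> w0) n)
      \<le> (TINT x. \<bar>\<tau> * u0 x - \<tau> * w0 x\<bar>) / (2 * pi)"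
    by (rule fcoef_phase_diff_le[OF u0(1) w0(1)])
  also have "\<dots> = \<bar>\<tau>\<bar> * norm (u - w) / (2 * pi)"
    by (simp add: n abs_mult flip: right_diff_distrib)
  also have "\<dots> \<le> \<bar>\<tau>\<bar> * norm (u - w) / 1"
    using pi_ge_two by (intro divide_left_mono) auto
  finally show ?thesis using u0 w0 by (simp add: fourier_coeff_phase_class)
qed

abbreviation besov_borel :: "real \<Rightarrow> real torus_L1 measure" where
  "besov_borel \<alpha> \<equiv> norm_borel (besov \<alpha>) (besov_norm \<alpha>)"

lemma norm_le_besov_norm: "u \<in> besov \<alpha> \<Longrightarrow> norm u \<le> besov_norm \<alpha> u"
  unfolding besov_norm_def
  using enn2real_mono[of "ennreal (norm u)" "besov_enorm \<alpha> u"]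
  by (simp add: besov_def besov_enorm_def)

text \<open>Each condition is stable under small perturbations when violated: the coefficient is
  Lipschitz in the L^1 norm with constant |\<tau>|, and the Besov norm dominates the L^1
  norm.\<close>

lemma closedin_decay_set:
  "closedin (besov_topology \<alpha>) (decay_set \<alpha> j M)"
proof -
  interpret Metric_space "besov \<alpha>" "\<lambda>u v. besov_norm \<alpha> (u - v)" by (rule Metric_space_besov)
  let ?c = "\<lambda>\<tau> n u. fourier_coeff (phase_mult \<tau> u (torus_class (\<lambda>_. 1))) n"
  have "openin mtopology (besov \<alpha> - decay_set \<alpha> j M)"
    unfolding openin_mtopology
  proof (intro conjI allI impI ballI)
    fix u assume u: "u \<in> besov \<alpha> - decay_set \<alpha> j M"
    then obtain \<tau> n where \<tau>: "1 \<le> \<bar>\<tau>\<bar>"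
      "real M * \<bar>\<tau>\<bar> powr (1 / real (Suc j) - 1 / (2 * \<alpha>)) * jb n powr (1 / real (Suc j)) < norm (?c \<tau> n u)"
      unfolding decay_set_def not_le[symmetric] by blast
    define b where "b = real M * \<bar>\<tau>\<bar> powr (1 / real (Suc j) - 1 / (2 * \<alpha>)) * jb n powr (1 / real (Suc j))"
    define r where "r = (norm (?c \<tau> n u) - b) / \<bar>\<tau>\<bar>"
    have r: "0 < r" using \<tau> by (simp add: r_def b_def)
    have "mball u r \<subseteq> besov \<alpha> - decay_set \<alpha> j M"
    proof
      fix w assume "w \<in> mball u r"
      then have w: "w \<in> besov \<alpha>" "besov_norm \<alpha> (u - w) < r" by auto
      have "norm (u - w) < r"
        using norm_le_besov_norm[OF besov_diff, of u \<alpha> w] u w by simp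
      then have "\<bar>\<tau>\<bar> * norm (u - w) < \<bar>\<tau>\<bar> * r" using \<tau> by (intro mult_strict_left_mono) auto
      also have "\<dots> = norm (?c \<tau> n u) - b" using \<tau> by (simp add: r_def)
      finally have "norm (?c \<tau> n u - ?c \<tau> n w) < norm (?c \<tau> n u) - b"
        using fourier_coeff_phase_diff_le[of \<tau> u n w] by linarith
      then have "b < norm (?c \<tau> n w)"
        using norm_triangle_sub[of "?c \<tau> n u" "?c \<tau> n w"] by linarith
      then show "w \<in> besov \<alpha> - decay_set \<alpha> j M"
        using w \<tau>(1) unfolding decay_set_def b_def not_le[symmetric] by blast
    qed
    then show "\<exists>r>0. mball u r \<subseteq> besov \<alpha> - decay_set \<alpha> j M" using r by blast
  qed auto
  then show ?thesis
    unfolding closedin_def norm_topology_def by (auto simp: decay_set_def)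
qed

lemma topspace_norm_topology_besov [simp]: "topspace (besov_topology \<alpha>) = besov \<alpha>"
proof -
  interpret Metric_space "besov \<alpha>" "\<lambda>u v. besov_norm \<alpha> (u - v)" by (rule Metric_space_besov)
  show ?thesis by (simp add: norm_topology_def)
qed

lemma openin_subset_besov:
  "{U. openin (besov_topology \<alpha>) U} \<subseteq> Pow (besov \<alpha>)"
  using openin_subset by fastforce

lemma space_norm_borel_besov [simp]: "space (besov_borel \<alpha>) = besov \<alpha>"
  unfolding norm_borel_def by (rule space_measure_of[OF openin_subset_besov])

lemma closedin_sets_norm_borel:
  assumes "closedin (besov_topology \<alpha>) K"
  shows "K \<in> sets (besov_borel \<alpha>)"
proof -
  have "openin (besov_topology \<alpha>) (besov \<alpha> - K)" "K \<subseteq> besov \<alpha>"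
    using assms by (auto simp: closedin_def)
  then have "besov \<alpha> - K \<in> sets (besov_borel \<alpha>)"
    unfolding norm_borel_def sets_measure_of[OF openin_subset_besov] by (auto intro: sigma_sets.Basic)
  then have "besov \<alpha> - (besov \<alpha> - K) \<in> sets (besov_borel \<alpha>)"
    using sets.compl_sets by fastforce
  then show ?thesis using \<open>K \<subseteq> besov \<alpha>\<close> by (simp add: double_diff)
qed

lemma measurable_rfun_class:
  assumes \<alpha>: "0 < \<alpha>" "\<alpha> < 1"
  shows "(\<lambda>\<omega>. torus_class (rfun \<alpha> \<omega>)) \<in> rand_measure \<rightarrow>\<^sub>M besov_borel \<alpha>"
  unfolding norm_borel_def
proof (rule measurable_measure_of[OF openin_subset_besov])
  show "(\<lambda>\<omega>. torus_class (rfun \<alpha> \<omega>)) \<in> space rand_measure \<rightarrow> besov \<alpha>"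
    by (simp add: rfun_in_besov[OF \<alpha>])
  fix U assume "U \<in> {U. openin (besov_topology \<alpha>) U}"
  then have "open {\<omega>. torus_class (rfun \<alpha> \<omega>) \<in> U}" by (auto intro: open_vimage_rfun[OF \<alpha>])
  then show "(\<lambda>\<omega>. torus_class (rfun \<alpha> \<omega>)) -` U \<inter> space rand_measure \<in> sets rand_measure"
    by (simp add: vimage_def)
qed

theorem prevalent_mixing:
  assumes \<alpha>: "0 < \<alpha>" "\<alpha> < 1"
  shows "prevalent (besov \<alpha>) (besov_norm \<alpha>)
     {u \<in> besov \<alpha>. \<forall>\<beta>>\<alpha>. \<exists>r. mixing_on_scale (1 / 2) u r \<and> (\<exists>c>0. \<forall>t\<ge>1. r t \<ge> c * t powr (1 / (2 * \<beta>)))}"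
proof -
  let ?B = "besov_borel \<alpha>" and ?T = "besov_topology \<alpha>"
  let ?\<Psi> = "\<lambda>\<omega>. torus_class (rfun \<alpha> \<omega>)"
  interpret Metric_space "besov \<alpha>" "\<lambda>u v. besov_norm \<alpha> (u - v)" by (rule Metric_space_besov)
  interpret R: prob_space rand_measure by (rule prob_space_rand)
  define D where "D = (\<Inter>j. \<Union>M. decay_set \<alpha> j M)"
  define \<mu> where "\<mu> = distr rand_measure ?B ?\<Psi>"
  note meas = measurable_rfun_class[OF \<alpha>]
  have D: "D \<in> sets ?B"
  proof -
    have "(\<Union>M. decay_set \<alpha> j M) \<in> sets ?B" for j
      using closedin_sets_norm_borel[OF closedin_decay_set] by blast
    then show ?thesis unfolding D_def by (intro sets.countable_INT) auto
  qed
  have A: "besov \<alpha> - D \<in> sets ?B"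
    using sets.compl_sets[OF D] by simp
  have compact: "\<exists>K. compactin ?T K \<and> 0 < emeasure \<mu> K \<and> emeasure \<mu> K < \<infinity>"
  proof (intro exI conjI)
    show K: "compactin ?T (range ?\<Psi>)" by (rule compactin_range_rfun[OF \<alpha>])
    then have "closedin ?T (range ?\<Psi>)"
      by (rule compactin_imp_closedin[rotated]) (simp add: norm_topology_def Hausdorff_space_mtopology)
    then have "range ?\<Psi> \<in> sets ?B" by (rule closedin_sets_norm_borel)
    then have "emeasure \<mu> (range ?\<Psi>) = emeasure rand_measure (?\<Psi> -` range ?\<Psi> \<inter> space rand_measure)"
      unfolding \<mu>_def by (rule emeasure_distr[OF meas])
    also have "?\<Psi> -` range ?\<Psi> \<inter> space rand_measure = space rand_measure" by auto
    finally have "emeasure \<mu> (range ?\<Psi>) = 1" by (simp only: R.emeasure_space_1)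
    then show "0 < emeasure \<mu> (range ?\<Psi>)" "emeasure \<mu> (range ?\<Psi>) < \<infinity>" by simp_all
  qed
  have null: "emeasure \<mu> ((+) v ` (besov \<alpha> - D)) = 0" if v: "v \<in> besov \<alpha>" for v
  \<comment> \<open>Translation by v is an isometry of the Besov space, so the translate is in fact
    Borel. The case split replaces a proof of this: outside the sigma-algebra
    \<open>emeasure\<close> is 0 by default.\<close>
  proof (cases "(+) v ` (besov \<alpha> - D) \<in> sets ?B")
    case False
    then show ?thesis by (intro emeasure_notin_sets) (simp add: \<mu>_def)
  next
    case True
    obtain v0 where v0: "torus_integrable v0" "v = torus_class v0" by (rule torus_class_cases)
    have "AE \<omega> in rand_measure. \<forall>j. \<exists>M. phase_decay \<alpha> (1 / real (Suc j)) M (\<lambda>x. rfun \<alpha> \<omega> x - v0 x)"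
      unfolding AE_all_countable by (intro allI AE_phase_decay \<alpha> v0) auto
    \<comment> \<open>Membership of the random element in the translated exceptional set would mean
      that its difference with v lies outside D; the almost sure decay, for all \<epsilon> = 1/(j +
      1) at once, excludes this.\<close>
    then have ae: "AE \<omega> in rand_measure. \<not> ?\<Psi> \<omega> \<in> (+) v ` (besov \<alpha> - D)"
    proof eventually_elim
      case (elim \<omega>)
      have ti: "torus_integrable (\<lambda>x. rfun \<alpha> \<omega> x - v0 x)"
        by (intro torus_integrable_diff torus_integrable_rfun \<alpha> v0)
      have eq: "?\<Psi> \<omega> - v = torus_class (\<lambda>x. rfun \<alpha> \<omega> x - v0 x)"
        by (simp add: v0 diff_torus_class torus_integrable_rfun[OF \<alpha>])
      have inE: "?\<Psi> \<omega> - v \<in> besov \<alpha>" by (intro besov_diff rfun_in_besov \<alpha> v)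
      have "\<exists>M. ?\<Psi> \<omega> - v \<in> decay_set \<alpha> j M" for j
      proof -
        obtain M where M: "phase_decay \<alpha> (1 / real (Suc j)) M (\<lambda>x. rfun \<alpha> \<omega> x - v0 x)" using elim by blast
        \<comment> \<open>The real constant is rounded up because \<open>D\<close> is built from
          unions over natural numbers.\<close>
        have "phase_decay \<alpha> (1 / real (Suc j)) (real (nat \<lceil>M\<rceil>)) (\<lambda>x. rfun \<alpha> \<omega> x - v0 x)"
          unfolding phase_decay_def
        proof (intro allI impI)
          fix \<tau> :: real and n assume "1 \<le> \<bar>\<tau>\<bar>"
          then have "norm (fcoef (phase \<tau> (\<lambda>x. rfun \<alpha> \<omega> x - v0 x)) n)
             \<le> M * \<bar>\<tau>\<bar> powr (1 / real (Suc j) - 1 / (2 * \<alpha>)) * jb n powr (1 / real (Suc j))"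
            using M unfolding phase_decay_def by blast
          also have "\<dots> \<le> real (nat \<lceil>M\<rceil>) * \<bar>\<tau>\<bar> powr (1 / real (Suc j) - 1 / (2 * \<alpha>)) * jb n powr (1 / real (Suc j))"
            by (intro mult_right_mono real_nat_ceiling_ge) auto
          finally show "norm (fcoef (phase \<tau> (\<lambda>x. rfun \<alpha> \<omega> x - v0 x)) n)
             \<le> real (nat \<lceil>M\<rceil>) * \<bar>\<tau>\<bar> powr (1 / real (Suc j) - 1 / (2 * \<alpha>)) * jb n powr (1 / real (Suc j))" .
        qed
        then show ?thesis
          using inE unfolding eq decay_set_class[OF ti] by blast
      qed
      then have "?\<Psi> \<omega> - v \<in> D" by (auto simp: D_def)
      then show ?case by auto
    qed
    have "emeasure \<mu> ((+) v ` (besov \<alpha> - D)) = emeasure rand_measure (?\<Psi> -` ((+) v ` (besov \<alpha> - D)) \<inter> space rand_measure)"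
      unfolding \<mu>_def by (rule emeasure_distr[OF meas True])
    also have "?\<Psi> -` ((+) v ` (besov \<alpha> - D)) \<inter> space rand_measure
        = {\<omega> \<in> space rand_measure. ?\<Psi> \<omega> \<in> (+) v ` (besov \<alpha> - D)}" by auto
    also have "emeasure rand_measure \<dots> = 0" by (rule emeasure_eq_0_AE[OF ae])
    finally show ?thesis .
  qed
  have "shy_borel (besov \<alpha>) (besov_norm \<alpha>) (besov \<alpha> - D)"
    unfolding shy_borel_def using A compact null by (intro conjI exI[of _ \<mu>] ballI) (auto simp: \<mu>_def)
  moreover have "\<exists>r. mixing_on_scale (1 / 2) u r \<and> (\<exists>c>0. \<forall>t\<ge>1. r t \<ge> c * t powr (1 / (2 * \<beta>)))"
    if u: "u \<in> D" and \<beta>: "\<alpha> < \<beta>" for u \<beta>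
  proof -
    obtain u0 where u0: "torus_integrable u0" "u = torus_class u0" by (rule torus_class_cases)
    have "\<exists>M. phase_decay \<alpha> (1 / real (Suc j)) M u0" for j
      using u unfolding D_def u0(2) by (auto simp: decay_set_class[OF u0(1)])
    then show ?thesis unfolding u0(2) by (rule mixing_of_phase_decay[OF u0(1) \<alpha>(1) \<beta>])
  qed
  ultimately show ?thesis
    unfolding prevalent_def shy_def by (intro exI[of _ "besov \<alpha> - D"] conjI) auto
qed

theorem theorem1p4:
  fixes \<alpha> :: real
  assumes "0 < \<alpha>" and "\<alpha> < 1"
  shows "(\<forall>u r. u \<in> besov \<alpha> \<longrightarrow> mixing_on_scale (1 / 2) u r \<longrightarrow>
            (\<exists>C>0. \<forall>t\<ge>1. r t \<le> C * t powr (1 / (2 * \<alpha>)))) \<and>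
         prevalent (besov \<alpha>) (besov_norm \<alpha>)
           {u \<in> besov \<alpha>. \<forall>\<beta>>\<alpha>. \<exists>r. mixing_on_scale (1 / 2) u r \<and>
              (\<exists>c>0. \<forall>t\<ge>1. r t \<ge> c * t powr (1 / (2 * \<beta>)))}"
  using mixing_rate_le[OF assms(1)] prevalent_mixing[OF assms] by blast

end
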